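(* Let $D$ be the $2$-dimensional simplicial complex on the vertex set $\{1,\dots,8\}$ whose triangles are $$124,\ 234,\ 346,\ 136,\ 126,\ 256,\ 235,\ 135,\ 127,\ 147,\ 278,\ 457,\ 578,\ 238,\ 138,\ 158,\ 456$$ (a triangulation of the dunce hat), regarded as a subcomplex of the boundary complex of the cyclic $5$-polytope $C_5(8)$ with vertices $1,2,\dots,8$ in that order. Then a regular neighborhood of $D$ in the boundary complex of $C_5(8)$ is a contractible $4$-manifold with boundary, but it is not a $4$-ball since its boundary is not a $3$-sphere.
   Context: $C_5(8)$ is the cyclic $5$-polytope with $8$ vertices, i.e. the convex hull of $8$ distinct points on the moment curve $t\mapsto(t,t^2,t^3,t^4,t^5)$ in $\mathbb{R}^5$, labelled $1,\dots,8$ in increasing order of the parameter; its boundary complex is a simplicial (combinatorial) $4$-sphere. Every listed triangle is a face of $C_5(8)$. Here $abc$ denotes the triangle with vertices $a,b,c$. The dunce hat is the $2$-dimensional space obtained from a triangle by identifying its three sides, with one side in reversed orientation. "Regular neighborhood" is in the sense of PL topology (e.g. the union of all closed simplices of the second barycentric subdivision of the boundary complex that meet $D$). *)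

theory Defs
  imports "HOL-Analysis.Analysis"
begin

section \<open>Cyclic polytopes and boundary complexes\<close>

definition moment_curve :: "real \<Rightarrow> real ^ 5"
  where "moment_curve s = vector [s, s ^ 2, s ^ 3, s ^ 4, s ^ 5]"

text \<open>Vertex \<open>i\<close> of the polytope is \<open>moment_curve (t i)\<close>. The labelling is in increasing order
  of the parameter exactly when \<open>t\<close> is strictly monotone on \<open>{1..n}\<close>.\<close>

definition cyclic_polytope :: "(nat \<Rightarrow> real) \<Rightarrow> nat \<Rightarrow> (real ^ 5) set"
  where "cyclic_polytope t n = convex hull ((\<lambda>i. moment_curve (t i)) ` {1..n})"

text \<open>As in the library's \<^const>\<open>simplicial_complex\<close>, a geometric complex is a set of closed
  cells, and the empty face belongs to it.\<close>

definition boundary_complex :: "'a::euclidean_space set \<Rightarrow> 'a set set"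
  where "boundary_complex P = {F. F face_of P \<and> F \<noteq> P}"


section \<open>Barycentric subdivision and regular neighborhoods\<close>

text \<open>The vertices of a simplex are its extreme points.\<close>

definition barycenter :: "'a::euclidean_space set \<Rightarrow> 'a"
  where "barycenter S = (\<Sum>v | v extreme_point_of S. v) /\<^sub>R real (card {v. v extreme_point_of S})"

text \<open>The simplices of the subdivision are spanned by the barycenters of chains
  \<open>S\<^sub>0 \<subset> \<dots> \<subset> S\<^sub>k\<close> of nonempty simplices. The empty chain gives the empty simplex.\<close>

definition barycentric_subdivision :: "'a::euclidean_space set set \<Rightarrow> 'a set set"
  where "barycentric_subdivision K =
    {convex hull (barycenter ` C) | C.
       finite C \<and> C \<subseteq> K - {{}} \<and> (\<forall>S\<in>C. \<forall>T\<in>C. S \<subseteq> T \<or> T \<subseteq> S)}"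

text \<open>The standard PL model of a regular neighborhood of a subpolyhedron \<open>X\<close> of the polyhedron
  \<open>\<Union>K\<close>. Every other regular neighborhood of \<open>X\<close> is PL homeomorphic to this one.\<close>

definition regular_neighborhood :: "'a::euclidean_space set set \<Rightarrow> 'a set \<Rightarrow> 'a set"
  where "regular_neighborhood K X =
    \<Union>{S \<in> barycentric_subdivision (barycentric_subdivision K). S \<inter> X \<noteq> {}}"


section \<open>Four-manifolds with boundary\<close>

definition half_space4 :: "(real ^ 4) set"
  where "half_space4 = {x. 0 \<le> x $ 1}"

text \<open>A chart maps a relatively open subset \<open>U\<close> of \<open>M\<close> onto a relatively open subset of the closed
  half-space. A set that misses the bounding hyperplane is an ordinary open set of \<open>\<real>\<^sup>4\<close>, so
  interior charts are included.\<close>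

definition chart4 :: "'a::euclidean_space set \<Rightarrow> 'a set \<Rightarrow> ('a \<Rightarrow> real ^ 4) \<Rightarrow> bool"
  where "chart4 M U h \<longleftrightarrow> openin (top_of_set M) U \<and>
    (\<exists>V k. openin (top_of_set half_space4) V \<and> homeomorphism U V h k)"

text \<open>Subsets of a Euclidean space are Hausdorff and second countable, so only the local
  condition has to be required.\<close>

definition four_manifold_with_boundary :: "'a::euclidean_space set \<Rightarrow> bool"
  where "four_manifold_with_boundary M \<longleftrightarrow> (\<forall>p\<in>M. \<exists>U h. p \<in> U \<and> chart4 M U h)"

definition four_manifold_boundary :: "'a::euclidean_space set \<Rightarrow> 'a set"
  where "four_manifold_boundary M = {p \<in> M. \<exists>U h. p \<in> U \<and> chart4 M U h \<and> h p $ 1 = 0}"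


section \<open>The dunce hat\<close>

definition dunce_triangle :: "(real \<times> real) set"
  where "dunce_triangle = convex hull {(0, 0), (1, 0), (0, 1)}"

text \<open>With \<open>a = (0, 0)\<close>, \<open>b = (1, 0)\<close>, \<open>c = (0, 1)\<close>, running once around the triangle traverses
  the sides \<open>ab\<close>, \<open>bc\<close>, \<open>ca\<close>. The sides \<open>ab\<close> and \<open>bc\<close> are glued in this direction and the third
  one in the reversed direction \<open>ac\<close>.\<close>

inductive dunce_glue :: "real \<times> real \<Rightarrow> real \<times> real \<Rightarrow> bool" where
  "0 \<le> s \<Longrightarrow> s \<le> 1 \<Longrightarrow> dunce_glue (linepath (0, 0) (1, 0) s) (linepath (1, 0) (0, 1) s)"
| "0 \<le> s \<Longrightarrow> s \<le> 1 \<Longrightarrow> dunce_glue (linepath (0, 0) (1, 0) s) (linepath (0, 0) (0, 1) s)"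

text \<open>\<open>X\<close> is homeomorphic to the quotient of the triangle by the equivalence relation generated
  by the gluing.\<close>

definition is_dunce_hat :: "'a::topological_space set \<Rightarrow> bool"
  where "is_dunce_hat X \<longleftrightarrow>
    (\<exists>q. quotient_map (top_of_set dunce_triangle) (top_of_set X) q \<and>
      (\<forall>x\<in>dunce_triangle. \<forall>y\<in>dunce_triangle. q x = q y \<longleftrightarrow> equivclp dunce_glue x y))"

definition dunce_triangles :: "nat set set"
  where "dunce_triangles =
    {{1,2,4}, {2,3,4}, {3,4,6}, {1,3,6}, {1,2,6}, {2,5,6}, {2,3,5}, {1,3,5}, {1,2,7},
     {1,4,7}, {2,7,8}, {4,5,7}, {5,7,8}, {2,3,8}, {1,3,8}, {1,5,8}, {4,5,6}}"

text \<open>The complex consists of the listed triangles and all their faces, placed on the vertices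
  of the cyclic polytope.\<close>

definition dunce_complex :: "(nat \<Rightarrow> real) \<Rightarrow> (real ^ 5) set set"
  where "dunce_complex t =
    {F. \<exists>T\<in>dunce_triangles. F face_of convex hull ((\<lambda>i. moment_curve (t i)) ` T)}"

end

theory Submission
  imports Defs "HOL-Computational_Algebra.Polynomial" "HOL-Library.Countable"
begin

text \<open>In barycentric coordinates of the first subdivision, let \<open>inner p\<close> be the largest coordinate of
  \<open>p\<close> at a simplex of \<open>D\<close> and \<open>outer p\<close> the largest one at a simplex outside \<open>D\<close>. The
  neighborhood is \<open>{p. outer p \<le> inner p}\<close>. Both functions are linear on the simplices of the second
  subdivision, and increasing one barycenter coordinate at the cost of another moves \<open>p\<close> across the
  level set \<open>{p. outer p = inner p}\<close>. This yields half-space charts, so the level set is the boundary.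
  Scaling the outer coordinates to zero deforms the neighborhood onto \<open>D\<close>. Adding the simplices 358 and 1358
  to \<open>D\<close> is an elementary expansion, and the result also arises from a vertex by elementary
  expansions. Hence \<open>D\<close> and the neighborhood are contractible.

  The boundary is not simply connected: it carries a local system with seven sheets. The system
  is trivial on the pieces of the boundary lying over a pair of a vertex of \<open>D\<close> and a facet of the polytope,
  so it is given by finitely many transition permutations, and consistency is a finite check. Its holonomy around
  the triangle 145 has no fixed point, while on a simply connected space there would be a global section.

  To recognize the dunce hat, a triangulated triangle is folded simplicially onto \<open>D\<close>. Two faces have
  the same image only if both lie on the sides, where the folding is the prescribed gluing.\<close>

section \<open>Geometric simplicial complexes\<close>

text \<open>The dunce hat has no free edge, so no collapse can start and an expansion must come
  first. The tetrahedron 1358 used for it is not a face of the polytope: it runs through the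
  interior, and the boundary complex together with it is still a geometric complex.

  The boundary of a compact contractible 4-manifold has the homology of the 3-sphere. Hence its
  fundamental group is perfect, and no abelian invariant can tell it from the sphere. A finite
  covering with nonsolvable monodromy is a tool that remains, and seven sheets are enough here.
  Instead of computing the fundamental group, a covering space is assembled from charts and
  transition permutations; over a simply connected base it would have a section.

  Instead of recognizing links of simplices as spheres, the charts rely on convexity: the complex
  lies on the boundary of a convex body, so invariance of domain makes injective continuous maps
  from open subsets of it into \<open>real ^ 4\<close> open.\<close>

definition weights :: "'v set set \<Rightarrow> ('v \<Rightarrow> real) set"
  where "weights \<K> = {w. (\<forall>v. 0 \<le> w v) \<and> {v. w v \<noteq> 0} \<in> \<K> \<and> (\<Sum>v | w v \<noteq> 0. w v) = 1}"

definition bary_point :: "('v \<Rightarrow> 'a::real_vector) \<Rightarrow> ('v \<Rightarrow> real) \<Rightarrow> 'a"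
  where "bary_point b w = (\<Sum>v | w v \<noteq> 0. w v *\<^sub>R b v)"

definition realization :: "('v \<Rightarrow> 'a::real_vector) \<Rightarrow> 'v set set \<Rightarrow> 'a set"
  where "realization b \<K> = (\<Union>C\<in>\<K>. convex hull (b ` C))"

lemma bary_point_superset:
  assumes "finite A" "\<And>v. w v \<noteq> 0 \<Longrightarrow> v \<in> A"
  shows "bary_point b w = (\<Sum>v\<in>A. w v *\<^sub>R b v)"
  unfolding bary_point_def by (rule sum.mono_neutral_left) (use assms in auto)

lemma weights_sum_superset:
  assumes "w \<in> weights \<K>" "finite A" "\<And>v. w v \<noteq> 0 \<Longrightarrow> v \<in> A"
  shows "sum w A = 1"
proof -
  have "sum w A = (\<Sum>v | w v \<noteq> 0. w v)"
    by (rule sum.mono_neutral_right) (use assms in auto)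
  then show ?thesis using assms(1) by (simp add: weights_def)
qed

lemma weights_mono: "\<K> \<subseteq> \<L> \<Longrightarrow> weights \<K> \<subseteq> weights \<L>"
  by (auto simp: weights_def)

lemma weights_PowI:
  assumes "finite C" "\<And>v. 0 \<le> w v" "\<And>v. v \<notin> C \<Longrightarrow> w v = 0" "sum w C = 1"
  shows "w \<in> weights (Pow C)"
proof -
  have "(\<Sum>v | w v \<noteq> 0. w v) = sum w C"
    by (rule sum.mono_neutral_left) (use assms in auto)
  then show ?thesis using assms by (auto simp: weights_def)
qed

lemma convex_hull_image_weights:
  assumes "finite C"
  shows "convex hull (b ` C) = bary_point b ` weights (Pow C)"
proof
  have eq: "bary_point b ` weights (Pow C)
     = {\<Sum>v\<in>C. w v *\<^sub>R b v | w. (\<forall>v\<in>C. 0 \<le> w v) \<and> sum w C = 1}" (is "_ = ?R")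
  proof (intro set_eqI iffI)
    fix x assume "x \<in> bary_point b ` weights (Pow C)"
    then obtain w where w: "w \<in> weights (Pow C)" "x = bary_point b w" by auto
    have "\<And>v. w v \<noteq> 0 \<Longrightarrow> v \<in> C" using w(1) by (auto simp: weights_def)
    then have "x = (\<Sum>v\<in>C. w v *\<^sub>R b v)" "sum w C = 1"
      using w weights_sum_superset[OF w(1) assms] bary_point_superset[OF assms, of w b] by auto
    then show "x \<in> ?R" using w(1) by (auto simp: weights_def)
  next
    fix x assume "x \<in> ?R"
    then obtain w where w: "x = (\<Sum>v\<in>C. w v *\<^sub>R b v)" "\<forall>v\<in>C. 0 \<le> w v" "sum w C = 1" by auto
    let ?w = "\<lambda>v. if v \<in> C then w v else 0"
    have "?w \<in> weights (Pow C)"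
      by (rule weights_PowI) (use assms w in auto)
    moreover have "x = bary_point b ?w"
      by (subst bary_point_superset[OF assms]) (auto simp: w(1) split: if_splits intro!: sum.cong)
    ultimately show "x \<in> bary_point b ` weights (Pow C)" by blast
  qed
  show "convex hull (b ` C) \<subseteq> bary_point b ` weights (Pow C)"
  proof (rule hull_minimal)
    show "convex (bary_point b ` weights (Pow C))"
      unfolding eq
    proof (rule convexI)
      fix x y and u v :: real
      assume xy: "x \<in> ?R" "y \<in> ?R" and uv: "0 \<le> u" "0 \<le> v" "u + v = 1"
      obtain w where w: "x = (\<Sum>v\<in>C. w v *\<^sub>R b v)" "\<forall>v\<in>C. 0 \<le> w v" "sum w C = 1" using xy by auto
      obtain w' where w': "y = (\<Sum>v\<in>C. w' v *\<^sub>R b v)" "\<forall>v\<in>C. 0 \<le> w' v" "sum w' C = 1" using xy by auto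
      let ?z = "\<lambda>i. u * w i + v * w' i"
      have "u *\<^sub>R x + v *\<^sub>R y = (\<Sum>i\<in>C. ?z i *\<^sub>R b i)"
        by (simp add: w w' scaleR_sum_right scaleR_add_left sum.distrib)
      moreover have "sum ?z C = 1"
        using w w' uv by (simp add: sum.distrib sum_distrib_left[symmetric])
      moreover have "\<forall>i\<in>C. 0 \<le> ?z i" using w w' uv by auto
      ultimately have "\<exists>w. u *\<^sub>R x + v *\<^sub>R y = (\<Sum>i\<in>C. w i *\<^sub>R b i) \<and> (\<forall>i\<in>C. 0 \<le> w i) \<and> sum w C = 1"
        by (intro exI[of _ ?z]) auto
      then show "u *\<^sub>R x + v *\<^sub>R y \<in> ?R" by simp
    qed
    show "b ` C \<subseteq> bary_point b ` weights (Pow C)"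
    proof
      fix x assume "x \<in> b ` C"
      then obtain v where v: "v \<in> C" "x = b v" by auto
      let ?w = "\<lambda>i. if i = v then 1 else (0::real)"
      have "?w \<in> weights (Pow C)" by (rule weights_PowI) (use assms v in auto)
      moreover have "bary_point b ?w = x"
        by (subst bary_point_superset[OF assms]) (use v assms in \<open>auto split: if_splits simp: if_distrib[of "\<lambda>c. c *\<^sub>R _"] cong: if_cong\<close>)
      ultimately show "x \<in> bary_point b ` weights (Pow C)" by blast
    qed
  qed
  show "bary_point b ` weights (Pow C) \<subseteq> convex hull (b ` C)"
    unfolding eq using assms
    by (auto intro!: convex_sum simp: hull_inc)
qed

lemma realization_weights:
  assumes "\<And>C. C \<in> \<K> \<Longrightarrow> finite C" "\<And>C C'. C \<in> \<K> \<Longrightarrow> C' \<subseteq> C \<Longrightarrow> C' \<in> \<K>"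
  shows "realization b \<K> = bary_point b ` weights \<K>"
proof -
  have "weights \<K> = (\<Union>C\<in>\<K>. weights (Pow C))"
    using assms(2) by (auto simp: weights_def)
  then show ?thesis
    unfolding realization_def using convex_hull_image_weights[OF assms(1), of _ b]
    by (simp add: image_UN)
qed

text \<open>Injectivity of \<open>bary_point\<close> on all of \<open>weights \<K>\<close> encodes
  both geometric axioms at once: every simplex is affinely independent, and two simplices meet
  exactly in the simplex on their common vertices.\<close>

locale geometric_complex =
  fixes b :: "'v \<Rightarrow> 'a::euclidean_space" and \<K> :: "'v set set"
  assumes finite_complex: "finite \<K>"
    and finite_simplex: "C \<in> \<K> \<Longrightarrow> finite C"
    and face_closed: "C \<in> \<K> \<Longrightarrow> C' \<subseteq> C \<Longrightarrow> C' \<in> \<K>"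
    and inj_bary_point: "inj_on (bary_point b) (weights \<K>)"
begin

definition coord :: "'a \<Rightarrow> 'v \<Rightarrow> real"
  where "coord p = inv_into (weights \<K>) (bary_point b) p"

lemma finite_vertices: "finite (\<Union>\<K>)"
  using finite_complex finite_simplex by auto

lemma realization_eq: "realization b \<K> = bary_point b ` weights \<K>"
  by (rule realization_weights) (use finite_simplex face_closed in auto)

lemma coord_bary_point: "w \<in> weights \<K> \<Longrightarrow> coord (bary_point b w) = w"
  unfolding coord_def by (rule inv_into_f_f[OF inj_bary_point])

lemma coord_weights: "p \<in> realization b \<K> \<Longrightarrow> coord p \<in> weights \<K>"
  unfolding coord_def realization_eq by (rule inv_into_into)

lemma bary_point_coord: "p \<in> realization b \<K> \<Longrightarrow> bary_point b (coord p) = p"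
  unfolding coord_def realization_eq by (rule f_inv_into_f[of _ "bary_point b"])

lemma coord_nonneg: "p \<in> realization b \<K> \<Longrightarrow> 0 \<le> coord p v"
  using coord_weights by (auto simp: weights_def)

lemma coord_support: "p \<in> realization b \<K> \<Longrightarrow> {v. coord p v \<noteq> 0} \<in> \<K>"
  using coord_weights by (auto simp: weights_def)

lemma coord_outside: "p \<in> realization b \<K> \<Longrightarrow> v \<notin> \<Union>\<K> \<Longrightarrow> coord p v = 0"
  using coord_support by auto

lemma coord_sum: "p \<in> realization b \<K> \<Longrightarrow> sum (coord p) (\<Union>\<K>) = 1"
  by (rule weights_sum_superset[OF coord_weights]) (use finite_vertices coord_outside in auto)

lemma convex_hull_eq_support:
  assumes "C \<in> \<K>"
  shows "convex hull (b ` C) = {p \<in> realization b \<K>. {v. coord p v \<noteq> 0} \<subseteq> C}"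
proof (intro set_eqI iffI)
  fix p assume "p \<in> convex hull (b ` C)"
  then obtain w where w: "w \<in> weights (Pow C)" "p = bary_point b w"
    using convex_hull_image_weights[OF finite_simplex[OF assms], of b] by auto
  have "w \<in> weights \<K>" using w face_closed[OF assms] by (auto simp: weights_def)
  then show "p \<in> {p \<in> realization b \<K>. {v. coord p v \<noteq> 0} \<subseteq> C}"
    using w coord_bary_point realization_eq by (auto simp: weights_def)
next
  fix p assume p: "p \<in> {p \<in> realization b \<K>. {v. coord p v \<noteq> 0} \<subseteq> C}"
  then have "coord p \<in> weights (Pow C)" using coord_weights by (auto simp: weights_def)
  then show "p \<in> convex hull (b ` C)"
    using convex_hull_image_weights[OF finite_simplex[OF assms], of b] p bary_point_coord
    by (metis (no_types, lifting) image_eqI mem_Collect_eq)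
qed

lemma realization_subcomplex:
  assumes "\<L> \<subseteq> \<K>" "\<And>C C'. C \<in> \<L> \<Longrightarrow> C' \<subseteq> C \<Longrightarrow> C' \<in> \<L>"
  shows "realization b \<L> = {p \<in> realization b \<K>. {v. coord p v \<noteq> 0} \<in> \<L>}"
proof -
  have "realization b \<L> = (\<Union>C\<in>\<L>. {p \<in> realization b \<K>. {v. coord p v \<noteq> 0} \<subseteq> C})"
    unfolding realization_def[of b \<L>] using assms(1) convex_hull_eq_support
    by (intro SUP_cong) auto
  also have "\<dots> = {p \<in> realization b \<K>. {v. coord p v \<noteq> 0} \<in> \<L>}"
    using assms(2) by blast
  finally show ?thesis .
qed

text \<open>Over a simplex the graph of a coordinate is the convex hull of its values at the vertices.
  Hence the whole graph is compact.\<close>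

lemma continuous_on_coord: "continuous_on (realization b \<K>) (\<lambda>p. coord p v)"
proof (rule continuous_from_closed_graph[where T = "{0..1}"])
  let ?g = "\<lambda>u. (b u, if u = v then 1 else (0::real))"
  show "compact {0..1::real}" by simp
  show "(\<lambda>p. coord p v) \<in> realization b \<K> \<rightarrow> {0..1}"
  proof
    fix p assume p: "p \<in> realization b \<K>"
    have "coord p v \<le> 1"
    proof (cases "v \<in> \<Union>\<K>")
      case True
      have "coord p v \<le> sum (coord p) (\<Union>\<K>)"
        by (rule member_le_sum) (use True finite_vertices coord_nonneg[OF p] in auto)
      then show ?thesis using coord_sum[OF p] by simp
    qed (use coord_outside[OF p] in auto)
    then show "coord p v \<in> {0..1}" using coord_nonneg[OF p] by auto
  qed
  have snd_sum: "bary_point ?g w = (bary_point b w, w v)" if "w \<in> weights \<K>" for w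
  proof -
    have fin: "finite {u. w u \<noteq> 0}" using that finite_simplex by (auto simp: weights_def)
    have "bary_point ?g w = (\<Sum>u | w u \<noteq> 0. (w u *\<^sub>R b u, if u = v then w u else 0))"
      unfolding bary_point_def by (rule sum.cong) auto
    also have "\<dots> = (bary_point b w, \<Sum>u | w u \<noteq> 0. if u = v then w u else 0)"
      by (simp add: bary_point_def sum_prod)
    also have "(\<Sum>u | w u \<noteq> 0. if u = v then w u else 0) = w v" using fin by simp
    finally show ?thesis .
  qed
  have "(\<lambda>p. (p, coord p v)) ` realization b \<K> = bary_point ?g ` weights \<K>"
    unfolding realization_eq image_image by (rule image_cong) (auto simp: coord_bary_point snd_sum)
  also have "\<dots> = realization ?g \<K>"
    by (rule realization_weights[symmetric]) (use finite_simplex face_closed in auto)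
  finally have "(\<lambda>p. (p, coord p v)) ` realization b \<K> = realization ?g \<K>" .
  moreover have "compact (realization ?g \<K>)"
    unfolding realization_def using finite_complex finite_simplex
    by (intro compact_UN) (auto intro: finite_imp_compact_convex_hull)
  ultimately have "closed ((\<lambda>p. (p, coord p v)) ` realization b \<K>)"
    by (simp add: compact_imp_closed)
  then show "closed ((\<lambda>p. (p, coord p v)) ` realization b \<K>)" .
qed

lemma bary_point_single: "bary_point b (\<lambda>u. if u = v then 1 else 0) = b v"
  by (simp add: bary_point_def)

lemma single_weights: "{v} \<in> \<K> \<Longrightarrow> (\<lambda>u. if u = v then 1 else 0) \<in> weights \<K>"
  by (simp add: weights_def)

lemma coord_vertex: "{v} \<in> \<K> \<Longrightarrow> coord (b v) = (\<lambda>u. if u = v then 1 else 0)"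
  using coord_bary_point[OF single_weights] by (simp add: bary_point_single)

lemma vertex_in: "{v} \<in> \<K> \<Longrightarrow> b v \<in> realization b \<K>"
  using single_weights realization_eq bary_point_single by (metis image_eqI)

lemma inj_on_vertices: "C \<in> \<K> \<Longrightarrow> inj_on b C"
proof (rule inj_onI)
  fix u v assume "C \<in> \<K>" "u \<in> C" "v \<in> C" "b u = b v"
  then have "{u} \<in> \<K>" "{v} \<in> \<K>" "b u = b v" using face_closed by auto
  then have "(if v = u then 1 else (0::real)) = 1"
    using coord_vertex[of u] coord_vertex[of v] by metis
  then show "u = v" by (auto split: if_splits)
qed

text \<open>An affine dependence splits into a positive and a negative part of equal total. Both,
  divided by that total \<open>S\<close>, are weights of the same point, against
  injectivity.\<close>

lemma affine_independent_simplex: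
  assumes "C \<in> \<K>"
  shows "\<not> affine_dependent (b ` C)"
proof
  have fC: "finite C" using finite_simplex assms by auto
  assume "affine_dependent (b ` C)"
  then obtain U where U: "sum U (b ` C) = 0" "\<exists>x\<in>b ` C. U x \<noteq> 0" "(\<Sum>x\<in>b ` C. U x *\<^sub>R x) = 0"
    using affine_dependent_explicit_finite[of "b ` C"] fC by auto
  define c where "c v = (if v \<in> C then U (b v) else 0)" for v
  have inj: "inj_on b C" using inj_on_vertices assms .
  have c0: "sum c C = 0" and cb: "(\<Sum>v\<in>C. c v *\<^sub>R b v) = 0" and cn: "\<exists>v\<in>C. c v \<noteq> 0"
    using U by (auto simp: c_def sum.reindex[OF inj])
  define S where "S = (\<Sum>v\<in>C. max (c v) 0)"
  have S': "(\<Sum>v\<in>C. max (- c v) 0) = S"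
  proof -
    have "(\<Sum>v\<in>C. max (c v) 0) - (\<Sum>v\<in>C. max (- c v) 0) = (\<Sum>v\<in>C. c v)"
      unfolding sum_subtractf[symmetric] by (rule sum.cong) auto
    then show ?thesis using c0 by (simp add: S_def)
  qed
  have "S > 0"
  proof -
    obtain v where v: "v \<in> C" "c v \<noteq> 0" using cn by auto
    show ?thesis
    proof (cases "c v > 0")
      case True
      then show ?thesis unfolding S_def by (intro sum_pos2[OF fC v(1)]) auto
    next
      case False
      then show ?thesis unfolding S'[symmetric] using v by (intro sum_pos2[OF fC v(1)]) auto
    qed
  qed
  \<comment> \<open>\<open>s = 1\<close> selects the positive part of \<open>c\<close> and
    \<open>s = - 1\<close> the negative one.\<close>
  have W: "(\<lambda>v. max (s * c v) 0 / S) \<in> weights \<K>" and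
    B: "bary_point b (\<lambda>v. max (s * c v) 0 / S) = (\<Sum>v\<in>C. max (s * c v) 0 *\<^sub>R b v) /\<^sub>R S"
    if "s = 1 \<or> s = - 1" for s
  proof -
    let ?w = "\<lambda>v. max (s * c v) 0 / S"
    have "?w \<in> weights (Pow C)"
    proof (rule weights_PowI[OF fC])
      show "sum ?w C = 1"
        unfolding sum_divide_distrib[symmetric] using that S' \<open>S > 0\<close> by (auto simp: S_def)
    qed (use \<open>S > 0\<close> in \<open>auto simp: c_def\<close>)
    then show "?w \<in> weights \<K>" using weights_mono[of "Pow C" \<K>] face_closed[OF assms] by auto
    have "bary_point b ?w = (\<Sum>v\<in>C. ?w v *\<^sub>R b v)"
      by (rule bary_point_superset[OF fC]) (auto simp: c_def split: if_splits)
    then show "bary_point b ?w = (\<Sum>v\<in>C. max (s * c v) 0 *\<^sub>R b v) /\<^sub>R S"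
      by (simp add: scaleR_sum_right divide_inverse mult.commute)
  qed
  have "(\<Sum>v\<in>C. max (1 * c v) 0 *\<^sub>R b v) - (\<Sum>v\<in>C. max (- 1 * c v) 0 *\<^sub>R b v) = (\<Sum>v\<in>C. c v *\<^sub>R b v)"
    unfolding sum_subtractf[symmetric] scaleR_left_diff_distrib[symmetric]
    by (rule sum.cong) auto
  then have "bary_point b (\<lambda>v. max (1 * c v) 0 / S) = bary_point b (\<lambda>v. max (- 1 * c v) 0 / S)"
    using B[of 1] B[of "- 1"] cb by simp
  then have "(\<lambda>v. max (1 * c v) 0 / S) = (\<lambda>v. max (- 1 * c v) 0 / S)"
    using inj_onD[OF inj_bary_point] W by blast
  then have "c v = 0" for v
    using \<open>S > 0\<close> by (auto dest!: fun_cong[of _ _ v] simp: max_def split: if_splits)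
  then show False using cn by simp
qed

lemma extreme_points_simplex:
  assumes "C \<in> \<K>"
  shows "{x. x extreme_point_of (convex hull (b ` C))} = b ` C"
  using extreme_point_of_convex_hull_affine_independent[OF affine_independent_simplex[OF assms]]
  by auto

lemma barycenter_simplex:
  assumes "C \<in> \<K>"
  shows "barycenter (convex hull (b ` C)) = (\<Sum>v\<in>C. b v) /\<^sub>R real (card C)"
  unfolding barycenter_def extreme_points_simplex[OF assms]
  by (simp add: card_image[OF inj_on_vertices[OF assms]] sum.reindex[OF inj_on_vertices[OF assms]])

lemma convex_hull_subset_iff:
  assumes "C \<in> \<K>" "C' \<in> \<K>"
  shows "convex hull (b ` C) \<subseteq> convex hull (b ` C') \<longleftrightarrow> C \<subseteq> C'"
proof
  assume sub: "convex hull (b ` C) \<subseteq> convex hull (b ` C')"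
  show "C \<subseteq> C'"
  proof
    fix v assume v: "v \<in> C"
    then have "b v \<in> convex hull (b ` C')" using sub by (auto simp: hull_inc)
    then have "{u. coord (b v) u \<noteq> 0} \<subseteq> C'" using convex_hull_eq_support[OF assms(2)] by auto
    moreover have "{v} \<in> \<K>" using v assms face_closed by auto
    ultimately show "v \<in> C'" using coord_vertex by auto
  qed
next
  assume "C \<subseteq> C'"
  then show "convex hull (b ` C) \<subseteq> convex hull (b ` C')" by (intro hull_mono image_mono)
qed

end

section \<open>Barycentric subdivision\<close>

definition simplices :: "('v \<Rightarrow> 'a::real_vector) \<Rightarrow> 'v set set \<Rightarrow> 'a set set"
  where "simplices b \<K> = (\<lambda>C. convex hull (b ` C)) ` \<K>"

definition chains :: "'v set set \<Rightarrow> 'v set set set"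
  where "chains \<K> = {C. C \<subseteq> \<K> - {{}} \<and> (\<forall>S\<in>C. \<forall>T\<in>C. S \<subseteq> T \<or> T \<subseteq> S)}"

definition centroid :: "('v \<Rightarrow> 'a::real_vector) \<Rightarrow> 'v set \<Rightarrow> 'a"
  where "centroid b S = (\<Sum>v\<in>S. b v) /\<^sub>R real (card S)"

text \<open>Passes from coordinates with respect to the barycenters to coordinates with respect to the
  original vertices.\<close>

definition flatten :: "('v set \<Rightarrow> real) \<Rightarrow> 'v \<Rightarrow> real"
  where "flatten w v = (\<Sum>S | w S \<noteq> 0. if v \<in> S then w S / real (card S) else 0)"

lemma Union_realization: "\<Union>(simplices b \<K>) = realization b \<K>"
  by (simp add: simplices_def realization_def)

lemma flatten_superset:
  assumes "finite A" "\<And>S. w S \<noteq> 0 \<Longrightarrow> S \<in> A"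
  shows "flatten w v = (\<Sum>S\<in>A. if v \<in> S then w S / real (card S) else 0)"
  unfolding flatten_def by (rule sum.mono_neutral_left) (use assms in auto)

lemma chain_Union_in:
  assumes "finite C" "C \<noteq> {}" "\<forall>S\<in>C. \<forall>T\<in>C. S \<subseteq> T \<or> T \<subseteq> S"
  shows "\<Union>C \<in> C"
  using assms by (intro Union_in_chain) (auto simp: subset_chain_def)

section \<open>Recovering a chain from its flattened coordinates\<close>

context
  fixes w :: "'v set \<Rightarrow> real"
  assumes fin: "finite {S. w S \<noteq> 0}"
    and nonneg: "\<And>S. 0 \<le> w S"
    and chain: "\<And>S T. w S \<noteq> 0 \<Longrightarrow> w T \<noteq> 0 \<Longrightarrow> S \<subseteq> T \<or> T \<subseteq> S"
    and simplex: "\<And>S. w S \<noteq> 0 \<Longrightarrow> finite S \<and> S \<noteq> {}"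
begin

lemma flatten_support: "{v. flatten w v \<noteq> 0} = \<Union>{S. w S \<noteq> 0}"
proof (intro set_eqI iffI)
  fix v assume "v \<in> \<Union>{S. w S \<noteq> 0}"
  then obtain S where S: "w S \<noteq> 0" "v \<in> S" by auto
  then have "0 < w S / real (card S)"
    using nonneg[of S] simplex[of S] by (auto simp: card_gt_0_iff intro!: divide_pos_pos)
  then have "0 < flatten w v"
    unfolding flatten_def using S nonneg
    by (intro sum_pos2[OF fin, of S]) auto
  then show "v \<in> {v. flatten w v \<noteq> 0}" by simp
next
  fix v assume "v \<in> {v. flatten w v \<noteq> 0}"
  then have "(\<Sum>S | w S \<noteq> 0. if v \<in> S then w S / real (card S) else 0) \<noteq> 0"
    by (simp add: flatten_def)
  then obtain S where "S \<in> {S. w S \<noteq> 0}" "(if v \<in> S then w S / real (card S) else 0) \<noteq> 0"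
    by (rule sum.not_neutral_contains_not_neutral)
  then show "v \<in> \<Union>{S. w S \<noteq> 0}" by (auto split: if_splits)
qed

lemma flatten_nonneg: "0 \<le> flatten w v"
  unfolding flatten_def using nonneg by (auto intro!: sum_nonneg)

lemma flatten_sum: "(\<Sum>v | flatten w v \<noteq> 0. flatten w v) = (\<Sum>S | w S \<noteq> 0. w S)"
proof -
  have f: "finite (\<Union>{S. w S \<noteq> 0})" using fin simplex by auto
  have "(\<Sum>v\<in>\<Union>{S. w S \<noteq> 0}. flatten w v)
      = (\<Sum>S | w S \<noteq> 0. \<Sum>v\<in>\<Union>{S. w S \<noteq> 0}. if v \<in> S then w S / real (card S) else 0)"
    unfolding flatten_def by (rule sum.swap)
  also have "\<dots> = (\<Sum>S | w S \<noteq> 0. w S)"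
  proof (rule sum.cong[OF refl])
    fix S assume S: "S \<in> {S. w S \<noteq> 0}"
    then have "(\<Sum>v\<in>\<Union>{S. w S \<noteq> 0}. if v \<in> S then w S / real (card S) else 0)
        = (\<Sum>v\<in>S. w S / real (card S))"
      by (intro sum.mono_neutral_cong_right[OF f]) auto
    then show "(\<Sum>v\<in>\<Union>{S. w S \<noteq> 0}. if v \<in> S then w S / real (card S) else 0) = w S"
      using S simplex[of S] by auto
  qed
  finally show ?thesis by (simp add: flatten_support)
qed

lemma flatten_bary_point: "bary_point b (flatten w) = bary_point (centroid b) w"
proof -
  have f: "finite (\<Union>{S. w S \<noteq> 0})" using fin simplex by auto
  have "bary_point b (flatten w) = (\<Sum>v\<in>\<Union>{S. w S \<noteq> 0}. flatten w v *\<^sub>R b v)"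
    unfolding bary_point_def flatten_support ..
  also have "\<dots> = (\<Sum>v\<in>\<Union>{S. w S \<noteq> 0}. \<Sum>S | w S \<noteq> 0. (if v \<in> S then w S / real (card S) else 0) *\<^sub>R b v)"
    by (simp add: flatten_def scaleR_sum_left)
  also have "\<dots> = (\<Sum>S | w S \<noteq> 0. \<Sum>v\<in>\<Union>{S. w S \<noteq> 0}. (if v \<in> S then w S / real (card S) else 0) *\<^sub>R b v)"
    by (rule sum.swap)
  also have "\<dots> = (\<Sum>S | w S \<noteq> 0. w S *\<^sub>R centroid b S)"
  proof (rule sum.cong[OF refl])
    fix S assume S: "S \<in> {S. w S \<noteq> 0}"
    then have "(\<Sum>v\<in>\<Union>{S. w S \<noteq> 0}. (if v \<in> S then w S / real (card S) else 0) *\<^sub>R b v)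
        = (\<Sum>v\<in>S. (w S / real (card S)) *\<^sub>R b v)"
      by (intro sum.mono_neutral_cong_right[OF f]) auto
    then show "(\<Sum>v\<in>\<Union>{S. w S \<noteq> 0}. (if v \<in> S then w S / real (card S) else 0) *\<^sub>R b v)
        = w S *\<^sub>R centroid b S"
      by (simp add: centroid_def scaleR_sum_right divide_inverse)
  qed
  finally show ?thesis by (simp add: bary_point_def)
qed

text \<open>Let \<open>i\<close> be a vertex that enters the chain at \<open>S\<close>. The members
  containing \<open>i\<close> are then \<open>S\<close> and those above it, so any vertex of
  \<open>S\<close> collects at least as much weight as \<open>i\<close>, while a vertex outside
  \<open>S\<close> misses the share of \<open>S\<close>. Members of the chain are therefore
  superlevel sets of \<open>flatten w\<close>.\<close>

lemma flatten_level:
  assumes "w S \<noteq> 0" "i \<in> S" "\<And>T. w T \<noteq> 0 \<Longrightarrow> T \<subset> S \<Longrightarrow> i \<notin> T"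
  shows "S = {j. flatten w i \<le> flatten w j}"
proof (intro set_eqI iffI)
  fix j assume j: "j \<in> S"
  have "flatten w i \<le> flatten w j"
    unfolding flatten_def
  proof (rule sum_mono)
    fix T assume T: "T \<in> {S. w S \<noteq> 0}"
    have "i \<in> T \<Longrightarrow> j \<in> T" using chain[of S T] assms T j by auto
    then show "(if i \<in> T then w T / real (card T) else 0) \<le> (if j \<in> T then w T / real (card T) else 0)"
      using nonneg[of T] by auto
  qed
  then show "j \<in> {j. flatten w i \<le> flatten w j}" by simp
next
  fix j assume j: "j \<in> {j. flatten w i \<le> flatten w j}"
  show "j \<in> S"
  proof (rule ccontr)
    assume nj: "j \<notin> S"
    have pos: "0 < w S / real (card S)"
      using assms(1) nonneg[of S] simplex[of S] by (auto simp: card_gt_0_iff intro!: divide_pos_pos)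
    have "flatten w j < flatten w i"
      unfolding flatten_def
    proof (rule sum_strict_mono_ex1[OF fin])
      show "\<forall>T\<in>{S. w S \<noteq> 0}. (if j \<in> T then w T / real (card T) else 0) \<le> (if i \<in> T then w T / real (card T) else 0)"
        using chain[of S] assms nj nonneg by auto
      show "\<exists>T\<in>{S. w S \<noteq> 0}. (if j \<in> T then w T / real (card T) else 0) < (if i \<in> T then w T / real (card T) else 0)"
        using assms nj pos by auto
    qed
    then show False using j by simp
  qed
qed

lemma smallest_support:
  assumes "w S \<noteq> 0" "i \<in> S"
  obtains T where "w T \<noteq> 0" "i \<in> T" "T \<subseteq> S" "\<And>T'. w T' \<noteq> 0 \<Longrightarrow> T' \<subset> T \<Longrightarrow> i \<notin> T'"
proof -
  let ?A = "{T. w T \<noteq> 0 \<and> i \<in> T \<and> T \<subseteq> S}"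
  have "finite ?A" using fin by (rule rev_finite_subset) auto
  from finite_has_minimal2[OF this, of S] assms
  obtain T where T: "T \<in> ?A" "\<forall>T'\<in>?A. T' \<subseteq> T \<longrightarrow> T = T'" by auto
  show thesis
  proof (rule that[of T])
    fix T' assume "w T' \<noteq> 0" "T' \<subset> T"
    then show "i \<notin> T'" using T by blast
  qed (use T in auto)
qed

text \<open>The members strictly below \<open>S\<close> form a finite chain, so their union is one
  of them or empty, and in either case not all of \<open>S\<close>.\<close>

lemma private_vertex:
  assumes "w S \<noteq> 0"
  obtains i where "i \<in> S" "\<And>T. w T \<noteq> 0 \<Longrightarrow> T \<subset> S \<Longrightarrow> i \<notin> T"
proof -
  let ?A = "{T. w T \<noteq> 0 \<and> T \<subset> S}"
  have "\<Union>?A \<noteq> S"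
  proof
    assume eq: "\<Union>?A = S"
    have "?A \<noteq> {}" using eq simplex[OF assms] by auto
    moreover have "finite ?A" using fin by (rule rev_finite_subset) auto
    ultimately have "\<Union>?A \<in> ?A" by (intro chain_Union_in) (use chain in auto)
    then show False using eq by auto
  qed
  then obtain i where "i \<in> S" "i \<notin> \<Union>?A" by auto
  then show thesis using that by auto
qed

text \<open>The chain can be read off from \<open>flatten w\<close> alone, which is the first half
  of injectivity in \<open>inj_flatten\<close>.\<close>

lemma support_from_flatten:
  "w S \<noteq> 0 \<longleftrightarrow> (\<exists>i. flatten w i \<noteq> 0 \<and> S = {j. flatten w i \<le> flatten w j})"
proof
  assume S: "w S \<noteq> 0"
  obtain i where i: "i \<in> S" "\<And>T. w T \<noteq> 0 \<Longrightarrow> T \<subset> S \<Longrightarrow> i \<notin> T" using private_vertex[OF S] by blast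
  then show "\<exists>i. flatten w i \<noteq> 0 \<and> S = {j. flatten w i \<le> flatten w j}"
    using flatten_level[OF S i] flatten_support S by (intro exI[of _ i]) blast
next
  assume "\<exists>i. flatten w i \<noteq> 0 \<and> S = {j. flatten w i \<le> flatten w j}"
  then obtain i where i: "flatten w i \<noteq> 0" "S = {j. flatten w i \<le> flatten w j}" by auto
  then obtain T where T: "w T \<noteq> 0" "i \<in> T" using flatten_support by auto
  then obtain T' where "w T' \<noteq> 0" "i \<in> T'" "\<And>T''. w T'' \<noteq> 0 \<Longrightarrow> T'' \<subset> T' \<Longrightarrow> i \<notin> T''"
    using smallest_support by metis
  then show "w S \<noteq> 0" using flatten_level[of T' i] i by auto
qed

end

text \<open>Subtracting the least positive value \<open>m\<close> on the whole support leaves a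
  function with smaller support, whose chain lies strictly below that support. Iterating gives the
  chain of superlevel sets.\<close>

lemma flatten_exists:
  fixes y :: "'v \<Rightarrow> real"
  assumes "finite {v. y v \<noteq> 0}" "\<And>v. 0 \<le> y v"
  shows "\<exists>w. finite {S. w S \<noteq> 0} \<and> (\<forall>S. 0 \<le> w S) \<and> (\<forall>S T. w S \<noteq> 0 \<longrightarrow> w T \<noteq> 0 \<longrightarrow> S \<subseteq> T \<or> T \<subseteq> S) \<and>
    (\<forall>S. w S \<noteq> 0 \<longrightarrow> S \<subseteq> {v. y v \<noteq> 0} \<and> S \<noteq> {}) \<and> flatten w = y"
  using assms
proof (induction "card {v. y v \<noteq> 0}" arbitrary: y rule: less_induct)
  case less
  let ?S = "{v. y v \<noteq> 0}"
  show ?case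
  proof (cases "?S = {}")
    case True
    then show ?thesis
      by (intro exI[of _ "\<lambda>_. 0"]) (auto simp: flatten_def fun_eq_iff)
  next
    case False
    define m where "m = Min (y ` ?S)"
    have "m \<in> y ` ?S" unfolding m_def using False less.prems by (intro Min_in) auto
    then obtain u where u: "y u \<noteq> 0" "y u = m" by auto
    have m_pos: "0 < m" using u less.prems(2)[of u] by auto
    have m_le: "m \<le> y v" if "y v \<noteq> 0" for v unfolding m_def using that less.prems by auto
    define z where "z v = y v - (if y v \<noteq> 0 then m else 0)" for v
    have sub: "{v. z v \<noteq> 0} \<subset> ?S"
    proof -
      have "z u = 0" using u by (simp add: z_def)
      then have "{v. z v \<noteq> 0} \<noteq> ?S" using u(1) by blast
      moreover have "{v. z v \<noteq> 0} \<subseteq> ?S" by (auto simp: z_def)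
      ultimately show ?thesis by blast
    qed
    have z0: "0 \<le> z v" for v using m_le[of v] less.prems(2)[of v] by (auto simp: z_def)
    have "finite {v. z v \<noteq> 0}" using sub less.prems(1) by (meson finite_subset psubset_imp_subset)
    then obtain w where w: "finite {S. w S \<noteq> 0}" "\<forall>S. 0 \<le> w S"
      "\<forall>S T. w S \<noteq> 0 \<longrightarrow> w T \<noteq> 0 \<longrightarrow> S \<subseteq> T \<or> T \<subseteq> S"
      "\<forall>S. w S \<noteq> 0 \<longrightarrow> S \<subseteq> {v. z v \<noteq> 0} \<and> S \<noteq> {}" "flatten w = z"
      using less.hyps[of z] psubset_card_mono[OF less.prems(1) sub] z0 by blast
    have wS: "w ?S = 0" using w(4) sub by blast
    \<comment> \<open>\<open>flatten\<close> divides by the cardinality, so the factor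
      \<open>card ?S\<close> restores the height \<open>m\<close>.\<close>
    let ?w = "w(?S := m * card ?S)"
    have c: "0 < card ?S" using False less.prems(1) by (simp add: card_gt_0_iff)
    have supp: "{S. ?w S \<noteq> 0} = insert ?S {S. w S \<noteq> 0}" using m_pos c by auto
    have "flatten ?w = y"
    proof
      fix v
      have "flatten ?w v = (\<Sum>S\<in>insert ?S {S. w S \<noteq> 0}. if v \<in> S then ?w S / real (card S) else 0)"
        unfolding flatten_def supp ..
      also have "\<dots> = (if v \<in> ?S then m else 0) + (\<Sum>S | w S \<noteq> 0. if v \<in> S then ?w S / real (card S) else 0)"
        using w(1) wS c by (subst sum.insert) auto
      also have "(\<Sum>S | w S \<noteq> 0. if v \<in> S then ?w S / real (card S) else 0) = flatten w v"
        unfolding flatten_def by (rule sum.cong) (use wS in auto)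
      also have "(if v \<in> ?S then m else 0) + flatten w v = y v" by (simp add: w(5) z_def)
      finally show "flatten ?w v = y v" .
    qed
    moreover have sw: "S \<subseteq> ?S \<and> S \<noteq> {}" if "w S \<noteq> 0" for S using w(4) that sub by blast
    moreover have "finite {S. ?w S \<noteq> 0}" unfolding supp using w(1) by simp
    moreover have "\<forall>S. 0 \<le> ?w S" using w(2) m_pos by auto
    moreover have "\<forall>S T. ?w S \<noteq> 0 \<longrightarrow> ?w T \<noteq> 0 \<longrightarrow> S \<subseteq> T \<or> T \<subseteq> S"
      using sw w(3) by (metis fun_upd_apply order_refl)
    moreover have "\<forall>S. ?w S \<noteq> 0 \<longrightarrow> S \<subseteq> ?S \<and> S \<noteq> {}"
      using sw False by (metis fun_upd_apply order_refl)
    ultimately show ?thesis by blast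
  qed
qed

lemma chainsI:
  "(\<And>S. S \<in> C \<Longrightarrow> S \<in> \<K> \<and> S \<noteq> {}) \<Longrightarrow> (\<And>S T. S \<in> C \<Longrightarrow> T \<in> C \<Longrightarrow> S \<subseteq> T \<or> T \<subseteq> S) \<Longrightarrow> C \<in> chains \<K>"
  by (simp add: chains_def subset_iff)

lemma chains_comparable: "C \<in> chains \<K> \<Longrightarrow> S \<in> C \<Longrightarrow> T \<in> C \<Longrightarrow> S \<subseteq> T \<or> T \<subseteq> S"
  by (simp add: chains_def)

lemma chains_memberD: "C \<in> chains \<K> \<Longrightarrow> S \<in> C \<Longrightarrow> S \<in> \<K> \<and> S \<noteq> {}"
  by (auto simp: chains_def)

lemma chains_subset: "C \<in> chains \<K> \<Longrightarrow> C' \<subseteq> C \<Longrightarrow> C' \<in> chains \<K>"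
  by (simp add: chains_def subset_iff)

lemma finite_chains: "finite \<K> \<Longrightarrow> finite (chains \<K>)"
  by (rule finite_subset[of _ "Pow \<K>"]) (auto simp: chains_def)

section \<open>The subdivision as a geometric complex\<close>

context geometric_complex
begin

lemma chain_weightsD:
  assumes "w \<in> weights (chains \<K>)"
  shows "finite {S. w S \<noteq> 0}" "\<And>S. 0 \<le> w S" "\<And>S T. w S \<noteq> 0 \<Longrightarrow> w T \<noteq> 0 \<Longrightarrow> S \<subseteq> T \<or> T \<subseteq> S"
    "\<And>S. w S \<noteq> 0 \<Longrightarrow> finite S \<and> S \<noteq> {}" "\<And>S. w S \<noteq> 0 \<Longrightarrow> S \<in> \<K>" "{S. w S \<noteq> 0} \<noteq> {}"
proof -
  have C: "{S. w S \<noteq> 0} \<in> chains \<K>" "(\<Sum>S | w S \<noteq> 0. w S) = 1" using assms by (auto simp: weights_def)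
  show "finite {S. w S \<noteq> 0}" using C finite_complex by (auto simp: chains_def intro: finite_subset)
  show "\<And>S. 0 \<le> w S" using assms by (auto simp: weights_def)
  show "\<And>S T. w S \<noteq> 0 \<Longrightarrow> w T \<noteq> 0 \<Longrightarrow> S \<subseteq> T \<or> T \<subseteq> S" using C by (auto simp: chains_def)
  show "\<And>S. w S \<noteq> 0 \<Longrightarrow> finite S \<and> S \<noteq> {}" "\<And>S. w S \<noteq> 0 \<Longrightarrow> S \<in> \<K>"
    using C finite_simplex by (auto simp: chains_def)
  show "{S. w S \<noteq> 0} \<noteq> {}" using C(2) by force
qed

lemma flatten_weights:
  assumes "w \<in> weights (chains \<K>)"
  shows "flatten w \<in> weights \<K>" "bary_point b (flatten w) = bary_point (centroid b) w"
proof -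
  note d = chain_weightsD[OF assms]
  have "\<Union>{S. w S \<noteq> 0} \<in> {S. w S \<noteq> 0}"
    by (rule chain_Union_in) (use d in auto)
  then have "\<Union>{S. w S \<noteq> 0} \<in> \<K>" using d(5) by auto
  then show "flatten w \<in> weights \<K>"
    using flatten_support[OF d(1-4)] flatten_nonneg[OF d(1-4)] flatten_sum[OF d(1-4)] assms
    by (simp add: weights_def)
  show "bary_point b (flatten w) = bary_point (centroid b) w"
    by (rule flatten_bary_point[OF d(1-4)])
qed

text \<open>Both weights have the same chain. At a maximal member where they differ, a vertex lying
  in no smaller member sees only that member and larger ones, and on the larger ones the weights
  agree.\<close>

lemma inj_flatten: "inj_on flatten (weights (chains \<K>))"
proof (rule inj_onI, rule ccontr)
  fix w w' assume w: "w \<in> weights (chains \<K>)" and w': "w' \<in> weights (chains \<K>)"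
    and eq: "flatten w = flatten w'" and neq: "w \<noteq> w'"
  note d = chain_weightsD[OF w] and d' = chain_weightsD[OF w']
  have supp: "w S \<noteq> 0 \<longleftrightarrow> w' S \<noteq> 0" for S
    using support_from_flatten[OF d(1-4), of S] support_from_flatten[OF d'(1-4), of S] eq by simp
  let ?A = "{S. w S \<noteq> w' S}"
  have "?A \<subseteq> {S. w S \<noteq> 0}" using supp by auto
  then have "finite ?A" "?A \<noteq> {}" using d(1) neq by (auto intro: finite_subset)
  from finite_has_maximal[OF this]
  obtain S where S: "S \<in> ?A" "\<And>T. T \<in> ?A \<Longrightarrow> S \<subseteq> T \<Longrightarrow> S = T"
    by blast
  have S0: "w S \<noteq> 0" using S supp by auto
  obtain i where i: "i \<in> S" "\<And>T. w T \<noteq> 0 \<Longrightarrow> T \<subset> S \<Longrightarrow> i \<notin> T"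
    using private_vertex[OF d(1-4) S0] by blast
  have fl': "flatten w' i = (\<Sum>T | w T \<noteq> 0. if i \<in> T then w' T / real (card T) else 0)"
    by (rule flatten_superset[OF d(1)]) (use supp in auto)
  have "0 = flatten w i - flatten w' i" using eq by simp
  also have "\<dots> = (\<Sum>T | w T \<noteq> 0. (if i \<in> T then w T / real (card T) else 0) - (if i \<in> T then w' T / real (card T) else 0))"
    unfolding fl' flatten_def[of w] by (simp add: sum_subtractf)
  also have "\<dots> = (\<Sum>T | w T \<noteq> 0. if T = S then (w S - w' S) / real (card S) else 0)"
  proof (rule sum.cong[OF refl])
    fix T assume T: "T \<in> {T. w T \<noteq> 0}"
    have "i \<in> T \<Longrightarrow> T \<noteq> S \<Longrightarrow> w T = w' T"
      using T d(3)[OF S0, of T] i(2)[of T] S(2)[of T] by auto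
    then show "(if i \<in> T then w T / real (card T) else 0) - (if i \<in> T then w' T / real (card T) else 0)
      = (if T = S then (w S - w' S) / real (card S) else 0)"
      using i(1) by (auto simp: diff_divide_distrib)
  qed
  also have "\<dots> = (w S - w' S) / real (card S)" using d(1) S0 by simp
  finally show False using S(1) d(4)[OF S0] by auto
qed

lemma flatten_surj: "y \<in> weights \<K> \<Longrightarrow> \<exists>w\<in>weights (chains \<K>). flatten w = y"
proof -
  assume y: "y \<in> weights \<K>"
  have supp: "{v. y v \<noteq> 0} \<in> \<K>" "\<And>v. 0 \<le> y v" using y by (auto simp: weights_def)
  obtain w where w: "finite {S. w S \<noteq> 0}" "\<forall>S. 0 \<le> w S"
      "\<forall>S T. w S \<noteq> 0 \<longrightarrow> w T \<noteq> 0 \<longrightarrow> S \<subseteq> T \<or> T \<subseteq> S"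
      "\<forall>S. w S \<noteq> 0 \<longrightarrow> S \<subseteq> {v. y v \<noteq> 0} \<and> S \<noteq> {}" "flatten w = y"
    using flatten_exists[of y] supp finite_simplex[OF supp(1)] by auto
  have fin: "w S \<noteq> 0 \<Longrightarrow> finite S \<and> S \<noteq> {}" for S
    using w(4) finite_simplex[OF supp(1)] finite_subset by blast
  have "{S. w S \<noteq> 0} \<in> chains \<K>" using w(3,4) face_closed[OF supp(1)] by (auto simp: chains_def)
  moreover have "(\<Sum>S | w S \<noteq> 0. w S) = 1"
    using flatten_sum[of w] w fin y by (simp add: weights_def)
  ultimately have "w \<in> weights (chains \<K>)" using w(2) by (simp add: weights_def)
  then show ?thesis using w(5) by blast
qed

lemma sd_complex: "geometric_complex (centroid b) (chains \<K>)"
proof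
  show "finite (chains \<K>)" using finite_complex by (rule finite_chains)
  show "\<And>C. C \<in> chains \<K> \<Longrightarrow> finite C"
    using finite_complex by (auto simp: chains_def intro: finite_subset)
  show "\<And>C C'. C \<in> chains \<K> \<Longrightarrow> C' \<subseteq> C \<Longrightarrow> C' \<in> chains \<K>"
    by (rule chains_subset)
  show "inj_on (bary_point (centroid b)) (weights (chains \<K>))"
  proof (rule inj_onI)
    fix w w' assume w: "w \<in> weights (chains \<K>)" "w' \<in> weights (chains \<K>)"
      and "bary_point (centroid b) w = bary_point (centroid b) w'"
    then have "bary_point b (flatten w) = bary_point b (flatten w')" by (simp add: flatten_weights)
    then have "flatten w = flatten w'"
      using inj_onD[OF inj_bary_point] flatten_weights(1) w by blast
    then show "w = w'" using inj_onD[OF inj_flatten] w by blast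
  qed
qed

abbreviation sd_coord :: "'a \<Rightarrow> 'v set \<Rightarrow> real"
  where "sd_coord \<equiv> geometric_complex.coord (centroid b) (chains \<K>)"

lemma sd_realization: "realization (centroid b) (chains \<K>) = realization b \<K>"
proof -
  interpret sd: geometric_complex "centroid b" "chains \<K>" by (rule sd_complex)
  have "bary_point (centroid b) ` weights (chains \<K>) = bary_point b ` flatten ` weights (chains \<K>)"
    by (simp add: image_image flatten_weights cong: image_cong)
  also have "flatten ` weights (chains \<K>) = weights \<K>"
    using flatten_weights flatten_surj by force
  finally show ?thesis by (simp add: realization_eq sd.realization_eq)
qed

lemma flatten_sd_coord:
  assumes "p \<in> realization b \<K>"
  shows "flatten (sd_coord p) = coord p"
proof -
  interpret sd: geometric_complex "centroid b" "chains \<K>" by (rule sd_complex)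
  have p: "p \<in> realization (centroid b) (chains \<K>)" using assms sd_realization by simp
  then show ?thesis
    using coord_bary_point[of "flatten (sd.coord p)"] flatten_weights[OF sd.coord_weights[OF p]]
      sd.bary_point_coord[OF p] by simp
qed

lemma coord_support_sd:
  assumes "p \<in> realization b \<K>"
  shows "{v. coord p v \<noteq> 0} = \<Union>{S. sd_coord p S \<noteq> 0}"
proof -
  interpret sd: geometric_complex "centroid b" "chains \<K>" by (rule sd_complex)
  have p: "p \<in> realization (centroid b) (chains \<K>)" using assms sd_realization by simp
  show ?thesis
    using flatten_support[OF chain_weightsD(1-4)[OF sd.coord_weights[OF p]]] flatten_sd_coord[OF assms]
    by simp
qed

text \<open>The geometric definition speaks of nested cells, the combinatorial one of nested vertex
  sets; \<open>convex_hull_subset_iff\<close> identifies the two.\<close>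

lemma barycentric_subdivision_simplices:
  "barycentric_subdivision (simplices b \<K>) = simplices (centroid b) (chains \<K>)"
proof -
  interpret sd: geometric_complex "centroid b" "chains \<K>" by (rule sd_complex)
  let ?h = "\<lambda>S. convex hull (b ` S)"
  have bc: "barycenter ` ?h ` C = centroid b ` C" if "C \<subseteq> \<K>" for C
    unfolding image_image centroid_def using that by (intro image_cong) (auto simp: barycenter_simplex)
  show ?thesis
  proof (intro set_eqI iffI)
    fix X assume "X \<in> barycentric_subdivision (simplices b \<K>)"
    then obtain C where C: "finite C" "C \<subseteq> simplices b \<K> - {{}}" "\<forall>S\<in>C. \<forall>T\<in>C. S \<subseteq> T \<or> T \<subseteq> S"
      "X = convex hull (barycenter ` C)" unfolding barycentric_subdivision_def by auto
    define C' where "C' = {S \<in> \<K>. ?h S \<in> C}"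
    have CC: "C = ?h ` C'" using C(2) by (auto simp: C'_def simplices_def)
    have "C' \<in> chains \<K>"
    proof (rule chainsI)
      fix S assume "S \<in> C'"
      then have "S \<in> \<K>" "convex hull (b ` S) \<noteq> {}" using C(2) by (auto simp: C'_def)
      then show "S \<in> \<K> \<and> S \<noteq> {}" by auto
    next
      fix S T assume "S \<in> C'" "T \<in> C'"
      then have "S \<in> \<K>" "T \<in> \<K>" "?h S \<subseteq> ?h T \<or> ?h T \<subseteq> ?h S" using C(3) unfolding C'_def by blast+
      then show "S \<subseteq> T \<or> T \<subseteq> S" using convex_hull_subset_iff by blast
    qed
    moreover have "C' \<subseteq> \<K>" by (auto simp: C'_def)
    then have "X = convex hull (centroid b ` C')"
      unfolding C(4) by (subst CC) (simp only: bc)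
    ultimately show "X \<in> simplices (centroid b) (chains \<K>)" by (auto simp: simplices_def)
  next
    fix X assume "X \<in> simplices (centroid b) (chains \<K>)"
    then obtain C where C: "C \<in> chains \<K>" "X = convex hull (centroid b ` C)" by (auto simp: simplices_def)
    have "finite C" by (rule sd.finite_simplex[OF C(1)])
    have sub: "C \<subseteq> \<K>" using C by (auto simp: chains_def)
    have "finite (?h ` C)" "?h ` C \<subseteq> simplices b \<K> - {{}}"
      using C \<open>finite C\<close> by (auto simp: chains_def simplices_def)
    moreover have "?h S \<subseteq> ?h T \<or> ?h T \<subseteq> ?h S" if "S \<in> C" "T \<in> C" for S T
      using chains_comparable[OF C(1) that] hull_mono image_mono by metis
    then have "\<forall>S\<in>?h ` C. \<forall>T\<in>?h ` C. S \<subseteq> T \<or> T \<subseteq> S" by blast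
    moreover have "X = convex hull (barycenter ` ?h ` C)" using C(2) bc[OF sub] by simp
    ultimately show "X \<in> barycentric_subdivision (simplices b \<K>)"
      unfolding barycentric_subdivision_def by blast
  qed
qed

text \<open>A simplex of the second subdivision is a chain of chains, and \<open>sd_coord p\<close>
  is maximal at \<open>S\<close> exactly if \<open>S\<close> lies in every chain that
  \<open>p\<close> uses. In that case the vertex \<open>centroid b S\<close> spans a simplex
  together with the chains of \<open>p\<close>. Conversely, if a simplex meets the subcomplex, its
  smallest chain consists of simplices in \<D>, and each of these lies in all its chains.\<close>

lemma regular_neighborhood_simplices:
  assumes D: "\<D> \<subseteq> \<K>" "\<And>C C'. C \<in> \<D> \<Longrightarrow> C' \<subseteq> C \<Longrightarrow> C' \<in> \<D>"
  shows "regular_neighborhood (simplices b \<K>) (realization b \<D>) =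
    {p \<in> realization b \<K>. \<exists>S\<in>\<D> - {{}}. \<forall>T. sd_coord p T \<le> sd_coord p S}"
proof -
  interpret sd: geometric_complex "centroid b" "chains \<K>" by (rule sd_complex)
  interpret sd2: geometric_complex "centroid (centroid b)" "chains (chains \<K>)"
    by (rule sd.sd_complex)
  have eq: "barycentric_subdivision (barycentric_subdivision (simplices b \<K>))
      = simplices (centroid (centroid b)) (chains (chains \<K>))"
    by (simp add: barycentric_subdivision_simplices sd.barycentric_subdivision_simplices)
  have real: "realization (centroid (centroid b)) (chains (chains \<K>)) = realization b \<K>"
    by (simp add: sd.sd_realization sd_realization)
  have rD: "realization b \<D> = {p \<in> realization b \<K>. {v. coord p v \<noteq> 0} \<in> \<D>}"
    by (rule realization_subcomplex) (use D in auto)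
  have fl: "flatten (sd2.coord p) = sd.coord p" if "p \<in> realization b \<K>" for p
    using sd.flatten_sd_coord that by (simp add: sd_realization)
  have mem: "p \<in> convex hull (centroid (centroid b) ` C) \<longleftrightarrow> p \<in> realization b \<K> \<and> {v. sd2.coord p v \<noteq> 0} \<subseteq> C"
    if "C \<in> chains (chains \<K>)" for C p
    using sd2.convex_hull_eq_support[OF that] real by auto
  have d: "finite {S. sd2.coord p S \<noteq> 0}" "\<And>S. 0 \<le> sd2.coord p S"
    "\<And>S T. sd2.coord p S \<noteq> 0 \<Longrightarrow> sd2.coord p T \<noteq> 0 \<Longrightarrow> S \<subseteq> T \<or> T \<subseteq> S"
    "\<And>S. sd2.coord p S \<noteq> 0 \<Longrightarrow> finite S \<and> S \<noteq> {}" "\<And>S. sd2.coord p S \<noteq> 0 \<Longrightarrow> S \<in> chains \<K>"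
    "{S. sd2.coord p S \<noteq> 0} \<noteq> {}" if "p \<in> realization b \<K>" for p
    using sd.chain_weightsD[OF sd2.coord_weights[of p]] that real by auto
  show ?thesis
  proof (intro set_eqI iffI)
    fix p assume "p \<in> regular_neighborhood (simplices b \<K>) (realization b \<D>)"
    then obtain C q where C: "C \<in> chains (chains \<K>)" "p \<in> convex hull (centroid (centroid b) ` C)"
      "q \<in> convex hull (centroid (centroid b) ` C)" "q \<in> realization b \<D>"
      unfolding regular_neighborhood_def eq by (auto simp: simplices_def)
    have p: "p \<in> realization b \<K>" "{v. sd2.coord p v \<noteq> 0} \<subseteq> C"
      and q: "q \<in> realization b \<K>" "{v. sd2.coord q v \<noteq> 0} \<subseteq> C"
      using mem[OF C(1)] C by auto
    obtain T where T: "sd2.coord q T \<noteq> 0" using d(6)[OF q(1)] by auto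
    have TC: "T \<in> C" using q T by auto
    have "T \<subseteq> {S. sd.coord q S \<noteq> 0}"
      using flatten_support[OF d(1-4)[OF q(1)]] fl[OF q(1)] T by auto
    then have "\<Union>T \<subseteq> {v. coord q v \<noteq> 0}" using coord_support_sd[OF q(1)] by auto
    moreover have "{v. coord q v \<noteq> 0} \<in> \<D>" using C(4) rD by simp
    ultimately have TD: "S \<in> \<D>" if "S \<in> T" for S using D(2) that by blast
    have finC: "finite C" by (rule sd2.finite_simplex[OF C(1)])
    from finite_has_minimal2[OF this TC]
    obtain T0 where T0: "T0 \<in> C" "\<And>T'. T' \<in> C \<Longrightarrow> T' \<subseteq> T0 \<Longrightarrow> T0 = T'"
      by blast
    have T0_min: "T0 \<subseteq> T'" if "T' \<in> C" for T'
      using T0 that chains_comparable[OF C(1)] by blast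
    obtain S where S: "S \<in> T0" using chains_memberD[OF C(1) T0(1)] by blast
    have "S \<in> \<D>" "S \<noteq> {}" using TD T0_min[OF TC] S chains_memberD[OF _ S] chains_memberD[OF C(1) T0(1)] by blast+
    moreover have "sd.coord p S' \<le> sd.coord p S" for S'
      unfolding fl[OF p(1), symmetric] flatten_def
    proof (rule sum_mono)
      fix T' assume "T' \<in> {S. sd2.coord p S \<noteq> 0}"
      then have "S \<in> T'" using p(2) T0_min S by auto
      then show "(if S' \<in> T' then sd2.coord p T' / real (card T') else 0) \<le> (if S \<in> T' then sd2.coord p T' / real (card T') else 0)"
        using d(2)[OF p(1)] by auto
    qed
    ultimately show "p \<in> {p \<in> realization b \<K>. \<exists>S\<in>\<D> - {{}}. \<forall>T. sd.coord p T \<le> sd.coord p S}"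
      using p by auto
  next
    fix p assume "p \<in> {p \<in> realization b \<K>. \<exists>S\<in>\<D> - {{}}. \<forall>T. sd.coord p T \<le> sd.coord p S}"
    then obtain S where p: "p \<in> realization b \<K>" and S: "S \<in> \<D>" "S \<noteq> {}" "\<And>T. sd.coord p T \<le> sd.coord p S"
      by auto
    let ?C = "{T. sd2.coord p T \<noteq> 0}"
    from finite_has_minimal[OF d(1,6)[OF p]]
    obtain T0 where T0: "T0 \<in> ?C" "\<And>T'. T' \<in> ?C \<Longrightarrow> T' \<subseteq> T0 \<Longrightarrow> T0 = T'"
      by blast
    have T0_min: "T0 \<subseteq> T'" if "T' \<in> ?C" for T' using T0 that d(3)[OF p] by blast
    obtain S' where S': "S' \<in> T0" using T0(1) d(4)[OF p] by blast
    \<comment> \<open>\<open>S'\<close> lies in every chain of the support, so a chain that misses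
      \<open>S\<close> would make the coordinate of \<open>S'\<close> strictly larger than that of
      \<open>S\<close>.\<close>
    have all: "S \<in> T" if "T \<in> ?C" for T
    proof (rule ccontr)
      assume "S \<notin> T"
      have "flatten (sd2.coord p) S < flatten (sd2.coord p) S'"
        unfolding flatten_def
      proof (rule sum_strict_mono_ex1[OF d(1)[OF p]])
        show "\<forall>T\<in>?C. (if S \<in> T then sd2.coord p T / real (card T) else 0) \<le> (if S' \<in> T then sd2.coord p T / real (card T) else 0)"
          using T0_min S' d(2)[OF p] by auto
        show "\<exists>T\<in>?C. (if S \<in> T then sd2.coord p T / real (card T) else 0) < (if S' \<in> T then sd2.coord p T / real (card T) else 0)"
        proof (rule bexI[of _ T])
          have "0 < sd2.coord p T" using that d(2)[OF p, of T] by auto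
          moreover have "0 < real (card T)" using that d(4)[OF p, of T] by (auto simp: card_gt_0_iff)
          ultimately have "0 < sd2.coord p T / real (card T)" by (rule divide_pos_pos)
          then show "(if S \<in> T then sd2.coord p T / real (card T) else 0) < (if S' \<in> T then sd2.coord p T / real (card T) else 0)"
            using \<open>S \<notin> T\<close> T0_min[OF that] S' by auto
        qed (use that in simp)
      qed
      then show False using S(3)[of S'] fl[OF p] by simp
    qed
    have SK: "{S} \<in> chains \<K>" using S D(1) by (auto simp: chains_def)
    have "insert {S} ?C \<in> chains (chains \<K>)"
    proof (rule chainsI)
      fix T assume "T \<in> insert {S} ?C"
      then show "T \<in> chains \<K> \<and> T \<noteq> {}" using SK d(4,5)[OF p, of T] by auto
    next
      fix T T' assume "T \<in> insert {S} ?C" "T' \<in> insert {S} ?C"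
      then consider "T = {S}" "S \<in> T'" | "T' = {S}" "S \<in> T" | "T \<in> ?C" "T' \<in> ?C"
        using all by blast
      then show "T \<subseteq> T' \<or> T' \<subseteq> T" by cases (use d(3)[OF p, of T T'] in auto)
    qed
    note C = this
    have "p \<in> convex hull (centroid (centroid b) ` insert {S} ?C)"
      using mem[OF C, of p] p by auto
    moreover have "centroid b S \<in> convex hull (centroid (centroid b) ` insert {S} ?C)"
      by (rule hull_inc) (simp add: centroid_def[of _ "{S}"])
    moreover have "centroid b S \<in> realization b \<D>"
    proof -
      have c: "sd.coord (centroid b S) = (\<lambda>u. if u = S then 1 else 0)"
        by (rule sd.coord_vertex[OF SK])
      have r: "centroid b S \<in> realization b \<K>" using sd.vertex_in[OF SK] sd_realization by simp
      have "{v. coord (centroid b S) v \<noteq> 0} = S"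
        unfolding coord_support_sd[OF r] c by auto
      then show ?thesis using rD r S by simp
    qed
    moreover have "convex hull (centroid (centroid b) ` insert {S} ?C)
        \<in> simplices (centroid (centroid b)) (chains (chains \<K>))"
      unfolding simplices_def using C by (rule imageI)
    ultimately show "p \<in> regular_neighborhood (simplices b \<K>) (realization b \<D>)"
      unfolding regular_neighborhood_def eq by blast
  qed
qed

end

section \<open>The cyclic polytope\<close>

lemma exhaust_5: "x = 1 \<or> x = 2 \<or> x = 3 \<or> x = 4 \<or> x = 5" for x :: 5
proof (induct x)
  case (of_int z)
  then have "0 \<le> z" and "z < 5" by simp_all
  then have "z = 0 \<or> z = 1 \<or> z = 2 \<or> z = 3 \<or> z = 4" by arith
  then show ?case by auto
qed

lemma UNIV_5: "UNIV = {1::5, 2, 3, 4, 5}"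
  using exhaust_5 by auto

lemma sum_5: "sum f (UNIV :: 5 set) = f 1 + f 2 + f 3 + f 4 + f 5"
  unfolding UNIV_5 by (simp add: ac_simps)

lemma vector_5:
  "(vector [a,b,c,d,e] :: 'a::zero ^ 5) $ 1 = a" "(vector [a,b,c,d,e] :: 'a ^ 5) $ 2 = b"
  "(vector [a,b,c,d,e] :: 'a ^ 5) $ 3 = c" "(vector [a,b,c,d,e] :: 'a ^ 5) $ 4 = d"
  "(vector [a,b,c,d,e] :: 'a ^ 5) $ 5 = e"
  by (simp_all add: vector_def)

section \<open>Affine functionals on the moment curve as polynomials of degree at most five\<close>

lemma inner_moment_curve:
  "a \<bullet> moment_curve s = a $ 1 * s + a $ 2 * s ^ 2 + a $ 3 * s ^ 3 + a $ 4 * s ^ 4 + a $ 5 * s ^ 5"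
  by (simp add: inner_vec_def sum_5 moment_curve_def vector_5)

lemma affine_functional_poly:
  "\<exists>q. degree q \<le> 5 \<and> (\<forall>s. poly q s = a \<bullet> moment_curve s + c) \<and> (q = 0 \<longrightarrow> a = 0)"
proof (intro exI conjI)
  let ?q = "[:c, a $ 1, a $ 2, a $ 3, a $ 4, a $ 5:]"
  show "degree ?q \<le> 5" by (auto simp: degree_pCons_eq_if)
  show "\<forall>s. poly ?q s = a \<bullet> moment_curve s + c"
    by (simp add: inner_moment_curve algebra_simps eval_nat_numeral)
  show "?q = 0 \<longrightarrow> a = 0"
    using exhaust_5 by (auto simp: vec_eq_iff) (metis (full_types))
qed

lemma poly_affine_functional:
  assumes "degree q \<le> 5"
  obtains a c where "\<And>s. poly q s = a \<bullet> moment_curve s + c"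
proof
  fix s
  have "poly q s = (\<Sum>i\<le>5. coeff q i * s ^ i)"
    unfolding poly_altdef by (rule sum.mono_neutral_left) (use assms in \<open>auto intro: le_degree\<close>)
  then show "poly q s = vector [coeff q 1, coeff q 2, coeff q 3, coeff q 4, coeff q 5] \<bullet> moment_curve s + coeff q 0"
    by (simp add: inner_moment_curve vector_5 eval_nat_numeral)
qed

text \<open>A supporting hyperplane restricts to a polynomial on the moment curve that is
  nonnegative at the parameters, and the vertices of its face are the zeros. Excluding
  \<open>{1..8}\<close> excludes just \<open>q = 0\<close>, that is, the polytope itself.\<close>

definition cyclic_complex :: "(nat \<Rightarrow> real) \<Rightarrow> nat set set"
  where "cyclic_complex t = {\<sigma>. \<sigma> \<noteq> {1..8} \<and>
    (\<exists>q. degree q \<le> 5 \<and> (\<forall>i\<in>{1..8}. 0 \<le> poly q (t i)) \<and> \<sigma> = {i\<in>{1..8}. poly q (t i) = 0})}"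

locale cyclic_vertices =
  fixes t :: "nat \<Rightarrow> real"
  assumes mono: "strict_mono_on {1..8} t"
begin

abbreviation v :: "nat \<Rightarrow> real ^ 5"
  where "v i \<equiv> moment_curve (t i)"

lemma t_less: "i \<in> {1..8} \<Longrightarrow> j \<in> {1..8} \<Longrightarrow> t i < t j \<longleftrightarrow> i < j"
  using strict_mono_on_less[OF mono] by auto

lemma t_inj: "inj_on t {1..8}"
  by (rule strict_mono_on_imp_inj_on[OF mono])

lemma t_eq: "i \<in> {1..8} \<Longrightarrow> j \<in> {1..8} \<Longrightarrow> t i = t j \<longleftrightarrow> i = j"
  using inj_on_eq_iff[OF t_inj] .

lemma t_le: "i \<in> {1..8} \<Longrightarrow> j \<in> {1..8} \<Longrightarrow> t i \<le> t j \<longleftrightarrow> i \<le> j"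
  using t_less[of j i] by auto

lemma poly_zero:
  assumes "degree q \<le> 5" "I \<subseteq> {1..8}" "5 < card I" "\<And>i. i \<in> I \<Longrightarrow> poly q (t i) = 0"
  shows "q = 0"
proof (rule ccontr)
  assume q: "q \<noteq> 0"
  have "card I = card (t ` I)" using inj_on_subset[OF t_inj assms(2)] by (simp add: card_image)
  also have "\<dots> \<le> card {x. poly q x = 0}"
    using assms(4) poly_roots_finite[OF q] by (intro card_mono) auto
  also have "\<dots> \<le> degree q" by (rule card_poly_roots_bound[OF q])
  finally show False using assms by simp
qed

lemma complex_subset: "\<sigma> \<in> cyclic_complex t \<Longrightarrow> \<sigma> \<subseteq> {1..8}"
  by (auto simp: cyclic_complex_def)

lemma complexE:
  assumes "\<sigma> \<in> cyclic_complex t"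
  obtains q where "degree q \<le> 5" "\<And>i. i \<in> {1..8} \<Longrightarrow> 0 \<le> poly q (t i)"
    "\<sigma> = {i\<in>{1..8}. poly q (t i) = 0}" "\<sigma> \<noteq> {1..8}"
  using assms unfolding cyclic_complex_def by blast

lemma card_le_5: "\<sigma> \<in> cyclic_complex t \<Longrightarrow> card \<sigma> \<le> 5"
proof (rule ccontr)
  assume "\<sigma> \<in> cyclic_complex t" "\<not> card \<sigma> \<le> 5"
  then obtain q where q: "degree q \<le> 5" "\<sigma> = {i\<in>{1..8}. poly q (t i) = 0}" "\<sigma> \<noteq> {1..8}"
    by (auto simp: cyclic_complex_def)
  have "q = 0" by (rule poly_zero[of q \<sigma>]) (use q \<open>\<not> card \<sigma> \<le> 5\<close> in auto)
  then show False using q by auto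
qed

lemma lagrange_basis:
  assumes "\<sigma> \<subseteq> {1..8}" "card \<sigma> \<le> 5" "k \<in> \<sigma>"
  obtains p where "degree p \<le> 5" "poly p (t k) = 1" "\<And>j. j \<in> \<sigma> \<Longrightarrow> j \<noteq> k \<Longrightarrow> poly p (t j) = 0"
proof -
  let ?r = "\<Prod>j\<in>\<sigma> - {k}. [:- t j, 1:]"
  have fin: "finite \<sigma>" using assms(1) finite_subset by blast
  have "degree ?r \<le> (\<Sum>j\<in>\<sigma> - {k}. degree [:- t j, 1:])"
    using degree_prod_sum_le[of "\<sigma> - {k}" "\<lambda>j. [:- t j, 1:]"] fin by (simp add: o_def)
  also have "\<dots> \<le> 5" using assms fin by simp
  finally have deg: "degree ?r \<le> 5" .
  have "t k - t j \<noteq> 0" if "j \<in> \<sigma> - {k}" for j using that subsetD[OF assms(1), of j] subsetD[OF assms(1), of k] assms(3) t_eq[of k j] by auto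
  then have nz: "poly ?r (t k) \<noteq> 0"
    using fin by (simp add: poly_prod)
  have z: "poly ?r (t j) = 0" if "j \<in> \<sigma>" "j \<noteq> k" for j
    unfolding poly_prod by (rule prod_zero) (use that fin in auto)
  show thesis
    by (rule that[of "smult (inverse (poly ?r (t k))) ?r"]) (use deg nz z in auto)
qed

text \<open>A supporting polynomial for \<sigma> is perturbed by a small multiple of
  \<open>p\<close>, which is 0 on \<sigma>' and 1 on the rest of \<sigma>. The vertices of \<sigma>
  outside \<sigma>' leave the hyperplane, and those off \<sigma> keep their positive sign.\<close>

lemma complex_face_closed:
  assumes "\<sigma> \<in> cyclic_complex t" "\<sigma>' \<subseteq> \<sigma>"
  shows "\<sigma>' \<in> cyclic_complex t"
proof -
  have s8: "\<sigma> \<subseteq> {1..8}" and c5: "card \<sigma> \<le> 5" using complex_subset card_le_5 assms by auto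
  have fin: "finite \<sigma>" using s8 finite_subset by blast
  obtain q where q: "degree q \<le> 5" "\<And>i. i \<in> {1..8} \<Longrightarrow> 0 \<le> poly q (t i)"
    "\<sigma> = {i\<in>{1..8}. poly q (t i) = 0}" "\<sigma> \<noteq> {1..8}"
    by (rule complexE[OF assms(1)]) (rule that)
  have "\<forall>k\<in>\<sigma>. \<exists>p. degree p \<le> 5 \<and> poly p (t k) = 1 \<and> (\<forall>j\<in>\<sigma>. j \<noteq> k \<longrightarrow> poly p (t j) = 0)"
    using lagrange_basis[OF s8 c5] by metis
  then obtain l where l: "\<And>k. k \<in> \<sigma> \<Longrightarrow> degree (l k) \<le> 5" "\<And>k. k \<in> \<sigma> \<Longrightarrow> poly (l k) (t k) = 1"
    "\<And>k j. k \<in> \<sigma> \<Longrightarrow> j \<in> \<sigma> \<Longrightarrow> j \<noteq> k \<Longrightarrow> poly (l k) (t j) = 0"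
    by metis
  define p where "p = (\<Sum>k\<in>\<sigma> - \<sigma>'. l k)"
  have degp: "degree p \<le> 5" unfolding p_def by (rule degree_sum_le) (use fin l in auto)
  have pv: "poly p (t j) = (if j \<in> \<sigma>' then 0 else 1)" if "j \<in> \<sigma>" for j
  proof -
    have "poly p (t j) = (\<Sum>k\<in>\<sigma> - \<sigma>'. if k = j then 1 else 0)"
      unfolding p_def poly_sum by (rule sum.cong) (use l that in auto)
    then show ?thesis using that fin by auto
  qed
  define M where "M = 1 + (\<Sum>i\<in>{1..8}. \<bar>poly p (t i)\<bar>)"
  have M: "\<bar>poly p (t i)\<bar> < M" if "i \<in> {1..8}" for i
    using member_le_sum[of i "{1..8}" "\<lambda>i. \<bar>poly p (t i)\<bar>"] that by (auto simp: M_def)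
  have "M > 0" unfolding M_def by (smt (verit) sum_nonneg abs_ge_zero)
  \<comment> \<open>\<open>M\<close> exceeds the absolute value of \<open>p\<close> at every
    parameter, so the perturbation stays below the least positive value of \<open>q\<close>.\<close>
  define \<epsilon> where "\<epsilon> = Min (insert 1 ((\<lambda>i. poly q (t i)) ` ({1..8} - \<sigma>))) / M"
  have \<epsilon>: "0 < \<epsilon>"
  proof -
    have "0 < poly q (t i)" if "i \<in> {1..8} - \<sigma>" for i
      using that q(2)[of i] q(3) by (auto simp: order_less_le)
    then show ?thesis unfolding \<epsilon>_def using \<open>M > 0\<close> by (auto intro!: divide_pos_pos)
  qed
  have \<epsilon>q: "\<epsilon> * M \<le> poly q (t i)" if "i \<in> {1..8} - \<sigma>" for i
    unfolding \<epsilon>_def using that \<open>M > 0\<close> by (auto intro!: Min_le)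
  let ?q = "q + smult \<epsilon> p"
  have pos: "0 < poly ?q (t i)" if "i \<in> {1..8} - \<sigma>" for i
  proof -
    have "\<epsilon> * \<bar>poly p (t i)\<bar> < \<epsilon> * M" using M[of i] that \<epsilon> by auto
    then have "\<epsilon> * \<bar>poly p (t i)\<bar> < poly q (t i)" using \<epsilon>q[OF that] by linarith
    then have "\<bar>\<epsilon> * poly p (t i)\<bar> < poly q (t i)" using \<epsilon> by (simp add: abs_mult)
    then show ?thesis by simp
  qed
  have onS: "poly ?q (t i) = (if i \<in> \<sigma>' then 0 else \<epsilon>)" if "i \<in> \<sigma>" for i
    using that q(3) pv[OF that] by auto
  have "degree ?q \<le> 5" using q(1) degp by (intro degree_add_le) auto
  moreover have "0 \<le> poly ?q (t i)" if "i \<in> {1..8}" for i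
    using pos[of i] onS[of i] that \<epsilon> by (cases "i \<in> \<sigma>") auto
  moreover have "\<sigma>' = {i\<in>{1..8}. poly ?q (t i) = 0}"
  proof (intro set_eqI iffI)
    fix i assume "i \<in> \<sigma>'"
    then show "i \<in> {i\<in>{1..8}. poly ?q (t i) = 0}" using assms(2) s8 onS[of i] by auto
  next
    fix i assume "i \<in> {i\<in>{1..8}. poly ?q (t i) = 0}"
    then show "i \<in> \<sigma>'" using pos[of i] onS[of i] \<epsilon> by (cases "i \<in> \<sigma>") (auto split: if_splits)
  qed
  moreover have "\<sigma>' \<noteq> {1..8}" using assms(2) q(4) s8 by auto
  ultimately show ?thesis unfolding cyclic_complex_def by blast
qed

sublocale geometric_complex v "cyclic_complex t"
proof
  show "finite (cyclic_complex t)"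
    by (rule finite_subset[of _ "Pow {1..8}"]) (use complex_subset in auto)
  show "\<And>C. C \<in> cyclic_complex t \<Longrightarrow> finite C"
    using complex_subset finite_subset by blast
  show "\<And>C C'. C \<in> cyclic_complex t \<Longrightarrow> C' \<subseteq> C \<Longrightarrow> C' \<in> cyclic_complex t"
    by (rule complex_face_closed)
  show "inj_on (bary_point v) (weights (cyclic_complex t))"
  proof (rule inj_onI)
    fix w w' assume w: "w \<in> weights (cyclic_complex t)" and w': "w' \<in> weights (cyclic_complex t)"
      and eq: "bary_point v w = bary_point v w'"
    have s: "{i. u i \<noteq> 0} \<in> cyclic_complex t" "{i. u i \<noteq> 0} \<subseteq> {1..8}" "\<And>i. 0 \<le> u i"
      if "u \<in> weights (cyclic_complex t)" for u
      using that complex_subset[of "{i. u i \<noteq> 0}"] by (auto simp: weights_def)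
    \<comment> \<open>Equality of the two points is tested against every affine functional, that is,
      every polynomial of degree at most five.\<close>
    have sumeq: "(\<Sum>i\<in>{1..8}. w i * poly q (t i)) = (\<Sum>i\<in>{1..8}. w' i * poly q (t i))"
      if q: "degree q \<le> 5" for q
    proof -
      obtain a c where ac: "\<And>s. poly q s = a \<bullet> moment_curve s + c"
        using poly_affine_functional[OF q] by blast
      have "(\<Sum>i\<in>{1..8}. u i * poly q (t i)) = a \<bullet> bary_point v u + c" if u: "u \<in> weights (cyclic_complex t)" for u
      proof -
        have "sum u {1..8} = 1" by (rule weights_sum_superset[OF u]) (use s[OF u] in auto)
        moreover have "bary_point v u = (\<Sum>i\<in>{1..8}. u i *\<^sub>R v i)"
          by (rule bary_point_superset) (use s[OF u] in auto)
        ultimately show ?thesis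
          by (simp add: ac inner_sum_right distrib_left sum.distrib sum_distrib_right[symmetric])
      qed
      then show ?thesis using w w' eq by simp
    qed
    \<comment> \<open>Testing with a supporting polynomial of the face that carries \<open>u\<close>
      forces \<open>u'\<close> onto the same face.\<close>
    have sub: "{i. u' i \<noteq> 0} \<subseteq> {i. u i \<noteq> 0}"
      if u: "u \<in> weights (cyclic_complex t)" and u': "u' \<in> weights (cyclic_complex t)"
        and sq: "\<And>q. degree q \<le> 5 \<Longrightarrow> (\<Sum>i\<in>{1..8}. u i * poly q (t i)) = (\<Sum>i\<in>{1..8}. u' i * poly q (t i))" for u u'
    proof -
      obtain q where q: "degree q \<le> 5" "\<forall>i\<in>{1..8}. 0 \<le> poly q (t i)"
        "{i. u i \<noteq> 0} = {i\<in>{1..8}. poly q (t i) = 0}"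
        using s(1)[OF u] unfolding cyclic_complex_def mem_Collect_eq by blast
      have "(\<Sum>i\<in>{1..8}. u' i * poly q (t i)) = (\<Sum>i\<in>{1..8}. u i * poly q (t i))" using sq[OF q(1)] by simp
      also have "\<dots> = 0" by (rule sum.neutral) (use q(3) in auto)
      finally have "\<forall>i\<in>{1..8}. u' i * poly q (t i) = 0"
        using q(2) s(3)[OF u'] by (subst (asm) sum_nonneg_eq_0_iff) auto
      then show ?thesis using q(3) s(2)[OF u'] by auto
    qed
    have supp: "{i. w i \<noteq> 0} = {i. w' i \<noteq> 0}"
      using sub[OF w w' sumeq] sub[OF w' w sumeq[symmetric]] by auto
    show "w = w'"
    proof
      fix k show "w k = w' k"
      proof (cases "w k = 0")
        case True then show ?thesis using supp by auto
      next
        case False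
        obtain p where p: "degree p \<le> 5" "poly p (t k) = 1" "\<And>j. j \<in> {i. w i \<noteq> 0} \<Longrightarrow> j \<noteq> k \<Longrightarrow> poly p (t j) = 0"
          by (rule lagrange_basis[OF s(2)[OF w] card_le_5[OF s(1)[OF w]], of k]) (use False in auto)
        have k8: "k \<in> {1..8}" using False s(2)[OF w] by auto
        have "(\<Sum>i\<in>{1..8}. u i * poly p (t i)) = u k" if "{i. u i \<noteq> 0} = {i. w i \<noteq> 0}" for u
        proof -
          have "(\<Sum>i\<in>{1..8}. u i * poly p (t i)) = (\<Sum>i\<in>{1..8}. if i = k then u i else 0)"
            by (rule sum.cong) (use p that in auto)
          then show ?thesis using k8 by simp
        qed
        then show ?thesis using sumeq[OF p(1)] supp by simp
      qed
    qed
  qed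
qed

section \<open>Faces and frontier of the polytope\<close>

abbreviation P :: "(real ^ 5) set"
  where "P \<equiv> cyclic_polytope t 8"

lemma P_weights: "P = bary_point v ` weights (Pow {1..8})"
  unfolding cyclic_polytope_def by (rule convex_hull_image_weights) simp

lemma functional_face:
  assumes q: "degree q \<le> 5" "\<And>i. i \<in> {1..8} \<Longrightarrow> 0 \<le> poly q (t i)" "\<And>s. poly q s = a \<bullet> moment_curve s + c"
  shows "P \<subseteq> {x. 0 \<le> a \<bullet> x + c}" "P \<inter> {x. a \<bullet> x + c = 0} = convex hull (v ` {i\<in>{1..8}. poly q (t i) = 0})"
proof -
  have val: "a \<bullet> bary_point v w + c = (\<Sum>i\<in>{1..8}. w i * poly q (t i))" if w: "w \<in> weights (Pow {1..8})" for w
  proof -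
    have s: "\<And>i. w i \<noteq> 0 \<Longrightarrow> i \<in> {1..8}" using w by (auto simp: weights_def)
    have "sum w {1..8} = 1" by (rule weights_sum_superset[OF w]) (use s in auto)
    moreover have "bary_point v w = (\<Sum>i\<in>{1..8}. w i *\<^sub>R v i)"
      by (rule bary_point_superset) (use s in auto)
    ultimately show ?thesis
      by (simp add: q(3) inner_sum_right distrib_left sum.distrib sum_distrib_right[symmetric])
  qed
  show "P \<subseteq> {x. 0 \<le> a \<bullet> x + c}"
    unfolding P_weights using q(2) by (auto simp: val weights_def intro!: sum_nonneg)
  show "P \<inter> {x. a \<bullet> x + c = 0} = convex hull (v ` {i\<in>{1..8}. poly q (t i) = 0})" (is "?L = convex hull (v ` ?Z)")
  proof
    show "?L \<subseteq> convex hull (v ` ?Z)"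
    proof
      fix x assume "x \<in> ?L"
      then obtain w where w: "w \<in> weights (Pow {1..8})" "x = bary_point v w" "a \<bullet> x + c = 0"
        unfolding P_weights by auto
      have "(\<Sum>i\<in>{1..8}. w i * poly q (t i)) = 0" using val[OF w(1)] w by simp
      then have "\<forall>i\<in>{1..8}. w i * poly q (t i) = 0"
        using q(2) w(1) by (subst (asm) sum_nonneg_eq_0_iff) (auto simp: weights_def)
      then have "w \<in> weights (Pow ?Z)" using w(1) by (auto simp: weights_def)
      then show "x \<in> convex hull (v ` ?Z)" using convex_hull_image_weights[of ?Z v] w by auto
    qed
    have "v ` ?Z \<subseteq> P" unfolding cyclic_polytope_def by (rule subset_trans[OF _ hull_subset]) auto
    moreover have "convex P" unfolding cyclic_polytope_def by simp
    ultimately have "convex hull (v ` ?Z) \<subseteq> P" by (simp add: hull_minimal)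
    moreover have "convex hull (v ` ?Z) \<subseteq> {x. a \<bullet> x + c = 0}"
    proof (rule hull_minimal)
      show "v ` ?Z \<subseteq> {x. a \<bullet> x + c = 0}" using q(3) by auto
      have "{x. a \<bullet> x + c = 0} = {x. a \<bullet> x = - c}" by auto
      then show "convex {x. a \<bullet> x + c = 0}" by (simp add: convex_hyperplane)
    qed
    ultimately show "convex hull (v ` ?Z) \<subseteq> ?L" by blast
  qed
qed

lemma polytope_P: "polytope P"
  unfolding polytope_def cyclic_polytope_def by blast

text \<open>Every face of a polytope is exposed, so it is cut out by a supporting hyperplane, which
  becomes a polynomial on the moment curve.\<close>

lemma boundary_complex_P: "boundary_complex P = simplices v (cyclic_complex t)"
proof (intro set_eqI iffI)
  fix F assume "F \<in> boundary_complex P"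
  then have F: "F face_of P" "F \<noteq> P" by (auto simp: boundary_complex_def)
  then have "F exposed_face_of P"
    using exposed_face_of_polyhedron polytope_imp_polyhedron[OF polytope_P] by blast
  then obtain a b where ab: "P \<subseteq> {x. a \<bullet> x \<le> b}" "F = P \<inter> {x. a \<bullet> x = b}"
    unfolding exposed_face_of_def by blast
  obtain q where q: "degree q \<le> 5" "\<And>s. poly q s = (- a) \<bullet> moment_curve s + b"
    using affine_functional_poly[of "- a" b] by blast
  have vP: "v i \<in> P" if "i \<in> {1..8}" for i
    unfolding cyclic_polytope_def using that by (auto intro: hull_inc)
  have nn: "0 \<le> poly q (t i)" if "i \<in> {1..8}" for i
    using vP[OF that] ab(1) q(2) by auto
  let ?Z = "{i\<in>{1..8}. poly q (t i) = 0}"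
  have "P \<inter> {x. (- a) \<bullet> x + b = 0} = convex hull (v ` ?Z)" by (rule functional_face(2)[OF q(1) nn q(2)])
  moreover have "{x. (- a) \<bullet> x + b = 0} = {x. a \<bullet> x = b}" by auto
  ultimately have FZ: "F = convex hull (v ` ?Z)" using ab(2) by simp
  have "?Z \<noteq> {1..8}" using F(2) FZ unfolding cyclic_polytope_def by metis
  then have "?Z \<in> cyclic_complex t" using q(1) nn unfolding cyclic_complex_def by blast
  then show "F \<in> simplices v (cyclic_complex t)" using FZ by (auto simp: simplices_def)
next
  fix F assume "F \<in> simplices v (cyclic_complex t)"
  then obtain \<sigma> where \<sigma>: "\<sigma> \<in> cyclic_complex t" "F = convex hull (v ` \<sigma>)" by (auto simp: simplices_def)
  obtain q where q: "degree q \<le> 5" "\<And>i. i \<in> {1..8} \<Longrightarrow> 0 \<le> poly q (t i)"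
    "\<sigma> = {i\<in>{1..8}. poly q (t i) = 0}" "\<sigma> \<noteq> {1..8}" by (rule complexE[OF \<sigma>(1)]) (rule that)
  obtain a c where ac: "\<And>s. poly q s = a \<bullet> moment_curve s + c" using poly_affine_functional[OF q(1)] by blast
  have sub: "P \<subseteq> {x. 0 \<le> a \<bullet> x + c}" and F: "P \<inter> {x. a \<bullet> x + c = 0} = F"
    using functional_face[OF q(1,2) ac] q(3) \<sigma>(2) by auto
  have eq: "{x. a \<bullet> x + c = 0} = {x. a \<bullet> x = - c}" by auto
  have "(P \<inter> {x. a \<bullet> x = - c}) face_of P"
    by (rule face_of_Int_supporting_hyperplane_ge) (use sub in \<open>auto simp: cyclic_polytope_def\<close>)
  then have "F face_of P" using F eq by simp
  moreover have "F \<noteq> P"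
  proof
    assume "F = P"
    obtain i where i: "i \<in> {1..8}" "i \<notin> \<sigma>" using q(3,4) by blast
    have "v i \<in> P" unfolding cyclic_polytope_def using i by (auto intro: hull_inc)
    then have "poly q (t i) = 0" using \<open>F = P\<close> F ac by auto
    then show False using i q(3) by auto
  qed
  ultimately show "F \<in> boundary_complex P" by (simp add: boundary_complex_def)
qed

text \<open>A hyperplane containing the polytope would be a polynomial of degree at most five with
  eight roots.\<close>

lemma interior_P: "interior P \<noteq> {}"
proof
  assume "interior P = {}"
  then obtain a b where ab: "a \<noteq> 0" "P \<subseteq> {x. a \<bullet> x = b}"
    using empty_interior_subset_hyperplane[of P] unfolding cyclic_polytope_def by blast
  obtain q where q: "degree q \<le> 5" "\<And>s. poly q s = a \<bullet> moment_curve s + (- b)" "q = 0 \<longrightarrow> a = 0"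
    using affine_functional_poly[of a "- b"] by blast
  have "q = 0"
  proof (rule poly_zero[OF q(1), of "{1..8}"])
    fix i :: nat assume "i \<in> {1..8}"
    then have "v i \<in> P" unfolding cyclic_polytope_def by (auto intro: hull_inc)
    then show "poly q (t i) = 0" using ab(2) q(2) by auto
  qed auto
  then show False using q(3) ab(1) by simp
qed

lemma frontier_P: "frontier P = realization v (cyclic_complex t)"
proof -
  have "rel_frontier P = \<Union>{F. F face_of P \<and> F \<noteq> P}"
    by (rule rel_frontier_of_polyhedron_alt[OF polytope_imp_polyhedron[OF polytope_P]])
  then have "rel_frontier P = \<Union>(boundary_complex P)" by (simp add: boundary_complex_def)
  moreover have "rel_frontier P = frontier P"
    using interior_P by (simp add: rel_frontier_nonempty_interior)
  ultimately show ?thesis by (simp add: boundary_complex_P Union_realization)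
qed

text \<open>Among seven points the divided difference of order six annihilates polynomials of degree at
  most five, and its coefficients alternate in sign.\<close>

lemma alternating_zero:
  assumes I: "I \<subseteq> {1..8}" "card I = 7" and q: "degree q \<le> 5"
    and nn: "\<And>i. i \<in> I \<Longrightarrow> 0 \<le> poly q (t i)"
    and z: "\<And>i. i \<in> I \<Longrightarrow> even (card {j\<in>I. i < j}) = e \<Longrightarrow> poly q (t i) = 0"
  shows "q = 0"
proof -
  have fin: "finite I" using I finite_subset by blast
  let ?m = "\<lambda>i. \<Prod>j\<in>I - {i}. [:- t j, 1:]"
  \<comment> \<open>The coefficients of the divided difference of order six at the seven
    parameters.\<close>
  define c where "c i = inverse (\<Prod>j\<in>I - {i}. t i - t j)" for i
  have dm: "degree (?m i) \<le> 6" "coeff (?m i) 6 = 1" if "i \<in> I" for i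
  proof -
    have "degree (?m i) = (\<Sum>j\<in>I - {i}. degree [:- t j, 1:])"
      by (rule degree_prod_eq_sum_degree) auto
    also have "\<dots> = 6" using that I fin by simp
    finally have d: "degree (?m i) = 6" .
    then show "degree (?m i) \<le> 6" by simp
    have "lead_coeff (?m i) = 1" by (simp add: lead_coeff_prod)
    then show "coeff (?m i) 6 = 1" using d by simp
  qed
  have nz: "(\<Prod>j\<in>I - {i}. t i - t j) \<noteq> 0" if "i \<in> I" for i
  proof -
    have "t i - t j \<noteq> 0" if "j \<in> I - {i}" for j using that \<open>i \<in> I\<close> subsetD[OF I(1), of i] subsetD[OF I(1), of j] t_eq[of i j] by auto
    then show ?thesis using fin by simp
  qed
  have mv: "poly (?m i) (t k) = (if k = i then inverse (c i) else 0)" if "i \<in> I" "k \<in> I" for i k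
  proof (cases "k = i")
    case True then show ?thesis by (simp add: c_def poly_prod)
  next
    case False
    then have "poly (?m i) (t k) = 0" unfolding poly_prod by (intro prod_zero) (use that fin in auto)
    then show ?thesis using False by simp
  qed
  define L where "L = (\<Sum>i\<in>I. smult (poly q (t i) * c i) (?m i))"
  have "L = q"
  proof (rule poly_eqI_degree[of "t ` I"])
    fix x assume "x \<in> t ` I"
    then obtain k where k: "k \<in> I" "x = t k" by auto
    have "poly L x = (\<Sum>i\<in>I. if i = k then poly q (t k) else 0)"
      unfolding L_def poly_sum k using mv[OF _ k(1)] nz
      by (intro sum.cong) (auto simp: c_def)
    then show "poly L x = poly q x" using k fin by simp
  next
    have card: "card (t ` I) = 7" using I inj_on_subset[OF t_inj I(1)] by (simp add: card_image)
    have "degree L \<le> 6"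
      unfolding L_def by (rule degree_sum_le[OF fin]) (rule order_trans[OF degree_smult_le dm(1)])
    then show "card (t ` I) > degree L" using card by simp
    show "card (t ` I) > degree q" using card q by simp
  qed
  \<comment> \<open>The coefficient of degree six of the interpolation polynomial is the divided
    difference; it vanishes as \<open>q\<close> has lower degree.\<close>
  then have "coeff L 6 = 0" using q by (simp add: coeff_eq_0)
  moreover have "coeff L 6 = (\<Sum>i\<in>I. poly q (t i) * c i)"
    unfolding L_def by (simp add: coeff_sum dm cong: sum.cong)
  ultimately have sum0: "(\<Sum>i\<in>I. poly q (t i) * c i) = 0" by simp
  have sgn: "0 < (- 1) ^ card {j\<in>I. i < j} * c i" if i: "i \<in> I" for i
  proof -
    have "(\<Prod>j\<in>I - {i}. t i - t j) = (\<Prod>j\<in>I - {i}. (if i < j then - 1 else 1) * \<bar>t i - t j\<bar>)"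
    proof (rule prod.cong[OF refl])
      fix j assume "j \<in> I - {i}"
      then show "t i - t j = (if i < j then - 1 else 1) * \<bar>t i - t j\<bar>"
        using t_less[of i j] t_less[of j i] i subsetD[OF I(1), of i] subsetD[OF I(1), of j]
        by (cases i j rule: linorder_cases) (auto simp: abs_if)
    qed
    also have "\<dots> = (\<Prod>j\<in>I - {i}. if i < j then - 1 else 1) * (\<Prod>j\<in>I - {i}. \<bar>t i - t j\<bar>)"
      by (rule prod.distrib)
    also have "(\<Prod>j\<in>I - {i}. if i < j then - 1 else (1::real)) = (\<Prod>j\<in>{j\<in>I. i < j}. - 1)"
      by (rule prod.mono_neutral_cong_right) (use fin in auto)
    finally have p: "(\<Prod>j\<in>I - {i}. t i - t j) = (- 1) ^ card {j\<in>I. i < j} * (\<Prod>j\<in>I - {i}. \<bar>t i - t j\<bar>)"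
      by simp
    have "0 < (\<Prod>j\<in>I - {i}. \<bar>t i - t j\<bar>)"
    proof (rule prod_pos)
      fix j assume "j \<in> I - {i}"
      then show "0 < \<bar>t i - t j\<bar>" using i subsetD[OF I(1), of i] subsetD[OF I(1), of j] t_eq[of i j] by auto
    qed
    then show ?thesis unfolding c_def p by (cases "even (card {j\<in>I. i < j})") auto
  qed
  \<comment> \<open>The terms with parity \<open>e\<close> vanish; \<open>s\<close> is the common
    sign of the remaining coefficients.\<close>
  define s where "s = (if e then - 1 else (1::real))"
  have term_nonneg: "0 \<le> s * (poly q (t i) * c i)" if "i \<in> I" for i
  proof (cases "even (card {j\<in>I. i < j}) = e")
    case True then show ?thesis using z[OF that] by simp
  next
    case False
    then have "0 < s * c i" using sgn[OF that] by (auto simp: s_def split: if_splits)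
    then have "0 \<le> poly q (t i) * (s * c i)" using nn[OF that] by simp
    then show ?thesis by (simp add: ac_simps)
  qed
  have "(\<Sum>i\<in>I. s * (poly q (t i) * c i)) = 0" using sum0 by (simp add: sum_distrib_left[symmetric])
  then have "\<forall>i\<in>I. s * (poly q (t i) * c i) = 0"
    using term_nonneg fin by (subst (asm) sum_nonneg_eq_0_iff) auto
  then have "poly q (t i) = 0" if "i \<in> I" for i
    using that sgn[OF that] by (auto simp: s_def split: if_splits)
  then show ?thesis using poly_zero[OF q I(1)] I(2) by simp
qed

text \<open>Seven points of the curve in dimension five form a circuit whose Radon parts alternate;
  \<open>e\<close> selects one part. A hyperplane supporting a face that contains this part would
  contain all seven points and then every vertex.\<close>

lemma nonface:
  assumes "I \<subseteq> {1..8}" "card I = 7" "{i\<in>I. even (card {j\<in>I. i < j}) = e} \<subseteq> \<sigma>"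
  shows "\<sigma> \<notin> cyclic_complex t"
proof
  assume \<sigma>: "\<sigma> \<in> cyclic_complex t"
  obtain q where q: "degree q \<le> 5" "\<And>i. i \<in> {1..8} \<Longrightarrow> 0 \<le> poly q (t i)"
    "\<sigma> = {i\<in>{1..8}. poly q (t i) = 0}" "\<sigma> \<noteq> {1..8}" by (rule complexE[OF \<sigma>]) (rule that)
  have "q = 0"
    by (rule alternating_zero[OF assms(1,2) q(1), of e]) (use q assms in auto)
  then show False using q(3,4) by auto
qed

end

section \<open>The faces of the dunce hat\<close>

text \<open>Gale's evenness condition in odd dimension: an end vertex 1 or 8 together with two
  disjoint pairs of consecutive vertices. There are 20 such sets.\<close>

definition facet_list :: "nat list list"
  where "facet_list = [
     [1, 2, 3, 4, 5], [1, 2, 3, 4, 8], [1, 2, 3, 5, 6], [1, 2, 3, 6, 7], [1, 2, 3, 7, 8],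
     [1, 2, 4, 5, 8], [1, 2, 5, 6, 8], [1, 2, 6, 7, 8], [1, 3, 4, 5, 6], [1, 3, 4, 6, 7],
     [1, 3, 4, 7, 8], [1, 4, 5, 6, 7], [1, 4, 5, 7, 8], [1, 5, 6, 7, 8], [2, 3, 4, 5, 8],
     [2, 3, 5, 6, 8], [2, 3, 6, 7, 8], [3, 4, 5, 6, 8], [3, 4, 6, 7, 8], [4, 5, 6, 7, 8]]"

definition dunce_list :: "nat list list"
  where "dunce_list = [
     [1, 2, 4], [2, 3, 4], [3, 4, 6], [1, 3, 6], [1, 2, 6], [2, 5, 6], [2, 3, 5], [1, 3, 5], [1, 2, 7],
     [1, 4, 7], [2, 7, 8], [4, 5, 7], [5, 7, 8], [2, 3, 8], [1, 3, 8], [1, 5, 8], [4, 5, 6]]"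

text \<open>The tests on lists are written with nested \<open>if\<close> so that evaluation can stop
  at the first decisive comparison.\<close>

fun member_list :: "nat \<Rightarrow> nat list \<Rightarrow> bool"
  where "member_list x [] = False"
  | "member_list x (y # ys) = (if x = y then True else member_list x ys)"

fun subset_list :: "nat list \<Rightarrow> nat list \<Rightarrow> bool"
  where "subset_list [] ys = True"
  | "subset_list (x # xs) ys = (if member_list x ys then subset_list xs ys else False)"

lemma member_list_iff [simp]: "member_list x ys \<longleftrightarrow> x \<in> set ys"
  by (induction ys) auto

lemma subset_list_iff [simp]: "subset_list xs ys \<longleftrightarrow> set xs \<subseteq> set ys"
  by (induction xs) auto

definition face_list :: "nat list \<Rightarrow> bool"
  where "face_list s = list_ex (subset_list s) facet_list"

definition dunce_face_list :: "nat list \<Rightarrow> bool"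
  where "dunce_face_list s = list_ex (subset_list s) dunce_list"

text \<open>Alternating vertices among seven of the eight: the second, fourth and sixth for the
  triples, the odd positions for the quadruples.\<close>

definition nonface_list :: "nat list list"
  where "nonface_list = [[2,4,6], [2,4,7], [2,5,7], [3,5,7], [1,3,5,8], [1,3,6,8], [1,4,6,8]]"

definition vertex_lists :: "nat list list"
  where "vertex_lists = subseqs [1,2,3,4,5,6,7,8]"

text \<open>Settles all 256 vertex sets. Completeness of the facet list is thus obtained by
  exclusion: whatever fits into no listed facet contains part of a circuit.\<close>

lemma nonface_or_face:
  "list_all (\<lambda>s. if face_list s then True else list_ex (\<lambda>n. subset_list n s) nonface_list)
     vertex_lists"
  by code_simp

lemma sublist_of_8:
  assumes "\<sigma> \<subseteq> {1..8}"
  obtains s where "s \<in> set vertex_lists" "\<sigma> = set s"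
proof -
  have "\<sigma> \<in> Pow (set [1,2,3,4,5,6,7,8])" using assms by (auto simp: atLeastAtMost_upt upt_rec)
  then show thesis using that unfolding subseqs_powset[symmetric] vertex_lists_def[symmetric] by auto
qed

section \<open>The dunce hat as a subcomplex\<close>

definition dunce_faces :: "nat set set"
  where "dunce_faces = {\<sigma>. \<exists>T\<in>dunce_triangles. \<sigma> \<subseteq> T}"

lemma dunce_triangles_list: "dunce_triangles = set ` set dunce_list"
  by (simp add: dunce_triangles_def dunce_list_def)

lemma dunce_face_list_iff: "dunce_face_list s \<longleftrightarrow> set s \<in> dunce_faces"
  by (simp add: dunce_face_list_def dunce_faces_def dunce_triangles_list list_ex_iff)

lemma dunce_faces_closed: "\<sigma> \<in> dunce_faces \<Longrightarrow> \<sigma>' \<subseteq> \<sigma> \<Longrightarrow> \<sigma>' \<in> dunce_faces"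
  by (auto simp: dunce_faces_def)

lemma dunce_in_facet: "list_all face_list dunce_list"
  by code_simp

lemma facet_shape:
  "list_all (\<lambda>F. list_ex (\<lambda>e. list_ex (\<lambda>i. list_ex (\<lambda>j. subset_list F [e, i, Suc i, j, Suc j])
     [1,2,3,4,5,6,7]) [1,2,3,4,5,6,7]) [1,8]) facet_list"
  by code_simp

context cyclic_vertices
begin

lemma pair_nonneg:
  assumes "i \<in> {1..8}" "Suc i \<in> {1..8}" "k \<in> {1..8}"
  shows "0 \<le> (t k - t i) * (t k - t (Suc i))"
proof (cases "k \<le> i")
  case True
  then have "t k \<le> t i" "t k \<le> t (Suc i)" using t_le assms by auto
  then show ?thesis by (intro mult_nonpos_nonpos) auto
next
  case False
  then have "t i \<le> t k" "t (Suc i) \<le> t k" using t_le assms by auto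
  then show ?thesis by auto
qed

text \<open>The product of the five linear factors, with a sign for the end vertex, is nonnegative
  at all parameters because no parameter lies strictly between those of consecutive
  vertices.\<close>

lemma facet_even:
  assumes "e \<in> {1, 8}" "i \<in> {1..8}" "Suc i \<in> {1..8}" "j \<in> {1..8}" "Suc j \<in> {1..8}"
  shows "{e, i, Suc i, j, Suc j} \<in> cyclic_complex t"
proof -
  define s where "s = (if e = 1 then 1 else - 1 :: real)"
  define q where "q = smult s [:- t e, 1:] * ([:- t i, 1:] * [:- t (Suc i), 1:]) * ([:- t j, 1:] * [:- t (Suc j), 1:])"
  have pq: "poly q x = s * (x - t e) * ((x - t i) * (x - t (Suc i))) * ((x - t j) * (x - t (Suc j)))" for x
    by (simp add: q_def algebra_simps)
  have s0: "s \<noteq> 0" by (simp add: s_def)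
  have e8: "e \<in> {1..8}" using assms by auto
  have end_nonneg: "0 \<le> s * (t k - t e)" if "k \<in> {1..8}" for k
    using assms(1) that t_le[of e k] t_le[of k e] e8 by (auto simp: s_def)
  have deg: "degree q \<le> 5"
    unfolding q_def by (auto intro!: order_trans[OF degree_mult_le])
  have "{e, i, Suc i, j, Suc j} = {k\<in>{1..8}. poly q (t k) = 0}" (is "?S = ?Z")
  proof
    show "?S \<subseteq> ?Z" using assms e8 by (auto simp: pq)
    show "?Z \<subseteq> ?S"
    proof
      fix k assume k: "k \<in> ?Z"
      then have "t k = t e \<or> t k = t i \<or> t k = t (Suc i) \<or> t k = t j \<or> t k = t (Suc j)"
        using s0 by (auto simp: pq)
      then show "k \<in> ?S" using k assms e8 t_eq[of k] by auto
    qed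
  qed
  moreover have "\<forall>k\<in>{1..8}. 0 \<le> poly q (t k)"
    unfolding pq using pair_nonneg assms end_nonneg by (auto intro!: mult_nonneg_nonneg)
  moreover have "?S \<noteq> {1..8}"
  proof
    assume eq: "?S = {1..8}"
    have "card ?S \<le> 5" by (simp add: card_insert_if)
    then show False unfolding eq by simp
  qed
  ultimately show ?thesis using deg unfolding cyclic_complex_def by blast
qed

lemma facet_in_complex: "F \<in> set facet_list \<Longrightarrow> set F \<in> cyclic_complex t"
proof -
  assume "F \<in> set facet_list"
  then have "\<exists>e\<in>set [1,8]. \<exists>i\<in>set [1,2,3,4,5,6,7]. \<exists>j\<in>set [1,2,3,4,5,6,7].
      subset_list F [e, i, Suc i, j, Suc j]"
    by (rule bspec[OF facet_shape[unfolded list_all_iff list_ex_iff]])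
  then obtain e i j where eij: "e \<in> set [1,8]" "i \<in> set [1,2,3,4,5,6,7]" "j \<in> set [1,2,3,4,5,6,7]"
    "subset_list F [e, i, Suc i, j, Suc j]" by blast
  then have "{e, i, Suc i, j, Suc j} \<in> cyclic_complex t" by (intro facet_even) auto
  then show ?thesis by (rule complex_face_closed) (use eij(4) in simp)
qed

lemma nonface_list_nonface: "n \<in> set nonface_list \<Longrightarrow> set n \<subseteq> \<sigma> \<Longrightarrow> \<sigma> \<notin> cyclic_complex t"
proof -
  have *: "set n \<subseteq> \<sigma> \<Longrightarrow> \<sigma> \<notin> cyclic_complex t"
    if "set I \<subseteq> {1..8}" "distinct I" "length I = 7"
      "set n = {i\<in>set I. even (length (filter (\<lambda>j. i < j) I)) = e}" for I n e
  proof (rule nonface[of "set I" e])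
    have "card {j\<in>set I. i < j} = length (filter (\<lambda>j. i < j) I)" for i
      using that(2) distinct_card[of "filter (\<lambda>j. i < j) I"] by simp
    then show "set n \<subseteq> \<sigma> \<Longrightarrow> {i \<in> set I. even (card {j \<in> set I. i < j}) = e} \<subseteq> \<sigma>" using that(4) by simp
    show "set I \<subseteq> {1..8}" by (rule that(1))
    show "card (set I) = 7" using distinct_card[OF that(2)] that(3) by simp
  qed
  assume n: "n \<in> set nonface_list" and sub: "set n \<subseteq> \<sigma>"
  have "n = [2,4,6] \<or> n = [2,4,7] \<or> n = [2,5,7] \<or> n = [3,5,7] \<or> n = [1,3,5,8] \<or> n = [1,3,6,8] \<or> n = [1,4,6,8]"
    using n by (simp add: nonface_list_def)
  then show ?thesis
  proof (elim disjE)
    assume "n = [2,4,6]" show ?thesis by (rule *[OF _ _ _ _ sub, of "[1,2,3,4,5,6,7]" False]) (use \<open>n = _\<close> in auto)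
  next
    assume "n = [2,4,7]" show ?thesis by (rule *[OF _ _ _ _ sub, of "[1,2,3,4,5,7,8]" False]) (use \<open>n = _\<close> in auto)
  next
    assume "n = [2,5,7]" show ?thesis by (rule *[OF _ _ _ _ sub, of "[1,2,3,5,6,7,8]" False]) (use \<open>n = _\<close> in auto)
  next
    assume "n = [3,5,7]" show ?thesis by (rule *[OF _ _ _ _ sub, of "[2,3,4,5,6,7,8]" False]) (use \<open>n = _\<close> in auto)
  next
    assume "n = [1,3,5,8]" show ?thesis by (rule *[OF _ _ _ _ sub, of "[1,2,3,4,5,6,8]" True]) (use \<open>n = _\<close> in auto)
  next
    assume "n = [1,3,6,8]" show ?thesis by (rule *[OF _ _ _ _ sub, of "[1,2,3,4,6,7,8]" True]) (use \<open>n = _\<close> in auto)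
  next
    assume "n = [1,4,6,8]" show ?thesis by (rule *[OF _ _ _ _ sub, of "[1,2,4,5,6,7,8]" True]) (use \<open>n = _\<close> in auto)
  qed
qed

lemma complex_iff: "\<sigma> \<in> cyclic_complex t \<longleftrightarrow> (\<exists>F\<in>set facet_list. \<sigma> \<subseteq> set F)"
proof
  assume \<sigma>: "\<sigma> \<in> cyclic_complex t"
  obtain s where s: "s \<in> set vertex_lists" "\<sigma> = set s"
    by (rule sublist_of_8[OF complex_subset[OF \<sigma>]])
  then have "face_list s \<or> list_ex (\<lambda>n. subset_list n s) nonface_list"
    using nonface_or_face unfolding list_all_iff by (auto split: if_splits)
  then show "\<exists>F\<in>set facet_list. \<sigma> \<subseteq> set F"
    using nonface_list_nonface \<sigma> s(2) by (auto simp: face_list_def list_ex_iff)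
qed (use facet_in_complex complex_face_closed in blast)

lemma face_list_iff: "face_list s \<longleftrightarrow> set s \<in> cyclic_complex t"
  by (simp add: face_list_def complex_iff list_ex_iff)

lemma dunce_subset_complex: "dunce_faces \<subseteq> cyclic_complex t"
proof
  fix \<sigma> assume "\<sigma> \<in> dunce_faces"
  then obtain T where T: "T \<in> set dunce_list" "\<sigma> \<subseteq> set T" by (auto simp: dunce_faces_def dunce_triangles_list)
  then have "face_list T" using dunce_in_facet by (auto simp: list_all_iff)
  then show "\<sigma> \<in> cyclic_complex t" using T face_list_iff complex_face_closed by blast
qed

lemma dunce_complex_eq: "dunce_complex t = simplices v dunce_faces"
proof -
  have "F face_of convex hull (v ` T) \<longleftrightarrow> (\<exists>\<sigma>\<subseteq>T. F = convex hull (v ` \<sigma>))" if "T \<in> dunce_triangles" for F T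
  proof -
    have "T \<in> dunce_faces" using that by (auto simp: dunce_faces_def)
    then have "\<not> affine_dependent (v ` T)" using affine_independent_simplex dunce_subset_complex by blast
    then show ?thesis by (simp add: face_of_convex_hull_affine_independent subset_image_iff) blast
  qed
  then show ?thesis
    unfolding dunce_complex_def simplices_def dunce_faces_def by blast
qed

lemma Union_dunce_complex: "\<Union>(dunce_complex t) = realization v dunce_faces"
  by (simp add: dunce_complex_eq Union_realization)

lemma dunce_complex_boundary: "dunce_complex t \<subseteq> boundary_complex P"
  unfolding dunce_complex_eq boundary_complex_P simplices_def using dunce_subset_complex by blast

lemma finite_dunce_faces: "finite dunce_faces"
  using finite_subset[OF dunce_subset_complex finite_complex] .

text \<open>For the intersection property: two cells are faces of the polytope, so their
  intersection is a face of it and hence of either cell.\<close>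

lemma simplicial_dunce_complex: "simplicial_complex (dunce_complex t)"
  unfolding simplicial_complex_def
proof (intro conjI ballI allI impI)
  show "finite (dunce_complex t)"
    unfolding dunce_complex_eq simplices_def using finite_dunce_faces by simp
  fix S assume "S \<in> dunce_complex t"
  then obtain \<sigma> where \<sigma>: "\<sigma> \<in> dunce_faces" "S = convex hull (v ` \<sigma>)"
    by (auto simp: dunce_complex_eq simplices_def)
  have "\<not> affine_dependent (v ` \<sigma>)" using affine_independent_simplex dunce_subset_complex \<sigma>(1) by blast
  then show "\<exists>n. n simplex S"
    unfolding simplex_def \<sigma>(2) by (intro exI[of _ "int (card (v ` \<sigma>)) - 1"] exI[of _ "v ` \<sigma>"]) simp
next
  fix F S assume "S \<in> dunce_complex t \<and> F face_of S"
  then show "F \<in> dunce_complex t" unfolding dunce_complex_def by (blast intro: face_of_trans)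
next
  fix S S' assume SS: "S \<in> dunce_complex t \<and> S' \<in> dunce_complex t"
  then have f: "S face_of P" "S' face_of P" using dunce_complex_boundary by (auto simp: boundary_complex_def)
  then have "S \<inter> S' face_of P" by (rule face_of_Int)
  then show "S \<inter> S' face_of S" by (rule face_of_subset[OF _ _ face_of_imp_subset[OF f(1)]]) auto
qed

lemma regular_neighborhood_eq:
  "regular_neighborhood (boundary_complex P) (\<Union>(dunce_complex t)) =
    {p \<in> frontier P. \<exists>S\<in>dunce_faces - {{}}. \<forall>T. sd_coord p T \<le> sd_coord p S}"
  unfolding boundary_complex_P Union_dunce_complex frontier_P
  by (rule regular_neighborhood_simplices[OF dunce_subset_complex dunce_faces_closed])

end

section \<open>Contractibility\<close>

definition face_closed_family :: "'v set set \<Rightarrow> bool"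
  where "face_closed_family \<L> \<longleftrightarrow> (\<forall>C\<in>\<L>. \<forall>C'\<subseteq>C. C' \<in> \<L>)"

context geometric_complex
begin

text \<open>The simplex \<open>insert a f\<close> meets the rest in the horn of its faces other than
  \<open>f\<close> and itself, a cone with apex \<open>a\<close>. Simplex and horn are absolute
  retracts, and for closed sets this lets the gluing be both done and undone. The equivalence
  therefore serves for expansions and for collapses.\<close>

lemma AR_elementary_expansion:
  assumes L: "\<L> \<subseteq> \<K>" "face_closed_family \<L>" and c: "insert a f \<in> \<K>"
    and f: "f \<noteq> {}" "a \<notin> f" "f \<notin> \<L>"
    and faces: "\<And>g. g \<subseteq> insert a f \<Longrightarrow> g \<noteq> f \<Longrightarrow> g \<noteq> insert a f \<Longrightarrow> g \<in> \<L>"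
  shows "AR (realization b (\<L> \<union> {f, insert a f})) \<longleftrightarrow> AR (realization b \<L>)"
proof -
  let ?c = "insert a f"
  let ?H = "convex hull (b ` ?c)"
  let ?\<Lambda> = "Pow ?c - {f, ?c}"
  have finc: "finite ?c" by (rule finite_simplex[OF c])
  have Lc: "C' \<in> \<L>" if "C \<in> \<L>" "C' \<subseteq> C" for C C' using L(2) that by (auto simp: face_closed_family_def)
  have cL: "?c \<notin> \<L>" using Lc[of ?c f] f(3) by blast
  have un: "realization b (\<L> \<union> {f, ?c}) = realization b \<L> \<union> ?H"
  proof -
    have "convex hull (b ` f) \<subseteq> ?H" by (rule hull_mono) auto
    then show ?thesis by (auto simp: realization_def)
  qed
  have int: "realization b \<L> \<inter> ?H = realization b ?\<Lambda>"
  proof -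
    have "realization b ?\<Lambda> = {p \<in> realization b \<K>. {v. coord p v \<noteq> 0} \<in> ?\<Lambda>}"
    proof -
      have "realization b ?\<Lambda> = (\<Union>C\<in>?\<Lambda>. {p \<in> realization b \<K>. {v. coord p v \<noteq> 0} \<subseteq> C})"
        unfolding realization_def[of b ?\<Lambda>]
        by (rule SUP_cong[OF refl]) (use face_closed[OF c] in \<open>auto intro!: convex_hull_eq_support\<close>)
      also have "\<dots> = {p \<in> realization b \<K>. {v. coord p v \<noteq> 0} \<in> ?\<Lambda>}"
      proof -
        have "g' \<in> ?\<Lambda>" if "g' \<subseteq> g" "g \<in> ?\<Lambda>" for g g'
        proof -
          have "g \<in> \<L>" using faces that(2) by auto
          then have "g' \<in> \<L>" using Lc that(1) by blast
          then show ?thesis using that f(3) cL by auto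
        qed
        then show ?thesis by blast
      qed
      finally show ?thesis .
    qed
    moreover have L_eq: "realization b \<L> = {p \<in> realization b \<K>. {v. coord p v \<noteq> 0} \<in> \<L>}"
      by (rule realization_subcomplex[OF L(1)]) (rule Lc)
    have H_eq: "?H = {p \<in> realization b \<K>. {v. coord p v \<noteq> 0} \<subseteq> ?c}" by (rule convex_hull_eq_support[OF c])
    have mem: "g \<in> ?\<Lambda> \<longleftrightarrow> g \<in> \<L> \<and> g \<subseteq> ?c" for g using faces[of g] f(3) cL by auto
    have "realization b \<L> \<inter> ?H = {p \<in> realization b \<K>. {v. coord p v \<noteq> 0} \<in> ?\<Lambda>}"
      unfolding L_eq H_eq mem by blast
    ultimately show ?thesis by simp
  qed
  have AR_\<Lambda>: "AR (realization b ?\<Lambda>)"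
    unfolding AR_ANR
  proof (intro conjI)
    have "realization b ?\<Lambda> = \<Union>((\<lambda>C. convex hull (b ` C)) ` ?\<Lambda>)" by (simp add: realization_def)
    moreover have "ANR (\<Union>((\<lambda>C. convex hull (b ` C)) ` ?\<Lambda>))"
      using finc by (intro ANR_finite_Union_convex_closed)
        (auto intro!: compact_imp_closed finite_imp_compact_convex_hull intro: finite_subset)
    ultimately show "ANR (realization b ?\<Lambda>)" by simp
    have aL: "{a} \<in> ?\<Lambda>" using f(1,2) by auto
    have ba: "b a \<in> realization b ?\<Lambda>"
      unfolding realization_def using aL by (intro UN_I[OF aL]) (simp add: hull_inc)
    then show "realization b ?\<Lambda> \<noteq> {}" by blast
    \<comment> \<open>Adding \<open>a\<close> to a face of the horn stays in the horn: the whole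
      simplex could arise only from \<open>f\<close> or from itself.\<close>
    have "starlike (realization b ?\<Lambda>)"
      unfolding starlike_def
    proof (intro bexI[OF _ ba] ballI)
      fix p assume "p \<in> realization b ?\<Lambda>"
      then obtain g where g: "g \<in> ?\<Lambda>" "p \<in> convex hull (b ` g)" by (auto simp: realization_def)
      have "insert a g \<in> ?\<Lambda>" using g(1) f(2) by auto
      moreover have "closed_segment (b a) p \<subseteq> convex hull (b ` insert a g)"
      proof (rule closed_segment_subset)
        show "b a \<in> convex hull (b ` insert a g)" by (rule hull_inc) simp
        show "p \<in> convex hull (b ` insert a g)" using g(2) hull_mono[of "b ` g" "b ` insert a g"] by blast
      qed simp
      ultimately show "closed_segment (b a) p \<subseteq> realization b ?\<Lambda>"
        unfolding realization_def by (rule SUP_upper2)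
    qed
    then show "contractible (realization b ?\<Lambda>)" by (rule starlike_imp_contractible)
  qed
  have cl: "closed (realization b \<L>)"
    unfolding realization_def using L(1) finite_simplex
    by (intro compact_imp_closed compact_UN finite_subset[OF L(1) finite_complex]
        finite_imp_compact_convex_hull finite_imageI) auto
  have clH: "closed ?H" using finc by (intro compact_imp_closed finite_imp_compact_convex_hull) auto
  have "AR ?H" by (rule convex_imp_AR) auto
  then show ?thesis
    using AR_closed_Un[OF cl clH] AR_from_Un_Int[OF cl clH] AR_\<Lambda> unfolding un int by blast
qed

lemma face_closed_expansion:
  assumes "face_closed_family \<L>" "\<And>g. g \<subseteq> insert a f \<Longrightarrow> g \<noteq> f \<Longrightarrow> g \<noteq> insert a f \<Longrightarrow> g \<in> \<L>"
  shows "face_closed_family (\<L> \<union> {f, insert a f})"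
  unfolding face_closed_family_def
proof (intro ballI allI impI)
  fix C C' assume C: "C \<in> \<L> \<union> {f, insert a f}" "C' \<subseteq> C"
  show "C' \<in> \<L> \<union> {f, insert a f}"
  proof (cases "C \<in> \<L>")
    case True then show ?thesis using assms(1) C(2) by (auto simp: face_closed_family_def)
  next
    case False
    then have "C' \<subseteq> insert a f" using C by auto
    then show ?thesis using assms(2) by blast
  qed
qed

end

section \<open>Elementary expansions as a finite computation\<close>

definition same_set :: "nat list \<Rightarrow> nat list \<Rightarrow> bool"
  where "same_set xs ys = (if subset_list xs ys then subset_list ys xs else False)"

definition occurs :: "nat list \<Rightarrow> nat list list \<Rightarrow> bool"
  where "occurs xs S = list_ex (same_set xs) S"

fun expands :: "nat list list \<Rightarrow> (nat \<times> nat list) list \<Rightarrow> bool"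
  where "expands S [] = True"
  | "expands S ((a, f) # xs) = (if f \<noteq> [] \<and> \<not> member_list a f \<and> \<not> occurs f S \<and>
       list_all (\<lambda>g. if same_set g f then True else if same_set g (a # f) then True else occurs g S) (subseqs (a # f))
     then expands (f # (a # f) # S) xs else False)"

fun expansion :: "nat list list \<Rightarrow> (nat \<times> nat list) list \<Rightarrow> nat list list"
  where "expansion S [] = S"
  | "expansion S ((a, f) # xs) = expansion (f # (a # f) # S) xs"

lemma same_set_iff [simp]: "same_set xs ys \<longleftrightarrow> set xs = set ys"
  by (auto simp: same_set_def)

lemma occurs_iff: "occurs xs S \<longleftrightarrow> set xs \<in> set ` set S"
  by (auto simp: occurs_def list_ex_iff)

text \<open>A sequence of elementary expansions from the vertex 7 to the dunce hat together with the
  simplices 358 and 1358. The pair \<open>(a, f)\<close> adds the simplices \<open>f\<close> and \<open>f \<union> {a}\<close>.\<close>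

definition dunce_expansion :: "(nat \<times> nat list) list"
  where "dunce_expansion = [
     (7, [5]), (7, [2]), (2, [6]), (5, [8]), (7, [1]), (8, [3]), (7, [4]), (7, [1, 2]),
     (2, [1, 6]), (7, [1, 4]), (5, [7, 8]), (7, [4, 5]), (7, [2, 8]), (8, [3, 5]), (8, [2, 3]), (3, [2, 5]),
     (2, [5, 6]), (5, [4, 6]), (1, [2, 4]), (2, [3, 4]), (4, [3, 6]), (6, [1, 3]), (3, [1, 5]), (5, [1, 8]),
     (5, [1, 3, 8])]"

lemma expands_dunce: "expands [[7], []] dunce_expansion"
  by code_simp

lemma expansion_dunce_sound:
  "list_all (\<lambda>s. if dunce_face_list s then True else if same_set s [3,5,8] then True else same_set s [1,3,5,8])
     (expansion [[7], []] dunce_expansion)"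
  by code_simp

lemma expansion_dunce_complete:
  "list_all (\<lambda>s. if dunce_face_list s then occurs s (expansion [[7], []] dunce_expansion) else True) vertex_lists"
  by code_simp

lemma expansion_dunce_extra:
  "list_all (\<lambda>s. occurs s (expansion [[7], []] dunce_expansion)) [[3,5,8], [1,3,5,8]]"
  by code_simp

lemma expansion_dunce:
  "set ` set (expansion [[7], []] dunce_expansion) = dunce_faces \<union> {{3,5,8}, insert 1 {3,5,8}}"
proof
  let ?E = "expansion [[7], []] dunce_expansion"
  show "set ` set ?E \<subseteq> dunce_faces \<union> {{3,5,8}, insert 1 {3,5,8}}"
  proof
    fix \<sigma> assume "\<sigma> \<in> set ` set ?E"
    then obtain s where s: "s \<in> set ?E" "\<sigma> = set s" by blast
    then have "dunce_face_list s \<or> set s = set [3,5,8] \<or> set s = set [1,3,5,8]"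
      using expansion_dunce_sound unfolding list_all_iff by (auto simp del: set_simps split: if_splits)
    then show "\<sigma> \<in> dunce_faces \<union> {{3,5,8}, insert 1 {3,5,8}}" using s(2) by (auto simp: dunce_face_list_iff)
  qed
  show "dunce_faces \<union> {{3,5,8}, insert 1 {3,5,8}} \<subseteq> set ` set ?E"
  proof
    fix \<sigma> assume "\<sigma> \<in> dunce_faces \<union> {{3,5,8}, insert 1 {3,5,8}}"
    then consider "\<sigma> \<in> dunce_faces" | "\<sigma> = set [3,5,8]" | "\<sigma> = set [1,3,5,8]" by auto
    then show "\<sigma> \<in> set ` set ?E"
    proof cases
      case 1
      then have "\<sigma> \<subseteq> {1..8}" by (auto simp: dunce_faces_def dunce_triangles_def)
      then obtain s where s: "s \<in> set vertex_lists" "\<sigma> = set s" using sublist_of_8 by metis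
      then have "dunce_face_list s" using 1 by (simp add: dunce_face_list_iff)
      then have "occurs s (expansion [[7], []] dunce_expansion)"
        using expansion_dunce_complete s(1) by (simp add: list_all_iff)
      then show ?thesis unfolding occurs_iff s(2) .
    next
      case 2
      then show ?thesis using expansion_dunce_extra unfolding list_all_iff occurs_iff by (simp del: set_simps) simp
    next
      case 3
      then show ?thesis using expansion_dunce_extra unfolding list_all_iff occurs_iff by (simp del: set_simps) simp
    qed
  qed
qed

section \<open>The boundary complex enlarged by a tetrahedron\<close>

context cyclic_vertices
begin

lemma weights_functional:
  assumes w: "w \<in> weights (Pow {1..8})" and q: "\<And>s. poly q s = a \<bullet> moment_curve s + c"
  shows "a \<bullet> bary_point v w + c = (\<Sum>i\<in>{1..8}. w i * poly q (t i))"
proof -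
  have s: "\<And>i. w i \<noteq> 0 \<Longrightarrow> i \<in> {1..8}" using w by (auto simp: weights_def)
  have "sum w {1..8} = 1" by (rule weights_sum_superset[OF w]) (use s in auto)
  moreover have "bary_point v w = (\<Sum>i\<in>{1..8}. w i *\<^sub>R v i)"
    by (rule bary_point_superset) (use s in auto)
  ultimately show ?thesis
    by (simp add: q inner_sum_right distrib_left sum.distrib sum_distrib_right[symmetric])
qed

text \<open>1358 is a nonface of the polytope all of whose proper faces lie on the boundary, so it
  is the only simplex added.\<close>

definition extended_complex :: "nat set set"
  where "extended_complex = cyclic_complex t \<union> Pow {1, 3, 5, 8}"

lemma extended_subset: "\<sigma> \<in> extended_complex \<Longrightarrow> \<sigma> \<subseteq> {1..8}"
  using complex_subset by (auto simp: extended_complex_def)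

lemma extended_weights: "w \<in> weights extended_complex \<Longrightarrow> w \<in> weights (Pow {1..8})"
  using extended_subset by (auto simp: weights_def)

text \<open>A supporting polynomial of the face carrying a boundary point vanishes at every vertex
  used by any representation of that point. Even weights spread over a nonface can therefore not
  represent it outside its face.\<close>

lemma extended_support:
  assumes w: "w \<in> weights (Pow {1..8})" and u: "u \<in> weights (cyclic_complex t)" and eq: "bary_point v w = bary_point v u"
  shows "{i. w i \<noteq> 0} \<subseteq> {i. u i \<noteq> 0}"
proof -
  have \<sigma>: "{i. u i \<noteq> 0} \<in> cyclic_complex t" using u by (auto simp: weights_def)
  obtain q where q: "degree q \<le> 5" "\<And>i. i \<in> {1..8} \<Longrightarrow> 0 \<le> poly q (t i)"
    "{i. u i \<noteq> 0} = {i\<in>{1..8}. poly q (t i) = 0}" "{i. u i \<noteq> 0} \<noteq> {1..8}"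
    by (rule complexE[OF \<sigma>]) (rule that)
  obtain a c where ac: "\<And>s. poly q s = a \<bullet> moment_curve s + c" using poly_affine_functional[OF q(1)] by blast
  have u': "u \<in> weights (Pow {1..8})" using u complex_subset by (auto simp: weights_def)
  have "(\<Sum>i\<in>{1..8}. w i * poly q (t i)) = (\<Sum>i\<in>{1..8}. u i * poly q (t i))"
    using weights_functional[OF w ac] weights_functional[OF u' ac] eq by simp
  also have "\<dots> = 0" by (rule sum.neutral) (use q(3) in auto)
  finally have "\<forall>i\<in>{1..8}. w i * poly q (t i) = 0"
    using q(2) w by (subst (asm) sum_nonneg_eq_0_iff) (auto simp: weights_def)
  then show ?thesis using q(3) w by (auto simp: weights_def)
qed

lemma extended_geometric_complex: "geometric_complex v extended_complex"
proof
  show "finite extended_complex" using finite_complex by (simp add: extended_complex_def)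
  show "\<And>C. C \<in> extended_complex \<Longrightarrow> finite C" using extended_subset finite_subset by blast
  show "\<And>C C'. C \<in> extended_complex \<Longrightarrow> C' \<subseteq> C \<Longrightarrow> C' \<in> extended_complex"
    using complex_face_closed by (auto simp: extended_complex_def)
  show "inj_on (bary_point v) (weights extended_complex)"
  proof (rule inj_onI)
    fix w w' assume w: "w \<in> weights extended_complex" and w': "w' \<in> weights extended_complex"
      and eq: "bary_point v w = bary_point v w'"
    have in_complex: "u = u'" if u: "u \<in> weights (Pow {1..8})" "u' \<in> weights (cyclic_complex t)" "bary_point v u = bary_point v u'" for u u'
    proof -
      have "{i. u i \<noteq> 0} \<subseteq> {i. u' i \<noteq> 0}" by (rule extended_support[OF u])
      moreover have "{i. u' i \<noteq> 0} \<in> cyclic_complex t" using u(2) by (auto simp: weights_def)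
      ultimately have "u \<in> weights (cyclic_complex t)"
        using u(1) complex_face_closed by (auto simp: weights_def)
      then show ?thesis using inj_on_eq_iff[OF inj_bary_point] u(2,3) by blast
    qed
    consider "w' \<in> weights (cyclic_complex t)" | "w \<in> weights (cyclic_complex t)"
      | "{i. w i \<noteq> 0} \<subseteq> {1, 3, 5, 8}" "{i. w' i \<noteq> 0} \<subseteq> {1, 3, 5, 8}"
      using w w' by (auto simp: weights_def extended_complex_def)
    then show "w = w'"
    proof cases
      case 1 then show ?thesis using in_complex[OF extended_weights[OF w] 1 eq] by simp
    next
      case 2 then show ?thesis using in_complex[OF extended_weights[OF w'] 2 eq[symmetric]] by simp
    next
      \<comment> \<open>Four points of the curve are affinely independent: a polynomial of degree at
        most five separates each of them from the other three.\<close>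
      case 3
      show ?thesis
      proof
        fix k show "w k = w' k"
        proof (cases "k \<in> {1, 3, 5, 8}")
          case True
          obtain p where p: "degree p \<le> 5" "poly p (t k) = 1" "\<And>j. j \<in> {1, 3, 5, 8} \<Longrightarrow> j \<noteq> k \<Longrightarrow> poly p (t j) = 0"
            by (rule lagrange_basis[of "{1, 3, 5, 8}" k]) (use True that in auto)
          obtain a c where ac: "\<And>s. poly p s = a \<bullet> moment_curve s + c" using poly_affine_functional[OF p(1)] by blast
          have "(\<Sum>i\<in>{1..8}. u i * poly p (t i)) = u k" if "{i. u i \<noteq> 0} \<subseteq> {1, 3, 5, 8}" for u
          proof -
            have "(\<Sum>i\<in>{1..8}. u i * poly p (t i)) = (\<Sum>i\<in>{1..8}. if i = k then u i else 0)"
              by (rule sum.cong) (use p that in auto)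
            then show ?thesis using True by auto
          qed
          then show ?thesis
            using 3 weights_functional[OF extended_weights[OF w] ac] weights_functional[OF extended_weights[OF w'] ac] eq by simp
        next
          case False
          then have "w k = 0" "w' k = 0" using 3 by blast+
          then show ?thesis by simp
        qed
      qed
    qed
  qed
qed

lemma AR_expansion:
  assumes "expands S xs" "set ` set (expansion S xs) \<subseteq> extended_complex" "face_closed_family (set ` set S)"
    "AR (realization v (set ` set S))"
  shows "AR (realization v (set ` set (expansion S xs)))"
  using assms
proof (induction S xs rule: expands.induct)
  case (2 S a f xs)
  interpret e: geometric_complex v extended_complex by (rule extended_geometric_complex)
  have mono: "set ` set S \<subseteq> set ` set (expansion S xs)" for S xs
    by (induction S xs rule: expansion.induct) auto
  have c: "f \<noteq> []" "a \<notin> set f" "set f \<notin> set ` set S" "expands (f # (a # f) # S) xs"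
    "\<And>g. g \<in> set (subseqs (a # f)) \<Longrightarrow> set g \<noteq> set f \<Longrightarrow> set g \<noteq> set (a # f) \<Longrightarrow> set g \<in> set ` set S"
    using 2(2) by (auto simp: list_all_iff occurs_iff simp del: subseqs.simps split: if_splits)
  have faces: "g \<in> set ` set S" if "g \<subseteq> insert a (set f)" "g \<noteq> set f" "g \<noteq> insert a (set f)" for g
  proof -
    have "g \<in> set ` set (subseqs (a # f))" unfolding subseqs_powset using that(1) by simp
    then show ?thesis using c(5) that(2,3) by auto
  qed
  have eq: "set ` set (f # (a # f) # S) = set ` set S \<union> {set f, insert a (set f)}" by auto
  have sub: "set ` set (f # (a # f) # S) \<subseteq> extended_complex"
  proof -
    have "set ` set (expansion (f # (a # f) # S) xs) \<subseteq> extended_complex" using 2(3) by simp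
    then show ?thesis by (rule order_trans[OF mono])
  qed
  have "AR (realization v (set ` set (f # (a # f) # S)))"
    unfolding eq using e.AR_elementary_expansion[OF _ 2(4) _ _ c(2,3) faces] sub c(1) 2(5) by auto
  moreover have "face_closed_family (set ` set (f # (a # f) # S))"
    unfolding eq by (rule e.face_closed_expansion[OF 2(4) faces])
  ultimately show ?case using 2(1)[OF _ c(4)] 2(2,3) c by (auto split: if_splits)
qed simp

lemma AR_dunce: "AR (realization v dunce_faces)"
proof -
  interpret e: geometric_complex v extended_complex by (rule extended_geometric_complex)
  have sub: "dunce_faces \<subseteq> extended_complex" using dunce_subset_complex by (auto simp: extended_complex_def)
  have closed: "face_closed_family dunce_faces"
    using dunce_faces_closed by (auto simp: face_closed_family_def)
  have "AR (realization v (set ` set (expansion [[7], []] dunce_expansion)))"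
  proof (rule AR_expansion[OF expands_dunce])
    show "set ` set (expansion [[7], []] dunce_expansion) \<subseteq> extended_complex"
      unfolding expansion_dunce using sub by (auto simp: extended_complex_def)
    show "face_closed_family (set ` set [[7], []])" by (auto simp: face_closed_family_def)
    have "realization v (set ` set [[7], []]) = {v 7}" by (simp add: realization_def)
    then show "AR (realization v (set ` set [[7], []]))" by (simp add: AR_singleton)
  qed
  then have "AR (realization v (dunce_faces \<union> {{3,5,8}, insert 1 {3,5,8}}))" by (simp only: expansion_dunce)
  moreover have "{3, 5, 8} \<notin> dunce_faces"
  proof -
    have "\<not> dunce_face_list [3, 5, 8]" by code_simp
    then show ?thesis by (simp add: dunce_face_list_iff)
  qed
  moreover have "g \<in> dunce_faces" if "g \<subseteq> insert 1 {3,5,8}" "g \<noteq> {3,5,8}" "g \<noteq> insert 1 {3,5,8}" for g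
  proof -
    have "set [1,3,5] \<in> dunce_faces" "set [1,3,8] \<in> dunce_faces" "set [1,5,8] \<in> dunce_faces"
      "set [3,5] \<in> dunce_faces" "set [3,8] \<in> dunce_faces" "set [5,8] \<in> dunce_faces"
      unfolding dunce_face_list_iff[symmetric] by code_simp+
    moreover have "g \<subseteq> set [1,3,5] \<or> g \<subseteq> set [1,3,8] \<or> g \<subseteq> set [1,5,8]"
    proof -
      have "3 \<notin> g \<or> 5 \<notin> g \<or> 8 \<notin> g" using that by auto
      then show ?thesis using that(1) by auto
    qed
    ultimately show ?thesis using dunce_faces_closed by blast
  qed
  moreover have "insert 1 {3,5,8} \<in> extended_complex" by (auto simp: extended_complex_def)
  \<comment> \<open>The equivalence is used as a collapse: 358 is a free face of 1358, and both are
    removed.\<close>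
  ultimately show ?thesis
    using e.AR_elementary_expansion[OF sub closed, of 1 "{3,5,8}"] by simp
qed

lemma contractible_dunce: "contractible (realization v dunce_faces)"
  by (rule AR_imp_contractible[OF AR_dunce])

end

section \<open>The folded triangle\<close>

text \<open>A triangulation of the triangle. Positions are multiples of one sixth. The heights show that the
  triangulation is regular: on every triangle they agree with an affine function that stays strictly
  below them at the other vertices.\<close>

definition disc_x :: "int list"
  where "disc_x = [0, 2, 4, 6, 4, 2, 0, 0, 0, 3, 2, 4, 1, 1]"

definition disc_y :: "int list"
  where "disc_y = [0, 0, 0, 0, 2, 4, 6, 4, 2, 2, 2, 1, 4, 2]"

definition disc_height :: "int list"
  where "disc_height = [0, 4, 11, 36, 28, 28, 29, 17, 8, 14, 7, 15, 16, 6]"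

definition disc_label :: "nat list"
  where "disc_label = [1, 3, 2, 1, 3, 2, 1, 2, 3, 4, 5, 6, 7, 8]"

definition disc_triangles :: "nat list list"
  where "disc_triangles = [
     [6, 9, 5], [5, 9, 4], [4, 9, 11], [3, 4, 11], [3, 11, 2], [2, 11, 10],
     [2, 10, 1], [0, 1, 10], [6, 7, 12], [6, 12, 9], [7, 13, 12], [9, 12, 10],
     [10, 12, 13], [7, 8, 13], [0, 13, 8], [0, 10, 13], [9, 10, 11]]"

text \<open>In the order of \<open>disc_triangles\<close>: \<open>(d, a, b, c)\<close> is the affine
  function \<open>(a + b * x + c * y) / d\<close> that interpolates the heights over the triangle,
  with the denominator \<open>d\<close> cleared to stay within the integers.\<close>

definition disc_functionals :: "(int \<times> int \<times> int \<times> int) list"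
  where "disc_functionals = [
     (2, -104, 26, 27), (1, -56, 14, 14), (1, -54, 14, 13), (1, -66, 17, 13),
     (2, -78, 25, 8), (1, -13, 6, 4), (2, -6, 7, 3), (2, 0, 4, 3),
     (1, -7, -1, 6), (1, -43, 11, 12), (1, -3, -1, 5), (1, -23, 7, 8),
     (1, -5, 1, 5), (2, -2, -4, 9), (1, 0, -2, 4), (2, 0, 2, 5),
     (1, -19, 7, 6)]"

text \<open>Along each side, in the direction of the gluing, the labels are 1, 3, 2, 1.\<close>

definition disc_sides :: "nat list list"
  where "disc_sides = [[0, 1, 2, 3], [3, 4, 5, 6], [0, 8, 7, 6]]"

definition disc_vertices :: "nat list"
  where "disc_vertices = [0, 1, 2, 3, 4, 5, 6, 7, 8, 9, 10, 11, 12, 13]"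

section \<open>Finite checks on the triangulated triangle\<close>

definition functional_value :: "int \<times> int \<times> int \<times> int \<Rightarrow> nat \<Rightarrow> int"
  where "functional_value = (\<lambda>(d, a, b, c) j. a + b * disc_x ! j + c * disc_y ! j - d * disc_height ! j)"

definition supports :: "nat list \<Rightarrow> int \<times> int \<times> int \<times> int \<Rightarrow> bool"
  where "supports T = (\<lambda>\<phi>. list_all (\<lambda>j. if member_list j T then functional_value \<phi> j = 0
     else functional_value \<phi> j < 0) disc_vertices)"

lemma disc_regular: "list_all (\<lambda>(T, \<phi>). supports T \<phi> \<and> 0 < fst \<phi>) (zip disc_triangles disc_functionals)"
  by code_simp

fun orientation :: "nat list \<Rightarrow> int"
  where "orientation [i, j, k] = (disc_x ! j - disc_x ! i) * (disc_y ! k - disc_y ! i)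
     - (disc_y ! j - disc_y ! i) * (disc_x ! k - disc_x ! i)"
  | "orientation _ = 0"

lemma disc_oriented: "list_all (\<lambda>T. 0 < orientation T \<and> subset_list T disc_vertices \<and> length T = 3
     \<and> distinct T \<and> distinct (map ((!) disc_label) T)) disc_triangles"
  by code_simp

lemma disc_labels: "list_all (\<lambda>T. dunce_face_list (map ((!) disc_label) T)) disc_triangles"
  by code_simp

lemma disc_labels_onto:
  "list_all (\<lambda>D. list_ex (\<lambda>T. subset_list D (map ((!) disc_label) T)) disc_triangles) dunce_list"
  by code_simp

definition on_side :: "nat list \<Rightarrow> bool"
  where "on_side S = list_ex (\<lambda>A. list_ex (\<lambda>k. subset_list S [A ! k, A ! Suc k]) [0, 1, 2]) disc_sides"

definition disc_faces :: "nat list list"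
  where "disc_faces = [] # map (\<lambda>i. [i]) disc_vertices @ disc_triangles @
    [[0, 1], [0, 8], [0, 10], [0, 13], [1, 2], [1, 10], [2, 3], [2, 10],
     [2, 11], [3, 4], [3, 11], [4, 5], [4, 9], [4, 11], [5, 6], [5, 9],
     [6, 7], [6, 9], [6, 12], [7, 8], [7, 12], [7, 13], [8, 13], [9, 10],
     [9, 11], [9, 12], [10, 11], [10, 12], [10, 13], [12, 13]]"

lemma disc_faces_complete: "list_all (\<lambda>T. list_all (\<lambda>S. list_ex (\<lambda>S'.
     if subset_list S S' then subset_list S' S else False) disc_faces) (subseqs T)) disc_triangles"
  by code_simp

definition labelled_faces :: "(nat list \<times> nat list) list"
  where "labelled_faces = map (\<lambda>S. (S, map ((!) disc_label) S)) disc_faces"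

text \<open>Off the sides no two different faces are folded onto each other. This reduces the fibres
  of the folding to the gluing of the sides, in \<open>fold_map_eq\<close>.\<close>

lemma disc_identifications:
  "list_all (\<lambda>(S, L). list_all (\<lambda>(S', L').
      if subset_list L L' then if subset_list L' L then
        if subset_list S S' then True else if on_side S then on_side S' else False
      else True else True) labelled_faces) labelled_faces"
  by code_simp

definition disc_point :: "nat \<Rightarrow> real \<times> real"
  where "disc_point i = (real_of_int (disc_x ! i) / 6, real_of_int (disc_y ! i) / 6)"

definition disc_complex :: "nat set set"
  where "disc_complex = {\<sigma>. \<exists>T\<in>set disc_triangles. \<sigma> \<subseteq> set T}"

lemma disc_vertices_set: "set disc_vertices = {..<14}"
  by (auto simp: disc_vertices_def lessThan_nat_numeral lessThan_Suc)

lemma disc_triangleD: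
  assumes "T \<in> set disc_triangles"
  shows "0 < orientation T" "set T \<subseteq> {..<14}" "length T = 3" "distinct T" "inj_on ((!) disc_label) (set T)"
    "(!) disc_label ` set T \<in> dunce_faces"
proof -
  have "0 < orientation T \<and> subset_list T disc_vertices \<and> length T = 3 \<and> distinct T \<and> distinct (map ((!) disc_label) T)"
    using disc_oriented assms by (simp add: list_all_iff)
  then show "0 < orientation T" "set T \<subseteq> {..<14}" "length T = 3" "distinct T" "inj_on ((!) disc_label) (set T)"
    by (simp_all add: disc_vertices_set distinct_map)
  have "dunce_face_list (map ((!) disc_label) T)" using disc_labels assms by (simp add: list_all_iff)
  then show "(!) disc_label ` set T \<in> dunce_faces" by (simp add: dunce_face_list_iff)
qed

lemma disc_functional:
  assumes "T \<in> set disc_triangles"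
  obtains d a b c where "0 < d" "\<And>j. j < 14 \<Longrightarrow> a + b * disc_x ! j + c * disc_y ! j \<le> d * disc_height ! j"
    "\<And>j. j < 14 \<Longrightarrow> a + b * disc_x ! j + c * disc_y ! j = d * disc_height ! j \<longleftrightarrow> j \<in> set T"
proof -
  have len: "length disc_functionals = length disc_triangles" by (simp add: disc_functionals_def disc_triangles_def)
  obtain n where n: "n < length disc_triangles" "disc_triangles ! n = T" using assms by (metis in_set_conv_nth)
  obtain d a b c where \<phi>: "disc_functionals ! n = (d, a, b, c)" by (metis prod.exhaust)
  have "(T, (d, a, b, c)) \<in> set (zip disc_triangles disc_functionals)"
    unfolding set_zip using n \<phi> len by (auto intro!: exI[of _ n])
  then have "supports T (d, a, b, c)" "0 < d" using disc_regular by (auto simp: list_all_iff)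
  then have *: "if j \<in> set T then functional_value (d, a, b, c) j = 0 else functional_value (d, a, b, c) j < 0" if "j < 14" for j
    using that disc_vertices_set by (auto simp: supports_def list_all_iff)
  show thesis
    by (rule that[of d a b c]) (use \<open>0 < d\<close> * in \<open>force simp: functional_value_def split: if_splits\<close>)+
qed

lemma disc_complex_subset: "\<sigma> \<in> disc_complex \<Longrightarrow> \<sigma> \<subseteq> {..<14}"
  using disc_triangleD(2) by (auto simp: disc_complex_def)

lemma disc_weights_outside: "w \<in> weights disc_complex \<Longrightarrow> w i \<noteq> 0 \<Longrightarrow> i \<in> {..<14}"
  using disc_complex_subset[of "{i. w i \<noteq> 0}"] by (auto simp: weights_def)

lemma disc_complex_Pow: "T \<in> set disc_triangles \<Longrightarrow> \<sigma> \<subseteq> set T \<Longrightarrow> \<sigma> \<in> disc_complex"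
  by (auto simp: disc_complex_def)

text \<open>The heights interpolate to a function that is determined by the point alone, as the maximum of
  the affine functions. Hence the supports of two representations lie in a common triangle.\<close>

lemma disc_common_triangle:
  assumes w: "w \<in> weights disc_complex" "w' \<in> weights disc_complex"
    and eq: "\<And>a b c. (\<Sum>i<14. w i * (a + b * real_of_int (disc_x ! i) + c * real_of_int (disc_y ! i)))
      = (\<Sum>i<14. w' i * (a + b * real_of_int (disc_x ! i) + c * real_of_int (disc_y ! i)))"
    and T: "T \<in> set disc_triangles" "{i. w i \<noteq> 0} \<subseteq> set T"
  shows "{i. w' i \<noteq> 0} \<subseteq> set T"
proof -
  let ?h = "\<lambda>i. real_of_int (disc_height ! i)"
  have le: "(\<Sum>i<14. u i * ?h i) \<le> (\<Sum>i<14. u' i * ?h i)"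
    and strict: "(\<Sum>i<14. u i * ?h i) = (\<Sum>i<14. u' i * ?h i) \<Longrightarrow> {i. u' i \<noteq> 0} \<subseteq> set T"
    if u: "u \<in> weights disc_complex" "u' \<in> weights disc_complex" and
      eq: "\<And>a b c. (\<Sum>i<14. u i * (a + b * real_of_int (disc_x ! i) + c * real_of_int (disc_y ! i)))
      = (\<Sum>i<14. u' i * (a + b * real_of_int (disc_x ! i) + c * real_of_int (disc_y ! i)))"
    and T: "T \<in> set disc_triangles" "{i. u i \<noteq> 0} \<subseteq> set T" for u u' T
  proof -
    obtain d a b c where f: "0 < d" "\<And>j. j < 14 \<Longrightarrow> a + b * disc_x ! j + c * disc_y ! j \<le> d * disc_height ! j"
      "\<And>j. j < 14 \<Longrightarrow> a + b * disc_x ! j + c * disc_y ! j = d * disc_height ! j \<longleftrightarrow> j \<in> set T"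
      by (rule disc_functional[OF T(1)]) (rule that)
    let ?\<phi> = "\<lambda>i. real_of_int a + real_of_int b * real_of_int (disc_x ! i) + real_of_int c * real_of_int (disc_y ! i)"
    have \<phi>: "?\<phi> j = real_of_int (a + b * disc_x ! j + c * disc_y ! j)" for j by simp
    have \<phi>_le: "?\<phi> j \<le> real_of_int d * ?h j" if "j < 14" for j
      unfolding \<phi> using f(2)[OF that] by (metis of_int_le_iff of_int_mult)
    have \<phi>_eq: "?\<phi> j = real_of_int d * ?h j \<longleftrightarrow> j \<in> set T" if "j < 14" for j
      unfolding \<phi> using f(3)[OF that] by (metis of_int_eq_iff of_int_mult)
    have "real_of_int d * (\<Sum>i<14. u i * ?h i) = (\<Sum>i<14. u i * ?\<phi> i)"
      unfolding sum_distrib_left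
    proof (rule sum.cong[OF refl])
      fix i :: nat assume "i \<in> {..<14}"
      then have "u i \<noteq> 0 \<Longrightarrow> ?\<phi> i = real_of_int d * ?h i" using \<phi>_eq[of i] T(2) by auto
      then show "real_of_int d * (u i * ?h i) = u i * ?\<phi> i" by (cases "u i = 0") auto
    qed
    also have "\<dots> = (\<Sum>i<14. u' i * ?\<phi> i)" by (rule eq)
    finally have e: "real_of_int d * (\<Sum>i<14. u i * ?h i) = (\<Sum>i<14. u' i * ?\<phi> i)" .
    have nn: "0 \<le> u' i" for i using u(2) by (auto simp: weights_def)
    have "(\<Sum>i<14. u' i * ?\<phi> i) \<le> (\<Sum>i<14. u' i * (real_of_int d * ?h i))"
      by (rule sum_mono) (use \<phi>_le nn in \<open>auto intro: mult_left_mono\<close>)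
    also have "\<dots> = real_of_int d * (\<Sum>i<14. u' i * ?h i)" by (simp add: sum_distrib_left ac_simps)
    finally have "real_of_int d * (\<Sum>i<14. u i * ?h i) \<le> real_of_int d * (\<Sum>i<14. u' i * ?h i)" using e by simp
    then show "(\<Sum>i<14. u i * ?h i) \<le> (\<Sum>i<14. u' i * ?h i)" using f(1) by simp
    assume same: "(\<Sum>i<14. u i * ?h i) = (\<Sum>i<14. u' i * ?h i)"
    have "(\<Sum>i<14. u' i * (real_of_int d * ?h i - ?\<phi> i)) = real_of_int d * (\<Sum>i<14. u' i * ?h i) - (\<Sum>i<14. u' i * ?\<phi> i)"
      by (simp add: right_diff_distrib sum_subtractf sum_distrib_left ac_simps)
    then have "(\<Sum>i<14. u' i * (real_of_int d * ?h i - ?\<phi> i)) = 0" using e same by simp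
    moreover have "\<And>i. i \<in> {..<14} \<Longrightarrow> 0 \<le> u' i * (real_of_int d * ?h i - ?\<phi> i)"
      using nn \<phi>_le by (intro mult_nonneg_nonneg) auto
    ultimately have z: "\<forall>i\<in>{..<14}. u' i * (real_of_int d * ?h i - ?\<phi> i) = 0"
      using sum_nonneg_eq_0_iff[of "{..<14::nat}" "\<lambda>i. u' i * (real_of_int d * ?h i - ?\<phi> i)"] by blast
    show "{i. u' i \<noteq> 0} \<subseteq> set T"
    proof
      fix i assume i: "i \<in> {i. u' i \<noteq> 0}"
      then have "i < 14" using disc_weights_outside[OF u(2)] by auto
      then have "?\<phi> i = real_of_int d * ?h i" using z i by auto
      then show "i \<in> set T" using \<phi>_eq[OF \<open>i < 14\<close>] by simp
    qed
  qed
  \<comment> \<open>The comparison of interpolated heights holds in both directions. So the heights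
    agree, and strictness confines the support of \<open>w'\<close> to \<open>T\<close>.\<close>
  obtain T' where T': "T' \<in> set disc_triangles" "{i. w' i \<noteq> 0} \<subseteq> set T'"
    using w(2) by (auto simp: weights_def disc_complex_def)
  show ?thesis
    using strict[OF w eq T] le[OF w eq T] le[OF w(2,1) eq[symmetric] T'] by simp
qed

lemma three_weights_zero:
  fixes u1 u2 u3 :: real
  assumes "u1 + u2 + u3 = 0" "u1 * x1 + u2 * x2 + u3 * x3 = 0" "u1 * y1 + u2 * y2 + u3 * y3 = 0"
    and D: "(x2 - x1) * (y3 - y1) - (y2 - y1) * (x3 - x1) \<noteq> 0"
  shows "u1 = 0 \<and> u2 = 0 \<and> u3 = 0"
proof -
  have u1: "u1 = - u2 - u3" using assms(1) by simp
  have X: "u2 * (x2 - x1) + u3 * (x3 - x1) = 0" using assms(2) by (simp add: u1 algebra_simps)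
  have Y: "u2 * (y2 - y1) + u3 * (y3 - y1) = 0" using assms(3) by (simp add: u1 algebra_simps)
  have "u2 * ((x2 - x1) * (y3 - y1) - (y2 - y1) * (x3 - x1)) =
      (y3 - y1) * (u2 * (x2 - x1) + u3 * (x3 - x1)) - (x3 - x1) * (u2 * (y2 - y1) + u3 * (y3 - y1))"
    by (simp add: algebra_simps)
  then have u2: "u2 = 0" using D X Y by simp
  have "u3 * ((x2 - x1) * (y3 - y1) - (y2 - y1) * (x3 - x1)) =
      (x2 - x1) * (u2 * (y2 - y1) + u3 * (y3 - y1)) - (y2 - y1) * (u2 * (x2 - x1) + u3 * (x3 - x1))"
    by (simp add: algebra_simps)
  then have "u3 = 0" using D X Y by simp
  then show ?thesis using u1 u2 by simp
qed

text \<open>Regularity replaces pairwise intersection checks: two weights of one point live on a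
  common triangle by \<open>disc_common_triangle\<close>, and there the nonzero orientation makes
  them equal.\<close>

lemma disc_geometric_complex: "geometric_complex disc_point disc_complex"
proof
  show "finite disc_complex"
    by (rule finite_subset[of _ "Pow {..<14}"]) (use disc_complex_subset in auto)
  show "\<And>C. C \<in> disc_complex \<Longrightarrow> finite C" using disc_complex_subset finite_subset by blast
  show "\<And>C C'. C \<in> disc_complex \<Longrightarrow> C' \<subseteq> C \<Longrightarrow> C' \<in> disc_complex" by (auto simp: disc_complex_def)
  show "inj_on (bary_point disc_point) (weights disc_complex)"
  proof (rule inj_onI)
    fix w w' assume w: "w \<in> weights disc_complex" and w': "w' \<in> weights disc_complex"
      and eq: "bary_point disc_point w = bary_point disc_point w'"
    have moments: "(\<Sum>i<14. u i * (a + b * real_of_int (disc_x ! i) + c * real_of_int (disc_y ! i)))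
        = a + 6 * b * fst (bary_point disc_point u) + 6 * c * snd (bary_point disc_point u)"
      if u: "u \<in> weights disc_complex" for u a b c
    proof -
      have 1: "sum u {..<14} = 1" by (rule weights_sum_superset[OF u]) (use disc_weights_outside[OF u] in auto)
      have "bary_point disc_point u = (\<Sum>i<14. u i *\<^sub>R disc_point i)"
        by (rule bary_point_superset) (use disc_weights_outside[OF u] in auto)
      then have 2: "fst (bary_point disc_point u) = (\<Sum>i<14. u i * (real_of_int (disc_x ! i) / 6))"
        "snd (bary_point disc_point u) = (\<Sum>i<14. u i * (real_of_int (disc_y ! i) / 6))"
        by (simp_all add: fst_sum snd_sum disc_point_def)
      have "(\<Sum>i<14. u i * (a + b * real_of_int (disc_x ! i) + c * real_of_int (disc_y ! i)))
          = a * sum u {..<14} + 6 * b * (\<Sum>i<14. u i * (real_of_int (disc_x ! i) / 6))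
            + 6 * c * (\<Sum>i<14. u i * (real_of_int (disc_y ! i) / 6))"
        unfolding sum_distrib_left sum.distrib[symmetric] by (rule sum.cong) (simp_all add: algebra_simps)
      then show ?thesis using 1 2 by simp
    qed
    have e: "(\<Sum>i<14. w i * (a + b * real_of_int (disc_x ! i) + c * real_of_int (disc_y ! i)))
      = (\<Sum>i<14. w' i * (a + b * real_of_int (disc_x ! i) + c * real_of_int (disc_y ! i)))" for a b c
      using moments[OF w] moments[OF w'] eq by simp
    obtain T where T: "T \<in> set disc_triangles" "{i. w i \<noteq> 0} \<subseteq> set T"
      using w by (auto simp: weights_def disc_complex_def)
    have T': "{i. w' i \<noteq> 0} \<subseteq> set T" by (rule disc_common_triangle[OF w w' e T])
    note tD = disc_triangleD[OF T(1)]
    obtain i j k where ijk: "T = [i, j, k]" using tD(3) by (auto simp: numeral_3_eq_3 length_Suc_conv)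
    have sum3: "(\<Sum>n<14. u n * f n) = u i * f i + u j * f j + u k * f k"
      if "{n. u n \<noteq> 0} \<subseteq> set T" for u f :: "nat \<Rightarrow> real"
    proof -
      have "(\<Sum>n<14. u n * f n) = (\<Sum>n\<in>set T. u n * f n)"
        by (rule sum.mono_neutral_right) (use tD(2) that in auto)
      then show ?thesis using tD(4) by (simp add: ijk)
    qed
    have "w i - w' i = 0 \<and> w j - w' j = 0 \<and> w k - w' k = 0"
    proof (rule three_weights_zero)
      show "w i - w' i + (w j - w' j) + (w k - w' k) = 0"
        using e[of 1 0 0] sum3[OF T(2), of "\<lambda>_. 1"] sum3[OF T', of "\<lambda>_. 1"] by simp
      show "(w i - w' i) * real_of_int (disc_x ! i) + (w j - w' j) * real_of_int (disc_x ! j) + (w k - w' k) * real_of_int (disc_x ! k) = 0"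
        using e[of 0 1 0] sum3[OF T(2), of "\<lambda>n. real_of_int (disc_x ! n)"] sum3[OF T', of "\<lambda>n. real_of_int (disc_x ! n)"]
        by (simp add: algebra_simps)
      show "(w i - w' i) * real_of_int (disc_y ! i) + (w j - w' j) * real_of_int (disc_y ! j) + (w k - w' k) * real_of_int (disc_y ! k) = 0"
        using e[of 0 0 1] sum3[OF T(2), of "\<lambda>n. real_of_int (disc_y ! n)"] sum3[OF T', of "\<lambda>n. real_of_int (disc_y ! n)"]
        by (simp add: algebra_simps)
      have "real_of_int (orientation T) \<noteq> 0" using tD(1) by linarith
      then show "(real_of_int (disc_x ! j) - real_of_int (disc_x ! i)) * (real_of_int (disc_y ! k) - real_of_int (disc_y ! i))
          - (real_of_int (disc_y ! j) - real_of_int (disc_y ! i)) * (real_of_int (disc_x ! k) - real_of_int (disc_x ! i)) \<noteq> 0"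
        by (simp add: ijk)
    qed
    then show "w = w'"
    proof (intro ext)
      fix n assume z: "w i - w' i = 0 \<and> w j - w' j = 0 \<and> w k - w' k = 0"
      show "w n = w' n"
      proof (cases "n \<in> set T")
        case True then show ?thesis using z by (auto simp: ijk)
      next
        case False
        then have "w n = 0" "w' n = 0" using T(2) T' by blast+
        then show ?thesis by simp
      qed
    qed
  qed
qed

text \<open>The position relative to the line through two vertices, again in units of one sixth.\<close>

definition line_side :: "nat \<Rightarrow> nat \<Rightarrow> real \<Rightarrow> real \<Rightarrow> real"
  where "line_side p q x y = real_of_int (disc_x ! p * disc_y ! q - disc_y ! p * disc_x ! q)
    + real_of_int (disc_y ! p - disc_y ! q) * x + real_of_int (disc_x ! q - disc_x ! p) * y"

fun in_triangle :: "nat list \<Rightarrow> real \<Rightarrow> real \<Rightarrow> bool"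
  where "in_triangle [i, j, k] x y \<longleftrightarrow> 0 \<le> line_side j k x y \<and> 0 \<le> line_side k i x y \<and> 0 \<le> line_side i j x y"
  | "in_triangle _ x y \<longleftrightarrow> False"

text \<open>The other half of being a triangulation; overlaps are excluded by regularity. It is a
  question of linear inequalities in two variables.\<close>

lemma disc_cover:
  assumes "0 \<le> x" "0 \<le> y" "x + y \<le> 6"
  shows "\<exists>T\<in>set disc_triangles. in_triangle T x y"
proof -
  have "list_ex (\<lambda>T. in_triangle T x y) disc_triangles"
    using assms unfolding disc_triangles_def
    by (simp add: line_side_def disc_x_def disc_y_def) (smt (verit))
  then show ?thesis by (simp add: list_ex_iff)
qed

text \<open>The values of \<open>line_side\<close> are twice the signed areas of the triangles
  spanned by the point and the sides. Divided by \<open>orientation T\<close>, twice the whole area,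
  they are the barycentric coordinates.\<close>

lemma in_triangle_hull:
  assumes T: "T \<in> set disc_triangles" and z: "in_triangle T (6 * fst z) (6 * snd z)"
  shows "z \<in> convex hull (disc_point ` set T)"
proof -
  note tD = disc_triangleD[OF T]
  obtain i j k where ijk: "T = [i, j, k]" using tD(3) by (auto simp: numeral_3_eq_3 length_Suc_conv)
  define D where "D = real_of_int (orientation T)"
  have D: "0 < D" using tD(1) by (simp add: D_def)
  define X where "X n = real_of_int (disc_x ! n)" for n
  define Y where "Y n = real_of_int (disc_y ! n)" for n
  define a where "a = line_side j k (6 * fst z) (6 * snd z)"
  define b where "b = line_side k i (6 * fst z) (6 * snd z)"
  define c where "c = line_side i j (6 * fst z) (6 * snd z)"
  have nn: "0 \<le> a" "0 \<le> b" "0 \<le> c" using z by (simp_all add: ijk a_def b_def c_def)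
  have D_eq: "D = (X j - X i) * (Y k - Y i) - (Y j - Y i) * (X k - X i)" by (simp add: D_def ijk X_def Y_def)
  have abc: "a = X j * Y k - Y j * X k + (Y j - Y k) * (6 * fst z) + (X k - X j) * (6 * snd z)"
    "b = X k * Y i - Y k * X i + (Y k - Y i) * (6 * fst z) + (X i - X k) * (6 * snd z)"
    "c = X i * Y j - Y i * X j + (Y i - Y j) * (6 * fst z) + (X j - X i) * (6 * snd z)"
    by (simp_all add: a_def b_def c_def line_side_def X_def Y_def)
  have s: "a + b + c = D" unfolding abc D_eq by (simp add: algebra_simps)
  have x: "a * X i + b * X j + c * X k = D * (6 * fst z)" unfolding abc D_eq by (simp add: algebra_simps)
  have y: "a * Y i + b * Y j + c * Y k = D * (6 * snd z)" unfolding abc D_eq by (simp add: algebra_simps)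
  have "z = (a / D) *\<^sub>R disc_point i + (b / D) *\<^sub>R disc_point j + (c / D) *\<^sub>R disc_point k"
  proof (rule prod_eqI)
    have "(a * X i + b * X j + c * X k) / (6 * D) = fst z" unfolding x using D by simp
    then show "fst z = fst ((a / D) *\<^sub>R disc_point i + (b / D) *\<^sub>R disc_point j + (c / D) *\<^sub>R disc_point k)"
      using D by (simp add: disc_point_def X_def add_divide_distrib ac_simps)
    have "(a * Y i + b * Y j + c * Y k) / (6 * D) = snd z" unfolding y using D by simp
    then show "snd z = snd ((a / D) *\<^sub>R disc_point i + (b / D) *\<^sub>R disc_point j + (c / D) *\<^sub>R disc_point k)"
      using D by (simp add: disc_point_def Y_def add_divide_distrib ac_simps)
  qed
  moreover have "a / D + b / D + c / D = 1" unfolding add_divide_distrib[symmetric] s using D by simp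
  moreover have "0 \<le> a / D" "0 \<le> b / D" "0 \<le> c / D" using nn D by simp_all
  ultimately have "z \<in> convex hull {disc_point i, disc_point j, disc_point k}"
    unfolding convex_hull_3 by blast
  then show ?thesis by (simp add: ijk)
qed

lemma dunce_triangle_eq: "dunce_triangle = {z. 0 \<le> fst z \<and> 0 \<le> snd z \<and> fst z + snd z \<le> 1}"
proof
  have "{z :: real \<times> real. 0 \<le> fst z \<and> 0 \<le> snd z \<and> fst z + snd z \<le> 1}
      = {z. (1, 0) \<bullet> z \<ge> 0} \<inter> {z. (0, 1) \<bullet> z \<ge> 0} \<inter> {z. (1, 1) \<bullet> z \<le> 1}"
    by (auto simp: inner_prod_def)
  then have "convex {z :: real \<times> real. 0 \<le> fst z \<and> 0 \<le> snd z \<and> fst z + snd z \<le> 1}"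
    by (simp add: convex_Int convex_halfspace_le convex_halfspace_ge)
  then show "dunce_triangle \<subseteq> {z. 0 \<le> fst z \<and> 0 \<le> snd z \<and> fst z + snd z \<le> 1}"
    unfolding dunce_triangle_def by (intro hull_minimal) auto
  show "{z. 0 \<le> fst z \<and> 0 \<le> snd z \<and> fst z + snd z \<le> 1} \<subseteq> dunce_triangle"
  proof
    fix z :: "real \<times> real" assume z: "z \<in> {z. 0 \<le> fst z \<and> 0 \<le> snd z \<and> fst z + snd z \<le> 1}"
    have "z = (1 - fst z - snd z) *\<^sub>R (0, 0) + fst z *\<^sub>R (1, 0) + snd z *\<^sub>R (0, 1)"
      by (simp add: prod_eq_iff)
    moreover have "1 - fst z - snd z + fst z + snd z = 1" by simp
    moreover have "0 \<le> 1 - fst z - snd z" "0 \<le> fst z" "0 \<le> snd z" using z by auto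
    ultimately show "z \<in> dunce_triangle" unfolding dunce_triangle_def convex_hull_3 by blast
  qed
qed

lemma disc_realization: "realization disc_point disc_complex = dunce_triangle"
proof
  have "disc_point i \<in> dunce_triangle" if "i \<in> {..<14}" for i
  proof -
    have "list_all (\<lambda>i. 0 \<le> disc_x ! i \<and> 0 \<le> disc_y ! i \<and> disc_x ! i + disc_y ! i \<le> 6) disc_vertices" by code_simp
    then have "0 \<le> disc_x ! i" "0 \<le> disc_y ! i" "disc_x ! i + disc_y ! i \<le> 6"
      using that disc_vertices_set by (auto simp: list_all_iff)
    then show ?thesis by (simp add: dunce_triangle_eq disc_point_def)
  qed
  then have "disc_point ` \<sigma> \<subseteq> dunce_triangle" if "\<sigma> \<in> disc_complex" for \<sigma>
    using disc_complex_subset[OF that] by blast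
  moreover have "convex dunce_triangle" by (simp add: dunce_triangle_def)
  ultimately show "realization disc_point disc_complex \<subseteq> dunce_triangle"
    unfolding realization_def by (intro UN_least hull_minimal)
  show "dunce_triangle \<subseteq> realization disc_point disc_complex"
  proof
    fix z assume "z \<in> dunce_triangle"
    then have "\<exists>T\<in>set disc_triangles. in_triangle T (6 * fst z) (6 * snd z)"
      by (intro disc_cover) (auto simp: dunce_triangle_eq)
    then obtain T where T: "T \<in> set disc_triangles" "in_triangle T (6 * fst z) (6 * snd z)" by blast
    then have "z \<in> convex hull (disc_point ` set T)" by (rule in_triangle_hull)
    moreover have "set T \<in> disc_complex" using T(1) by (auto simp: disc_complex_def)
    ultimately show "z \<in> realization disc_point disc_complex" by (auto simp: realization_def)
  qed
qed

lemma disc_faces_iff: "\<sigma> \<in> disc_complex \<Longrightarrow> \<exists>S\<in>set disc_faces. set S = \<sigma>"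
proof -
  assume "\<sigma> \<in> disc_complex"
  then obtain T where T: "T \<in> set disc_triangles" "\<sigma> \<in> Pow (set T)" by (auto simp: disc_complex_def)
  then obtain S where S: "S \<in> set (subseqs T)" "set S = \<sigma>" unfolding subseqs_powset[symmetric] by blast
  have "list_ex (\<lambda>S'. if subset_list S S' then subset_list S' S else False) disc_faces"
    using disc_faces_complete T(1) S(1) unfolding list_all_iff by blast
  then show ?thesis using S(2) by (auto simp: list_ex_iff split: if_splits)
qed

lemma on_sideE:
  assumes "on_side S"
  obtains X k where "X \<in> set disc_sides" "k < 3" "set S \<subseteq> {X ! k, X ! Suc k}"
proof -
  have "\<exists>X\<in>set disc_sides. \<exists>k\<in>{0, 1, 2}. set S \<subseteq> {X ! k, X ! Suc k}"
    using assms unfolding on_side_def list_ex_iff by simp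
  then show thesis using that by (metis insertE numeral_3_eq_3 empty_iff less_Suc_eq one_less_numeral_iff zero_less_numeral semiring_norm(77) lessI numeral_2_eq_2)
qed

section \<open>The folding in barycentric coordinates\<close>

definition push :: "(nat \<Rightarrow> real) \<Rightarrow> nat \<Rightarrow> real"
  where "push w l = (\<Sum>i<14. if disc_label ! i = l then w i else 0)"

lemma push_support:
  assumes w: "w \<in> weights disc_complex"
  shows "{l. push w l \<noteq> 0} = (!) disc_label ` {i. w i \<noteq> 0}"
proof -
  have nn: "0 \<le> w i" for i using w by (auto simp: weights_def)
  have "push w l = 0 \<longleftrightarrow> (\<forall>i<14. disc_label ! i = l \<longrightarrow> w i = 0)" for l
    unfolding push_def by (subst sum_nonneg_eq_0_iff) (auto simp: nn)
  then show ?thesis using disc_weights_outside[OF w] by fastforce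
qed

text \<open>The labels within a triangle are distinct, so no two coordinates are added up and the
  folding is injective there.\<close>

lemma push_label:
  assumes T: "T \<in> set disc_triangles" "{i. w i \<noteq> 0} \<subseteq> set T" "i \<in> set T"
  shows "push w (disc_label ! i) = w i"
proof -
  have "push w (disc_label ! i) = (\<Sum>j<14. if j = i then w j else 0)"
    unfolding push_def
  proof (rule sum.cong[OF refl])
    fix j :: nat
    show "(if disc_label ! j = disc_label ! i then w j else 0) = (if j = i then w j else 0)"
      using inj_onD[OF disc_triangleD(5)[OF T(1)], of j i] T(2,3) by (cases "w j = 0") auto
  qed
  also have "\<dots> = w i" using disc_triangleD(2)[OF T(1)] T(3) by auto
  finally show ?thesis .
qed

lemma push_weights:
  assumes w: "w \<in> weights disc_complex"
  shows "push w \<in> weights dunce_faces"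
proof -
  have nn: "0 \<le> w i" for i using w by (auto simp: weights_def)
  obtain T where T: "T \<in> set disc_triangles" "{i. w i \<noteq> 0} \<subseteq> set T"
    using w by (auto simp: weights_def disc_complex_def)
  have "{l. push w l \<noteq> 0} \<in> dunce_faces"
    unfolding push_support[OF w] using dunce_faces_closed[OF disc_triangleD(6)[OF T(1)]] T(2) by blast
  moreover have "(\<Sum>l | push w l \<noteq> 0. push w l) = 1"
  proof -
    have "(\<Sum>l | push w l \<noteq> 0. push w l) = (\<Sum>l\<in>(!) disc_label ` set T. push w l)"
      by (rule sum.mono_neutral_left) (use push_support[OF w] T(2) in auto)
    also have "\<dots> = (\<Sum>i\<in>set T. push w (disc_label ! i))"
      by (simp add: sum.reindex[OF disc_triangleD(5)[OF T(1)]])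
    also have "\<dots> = sum w (set T)" by (rule sum.cong) (use push_label[OF T] in auto)
    also have "\<dots> = 1" by (rule weights_sum_superset[OF w]) (use T(2) in auto)
    finally show ?thesis .
  qed
  ultimately show ?thesis by (auto simp: weights_def push_def nn intro!: sum_nonneg)
qed

lemma push_onto:
  assumes u: "u \<in> weights dunce_faces"
  obtains w where "w \<in> weights disc_complex" "push w = u"
proof -
  have "\<exists>D\<in>set dunce_list. {l. u l \<noteq> 0} \<subseteq> set D"
    using u by (auto simp: weights_def dunce_faces_def dunce_triangles_list)
  then obtain D where D: "D \<in> set dunce_list" "{l. u l \<noteq> 0} \<subseteq> set D" by blast
  have "\<exists>T\<in>set disc_triangles. set D \<subseteq> (!) disc_label ` set T"
    using disc_labels_onto D(1) by (auto simp: list_all_iff list_ex_iff)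
  then obtain T where T: "T \<in> set disc_triangles" "set D \<subseteq> (!) disc_label ` set T" by blast
  define w where "w i = (if i \<in> set T then u (disc_label ! i) else 0)" for i
  have supp: "{i. w i \<noteq> 0} \<subseteq> set T" by (auto simp: w_def)
  have "w \<in> weights (Pow (set T))"
  proof (rule weights_PowI)
    show "0 \<le> w i" for i using u by (auto simp: w_def weights_def)
    have "sum w (set T) = (\<Sum>i\<in>set T. u (disc_label ! i))" by (rule sum.cong) (auto simp: w_def)
    also have "\<dots> = (\<Sum>l\<in>(!) disc_label ` set T. u l)"
      by (simp add: sum.reindex[OF disc_triangleD(5)[OF T(1)]])
    also have "\<dots> = 1" by (rule weights_sum_superset[OF u]) (use D(2) T(2) in auto)
    finally show "sum w (set T) = 1" .
  qed (auto simp: w_def)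
  moreover have "Pow (set T) \<subseteq> disc_complex" using disc_complex_Pow[OF T(1)] by blast
  ultimately have w: "w \<in> weights disc_complex" using weights_mono by blast
  have "push w l = u l" for l
  proof (cases "l \<in> (!) disc_label ` set T")
    case True
    then obtain i where i: "i \<in> set T" "l = disc_label ! i" by blast
    have "push w l = w i" unfolding i(2) by (rule push_label[OF T(1) supp i(1)])
    then show ?thesis using i by (simp add: w_def)
  next
    case False
    then have "push w l = 0" using push_support[OF w] supp by blast
    moreover have "u l = 0" using False D(2) T(2) by blast
    ultimately show ?thesis by simp
  qed
  then show thesis using that w by blast
qed

section \<open>The sides of the triangle and their gluing\<close>

definition edge_weights :: "nat \<Rightarrow> nat \<Rightarrow> real \<Rightarrow> nat \<Rightarrow> real"
  where "edge_weights a b f i = (if i = a then 1 - f else 0) + (if i = b then f else 0)"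

lemma edge_weights:
  assumes "{a, b} \<in> disc_complex" "0 \<le> f" "f \<le> 1"
  shows "edge_weights a b f \<in> weights disc_complex"
proof -
  have "edge_weights a b f \<in> weights (Pow {a, b})"
    by (rule weights_PowI) (use assms in \<open>auto simp: edge_weights_def sum.distrib\<close>)
  moreover have "Pow {a, b} \<subseteq> disc_complex" using assms(1) by (auto simp: disc_complex_def)
  ultimately show ?thesis using weights_mono by blast
qed

lemma push_edge: "a < 14 \<Longrightarrow> b < 14 \<Longrightarrow>
    push (edge_weights a b f) = edge_weights (disc_label ! a) (disc_label ! b) f"
proof
  fix l assume ab: "a < 14" "b < 14"
  have "push (edge_weights a b f) l = (\<Sum>i<14. (if i = a then if disc_label ! a = l then 1 - f else 0 else 0)
      + (if i = b then if disc_label ! b = l then f else 0 else 0))"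
    unfolding push_def edge_weights_def by (rule sum.cong) auto
  then show "push (edge_weights a b f) l = edge_weights (disc_label ! a) (disc_label ! b) f l"
    using ab by (auto simp: sum.distrib edge_weights_def)
qed

lemma bary_point_edge: "a < 14 \<Longrightarrow> b < 14 \<Longrightarrow>
    bary_point disc_point (edge_weights a b f) = (1 - f) *\<^sub>R disc_point a + f *\<^sub>R disc_point b"
proof -
  assume ab: "a < 14" "b < 14"
  have "bary_point disc_point (edge_weights a b f) = (\<Sum>i<14. edge_weights a b f i *\<^sub>R disc_point i)"
    by (rule bary_point_superset) (use ab in \<open>auto simp: edge_weights_def split: if_splits\<close>)
  also have "\<dots> = (\<Sum>i<14. (if i = a then (1 - f) *\<^sub>R disc_point a else 0) + (if i = b then f *\<^sub>R disc_point b else 0))"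
    by (rule sum.cong) (auto simp: edge_weights_def scaleR_add_left)
  finally show ?thesis using ab by (simp add: sum.distrib)
qed

lemma disc_side:
  assumes "X \<in> set disc_sides" "k < 3"
  shows "X ! k < 14" "X ! Suc k < 14" "X ! k \<noteq> X ! Suc k" "{X ! k, X ! Suc k} \<in> disc_complex"
    "disc_label ! (X ! k) = [1, 3, 2, 1] ! k" "disc_label ! (X ! Suc k) = [1, 3, 2, 1] ! Suc k"
    "3 *\<^sub>R disc_point (X ! k) = (3 - real k) *\<^sub>R disc_point (X ! 0) + real k *\<^sub>R disc_point (X ! 3)"
    "3 *\<^sub>R disc_point (X ! Suc k) = (2 - real k) *\<^sub>R disc_point (X ! 0) + real (Suc k) *\<^sub>R disc_point (X ! 3)"
proof -
  have "list_all (\<lambda>X. list_all (\<lambda>k. X ! k < 14 \<and> X ! Suc k < 14 \<and> X ! k \<noteq> X ! Suc k \<and>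
      list_ex (subset_list [X ! k, X ! Suc k]) disc_triangles \<and>
      disc_label ! (X ! k) = [1, 3, 2, 1] ! k \<and> disc_label ! (X ! Suc k) = [1, 3, 2, 1] ! Suc k \<and>
      3 * disc_x ! (X ! k) = (3 - int k) * disc_x ! (X ! 0) + int k * disc_x ! (X ! 3) \<and>
      3 * disc_y ! (X ! k) = (3 - int k) * disc_y ! (X ! 0) + int k * disc_y ! (X ! 3) \<and>
      3 * disc_x ! (X ! Suc k) = (2 - int k) * disc_x ! (X ! 0) + (int k + 1) * disc_x ! (X ! 3) \<and>
      3 * disc_y ! (X ! Suc k) = (2 - int k) * disc_y ! (X ! 0) + (int k + 1) * disc_y ! (X ! 3)) [0, 1, 2])
      disc_sides"
    by code_simp
  moreover have "k \<in> set [0, 1, 2]" using assms(2) by auto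
  ultimately have *: "X ! k < 14" "X ! Suc k < 14" "X ! k \<noteq> X ! Suc k"
      "list_ex (subset_list [X ! k, X ! Suc k]) disc_triangles"
      "disc_label ! (X ! k) = [1, 3, 2, 1] ! k" "disc_label ! (X ! Suc k) = [1, 3, 2, 1] ! Suc k" and
    i: "3 * disc_x ! (X ! k) = (3 - int k) * disc_x ! (X ! 0) + int k * disc_x ! (X ! 3)"
      "3 * disc_y ! (X ! k) = (3 - int k) * disc_y ! (X ! 0) + int k * disc_y ! (X ! 3)"
      "3 * disc_x ! (X ! Suc k) = (2 - int k) * disc_x ! (X ! 0) + (int k + 1) * disc_x ! (X ! 3)"
      "3 * disc_y ! (X ! Suc k) = (2 - int k) * disc_y ! (X ! 0) + (int k + 1) * disc_y ! (X ! 3)"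
    using assms(1) unfolding list_all_iff by blast+
  note r = i[THEN arg_cong[of _ _ real_of_int], unfolded of_int_mult of_int_add of_int_diff of_int_of_nat_eq of_int_numeral of_int_1]
  show "3 *\<^sub>R disc_point (X ! k) = (3 - real k) *\<^sub>R disc_point (X ! 0) + real k *\<^sub>R disc_point (X ! 3)"
    using r(1,2) by (simp add: disc_point_def prod_eq_iff field_simps)
  show "3 *\<^sub>R disc_point (X ! Suc k) = (2 - real k) *\<^sub>R disc_point (X ! 0) + real (Suc k) *\<^sub>R disc_point (X ! 3)"
    using r(3,4) by (simp add: disc_point_def prod_eq_iff field_simps)
  show "X ! k < 14" "X ! Suc k < 14" "X ! k \<noteq> X ! Suc k"
    "disc_label ! (X ! k) = [1, 3, 2, 1] ! k" "disc_label ! (X ! Suc k) = [1, 3, 2, 1] ! Suc k"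
    by (fact *)+
  show "{X ! k, X ! Suc k} \<in> disc_complex" using *(4) by (auto simp: list_ex_iff disc_complex_def)
qed

definition side_point :: "nat list \<Rightarrow> real \<Rightarrow> real \<times> real"
  where "side_point X s = linepath (disc_point (X ! 0)) (disc_point (X ! 3)) s"

lemma side_point_edge:
  assumes X: "X \<in> set disc_sides" "k < 3"
  shows "side_point X ((real k + f) / 3) = bary_point disc_point (edge_weights (X ! k) (X ! Suc k) f)"
proof -
  have 1: "disc_point (X ! k) = (1 / 3) *\<^sub>R ((3 - real k) *\<^sub>R disc_point (X ! 0) + real k *\<^sub>R disc_point (X ! 3))"
    unfolding disc_side(7)[OF X, symmetric] by simp
  have 2: "disc_point (X ! Suc k) = (1 / 3) *\<^sub>R ((2 - real k) *\<^sub>R disc_point (X ! 0) + real (Suc k) *\<^sub>R disc_point (X ! 3))"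
    unfolding disc_side(8)[OF X, symmetric] by simp
  have "bary_point disc_point (edge_weights (X ! k) (X ! Suc k) f)
      = ((1 - f) * (1 / 3) * (3 - real k) + f * (1 / 3) * (2 - real k)) *\<^sub>R disc_point (X ! 0)
      + ((1 - f) * (1 / 3) * real k + f * (1 / 3) * real (Suc k)) *\<^sub>R disc_point (X ! 3)"
    unfolding bary_point_edge[OF disc_side(1,2)[OF X]] unfolding 1 2
    by (simp only: scaleR_add_right scaleR_add_left scaleR_scaleR ac_simps)
  also have "(1 - f) * (1 / 3) * (3 - real k) + f * (1 / 3) * (2 - real k) = 1 - (real k + f) / 3"
    by (simp add: field_simps)
  also have "(1 - f) * (1 / 3) * real k + f * (1 / 3) * real (Suc k) = (real k + f) / 3"
    by (simp add: field_simps)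
  finally show ?thesis by (simp add: side_point_def linepath_def)
qed

text \<open>Each side consists of three edges, so a parameter becomes an edge number
  \<open>k\<close> and a fraction \<open>f\<close> along that edge. At inner multiples of one third
  two choices exist, and both describe the same point.\<close>

lemma thirds:
  assumes "0 \<le> s" "s \<le> (1::real)"
  obtains k f where "k < 3" "0 \<le> f" "f \<le> 1" "s = (real k + f) / 3"
proof -
  consider "s \<le> 1 / 3" | "1 / 3 \<le> s" "s \<le> 2 / 3" | "2 / 3 \<le> s" by linarith
  then show thesis
  proof cases
    case 1 then show thesis using assms by (intro that[of 0 "3 * s"]) auto
  next
    case 2 then show thesis by (intro that[of 1 "3 * s - 1"]) auto
  next
    case 3 then show thesis using assms by (intro that[of 2 "3 * s - 2"]) auto
  qed
qed

lemma dunce_glue_sides: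
  assumes "0 \<le> s" "s \<le> 1" "X \<in> set disc_sides"
  shows "equivclp dunce_glue (side_point [0, 1, 2, 3] s) (side_point X s)"
proof -
  have "disc_point 0 = (0, 0)" "disc_point 3 = (1, 0)" "disc_point 6 = (0, 1)"
    by (simp_all add: disc_point_def disc_x_def disc_y_def)
  then have "side_point [0, 1, 2, 3] s = linepath (0, 0) (1, 0) s"
    "side_point [3, 4, 5, 6] s = linepath (1, 0) (0, 1) s" "side_point [0, 8, 7, 6] s = linepath (0, 0) (0, 1) s"
    by (simp_all add: side_point_def numeral_3_eq_3)
  then show ?thesis
    using assms dunce_glue.intros[of s] by (auto simp: disc_sides_def intro: r_into_equivclp)
qed

lemma dunce_glue_side:
  assumes "dunce_glue x y"
  obtains X s where "X \<in> set disc_sides" "0 \<le> s" "s \<le> 1" "x = side_point [0, 1, 2, 3] s" "y = side_point X s"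
proof -
  have p: "disc_point 0 = (0, 0)" "disc_point 3 = (1, 0)" "disc_point 6 = (0, 1)"
    by (simp_all add: disc_point_def disc_x_def disc_y_def)
  from assms show thesis
  proof cases
    case (1 s)
    then show thesis using p
      by (intro that[of "[3, 4, 5, 6]" s]) (auto simp: disc_sides_def side_point_def numeral_3_eq_3)
  next
    case (2 s)
    then show thesis using p
      by (intro that[of "[0, 8, 7, 6]" s]) (auto simp: disc_sides_def side_point_def numeral_3_eq_3)
  qed
qed

text \<open>The labels 1, 3, 2, 1 describe a closed path through three distinct vertices, which is
  injective except at its two ends.\<close>

lemma edge_labels_eq:
  assumes "k < 3" "k' < 3"
    and eq: "edge_weights ([1, 3, 2, 1] ! k) ([1, 3, 2, 1] ! Suc k) f
      = edge_weights ([1, 3, 2, 1] ! k') ([1, 3, 2, 1] ! Suc k') f'"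
  shows "real k + f = real k' + f' \<or> {(real k + f) / 3, (real k' + f') / 3} = {0, 1}"
proof -
  have k: "k \<in> {0, 1, 2}" "k' \<in> {0, 1, 2}" using assms(1,2) by auto
  show ?thesis
    using k fun_cong[OF eq, of 1] fun_cong[OF eq, of 2] fun_cong[OF eq, of 3]
    by (auto simp: edge_weights_def)
qed

lemma edge_weights_eq:
  assumes "w \<in> weights disc_complex" "{i. w i \<noteq> 0} \<subseteq> {a, b}" "a \<noteq> b"
  shows "w = edge_weights a b (w b)" "0 \<le> w b" "w b \<le> 1"
proof -
  have nn: "0 \<le> w i" for i using assms(1) by (auto simp: weights_def)
  have "sum w {a, b} = 1" by (rule weights_sum_superset[OF assms(1)]) (use assms(2) in auto)
  then have s: "w a + w b = 1" using assms(3) by simp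
  show "w = edge_weights a b (w b)"
  proof
    fix i show "w i = edge_weights a b (w b) i"
      using s assms(2,3) by (cases "i \<in> {a, b}") (auto simp: edge_weights_def)
  qed
  show "0 \<le> w b" "w b \<le> 1" using nn[of a] nn[of b] s by auto
qed

interpretation disc: geometric_complex disc_point disc_complex
  by (rule disc_geometric_complex)

section \<open>The folding map and its fibres\<close>

context cyclic_vertices
begin

definition fold_map :: "real \<times> real \<Rightarrow> real ^ 5"
  where "fold_map z = bary_point v (push (disc.coord z))"

lemma dunce_weights: "weights dunce_faces \<subseteq> weights (cyclic_complex t)"
  by (rule weights_mono) (rule dunce_subset_complex)

lemma fold_map_image: "fold_map ` dunce_triangle = realization v dunce_faces"
proof -
  have "realization v dunce_faces = bary_point v ` weights dunce_faces"
    by (rule realization_weights) (use dunce_subset_complex finite_simplex dunce_faces_closed in blast)+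
  also have "weights dunce_faces = push ` weights disc_complex"
    using push_weights push_onto by (auto simp: image_iff) (metis push_onto)
  also have "weights disc_complex = disc.coord ` dunce_triangle"
    unfolding disc_realization[symmetric] disc.realization_eq image_image
    by (simp add: disc.coord_bary_point)
  finally show ?thesis by (simp add: fold_map_def[abs_def] image_image)
qed

lemma continuous_fold_map: "continuous_on dunce_triangle fold_map"
proof -
  have eq: "fold_map z = (\<Sum>l\<in>{1..8}. push (disc.coord z) l *\<^sub>R v l)" if "z \<in> dunce_triangle" for z
  proof -
    have "push (disc.coord z) \<in> weights (cyclic_complex t)"
      using that unfolding disc_realization[symmetric]
      by (intro subsetD[OF dunce_weights] push_weights disc.coord_weights)
    then have "{l. push (disc.coord z) l \<noteq> 0} \<subseteq> {1..8}"
      by (intro complex_subset) (simp add: weights_def)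
    then show ?thesis unfolding fold_map_def by (intro bary_point_superset) auto
  qed
  have c: "continuous_on dunce_triangle (\<lambda>z. if disc_label ! i = l then disc.coord z i else 0)" for i l
    using disc.continuous_on_coord[of i] by (cases "disc_label ! i = l") (simp_all add: disc_realization)
  have "continuous_on dunce_triangle (\<lambda>z. \<Sum>l\<in>{1..8}. push (disc.coord z) l *\<^sub>R v l)"
    unfolding push_def by (intro continuous_intros c)
  then show ?thesis using eq by (simp cong: continuous_on_cong)
qed

lemma fold_map_side:
  assumes "X \<in> set disc_sides" "Y \<in> set disc_sides" "0 \<le> s" "s \<le> 1"
  shows "fold_map (side_point X s) = fold_map (side_point Y s)"
proof -
  obtain k f where kf: "k < 3" "0 \<le> f" "f \<le> 1" "s = (real k + f) / 3"
    by (rule thirds[OF assms(3,4)]) (rule that)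
  have "fold_map (side_point X s) = bary_point v (edge_weights ([1, 3, 2, 1] ! k) ([1, 3, 2, 1] ! Suc k) f)"
    if X: "X \<in> set disc_sides" for X
    unfolding fold_map_def kf(4) side_point_edge[OF X kf(1)]
      disc.coord_bary_point[OF edge_weights[OF disc_side(4)[OF X kf(1)] kf(2,3)]]
      push_edge[OF disc_side(1,2)[OF X kf(1)]] disc_side(5,6)[OF X kf(1)] ..
  then show ?thesis using assms(1,2) by simp
qed

lemma fold_map_glue: "equivclp dunce_glue x y \<Longrightarrow> fold_map x = fold_map y"
proof (induction rule: equivclp_induct)
  case base
  show ?case ..
next
  case (step y z)
  have "fold_map a = fold_map b" if glue: "dunce_glue a b" for a b
  proof -
    obtain X s where X: "X \<in> set disc_sides" "0 \<le> s" "s \<le> 1" "a = side_point [0, 1, 2, 3] s" "b = side_point X s"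
      by (rule dunce_glue_side[OF glue]) (rule that)
    have "[0, 1, 2, 3] \<in> set disc_sides" by (simp add: disc_sides_def)
    then show ?thesis unfolding X(4,5) using X(1-3) by (rule fold_map_side)
  qed
  then show ?case using step by metis
qed

text \<open>Equal images have equal pushed weights, so the faces carrying the two points have the
  same labels. Nested faces lie in one triangle, where the folding is injective; otherwise both
  points lie on sides and are compared after moving them to the first side.\<close>

lemma fold_map_eq:
  assumes x: "x \<in> dunce_triangle" and y: "y \<in> dunce_triangle" and eq: "fold_map x = fold_map y"
  shows "equivclp dunce_glue x y"
proof -
  define w where "w = disc.coord x"
  define w' where "w' = disc.coord y"
  have w: "w \<in> weights disc_complex" "bary_point disc_point w = x"
    using x disc.coord_weights disc.bary_point_coord by (auto simp: w_def disc_realization)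
  have w': "w' \<in> weights disc_complex" "bary_point disc_point w' = y"
    using y disc.coord_weights disc.bary_point_coord by (auto simp: w'_def disc_realization)
  have push: "push w = push w'"
    by (rule inj_onD[OF inj_bary_point])
      (use eq push_weights[OF w(1)] push_weights[OF w'(1)] dunce_weights in \<open>auto simp: fold_map_def w_def w'_def\<close>)
  have "{i. w i \<noteq> 0} \<in> disc_complex" "{i. w' i \<noteq> 0} \<in> disc_complex" using w w' by (auto simp: weights_def)
  then obtain S S' where S: "S \<in> set disc_faces" "set S = {i. w i \<noteq> 0}" and
    S': "S' \<in> set disc_faces" "set S' = {i. w' i \<noteq> 0}" using disc_faces_iff by meson
  have labels: "(!) disc_label ` set S = (!) disc_label ` set S'"
    unfolding S(2) S'(2) push_support[OF w(1), symmetric] push_support[OF w'(1), symmetric] push ..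
  have "(S, map ((!) disc_label) S) \<in> set labelled_faces" "(S', map ((!) disc_label) S') \<in> set labelled_faces"
    using S(1) S'(1) by (simp_all add: labelled_faces_def)
  then have "set S \<subseteq> set S' \<or> on_side S \<and> on_side S'"
    using disc_identifications labels unfolding list_all_iff by (fastforce split: if_splits)
  then show ?thesis
  proof
    assume sub: "set S \<subseteq> set S'"
    obtain T where T: "T \<in> set disc_triangles" "{i. w' i \<noteq> 0} \<subseteq> set T"
      using w'(1) by (auto simp: weights_def disc_complex_def)
    then have T': "{i. w i \<noteq> 0} \<subseteq> set T" using sub S S' by simp
    have "w i = w' i" for i
    proof (cases "i \<in> set T")
      case True
      then show ?thesis using push_label[OF T True] push_label[OF T(1) T' True] push by simp
    next
      case False
      then have "w i = 0" "w' i = 0" using T(2) T' by blast+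
      then show ?thesis by simp
    qed
    then have "w = w'" by blast
    then have "x = y" using w(2) w'(2) by simp
    then show ?thesis by simp
  next
    let ?A = "side_point [0, 1, 2, 3]"
    have param: "\<exists>k f. k < 3 \<and> 0 \<le> f \<and> f \<le> 1 \<and> equivclp dunce_glue (?A ((real k + f) / 3)) (bary_point disc_point w)
        \<and> push w = edge_weights ([1, 3, 2, 1] ! k) ([1, 3, 2, 1] ! Suc k) f"
      if w: "w \<in> weights disc_complex" and S: "set S = {i. w i \<noteq> 0}" "on_side S" for w S
    proof -
      obtain X k where X: "X \<in> set disc_sides" "k < 3" "set S \<subseteq> {X ! k, X ! Suc k}"
        by (rule on_sideE[OF S(2)]) (rule that)
      note side = disc_side[OF X(1,2)]
      define f where "f = w (X ! Suc k)"
      have f: "w = edge_weights (X ! k) (X ! Suc k) f" "0 \<le> f" "f \<le> 1"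
        unfolding f_def by (rule edge_weights_eq[OF w X(3)[unfolded S] side(3)])+
      have "(real k + f) / 3 \<le> 1" using X(2) f(3) by simp
      then have "equivclp dunce_glue (?A ((real k + f) / 3)) (bary_point disc_point w)"
        unfolding f(1) side_point_edge[OF X(1,2), symmetric] using f(2) by (intro dunce_glue_sides X(1)) auto
      moreover have "push w = edge_weights ([1, 3, 2, 1] ! k) ([1, 3, 2, 1] ! Suc k) f"
        unfolding side(5,6)[symmetric] push_edge[OF side(1,2), symmetric] using f(1) by (rule arg_cong)
      ultimately show ?thesis using X(2) f(2,3) by blast
    qed
    assume "on_side S \<and> on_side S'"
    then obtain k f k' f' where 1: "k < 3" "0 \<le> f" "f \<le> 1" "equivclp dunce_glue (?A ((real k + f) / 3)) x"
        "push w = edge_weights ([1, 3, 2, 1] ! k) ([1, 3, 2, 1] ! Suc k) f"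
      and 2: "k' < 3" "0 \<le> f'" "f' \<le> 1" "equivclp dunce_glue (?A ((real k' + f') / 3)) y"
        "push w' = edge_weights ([1, 3, 2, 1] ! k') ([1, 3, 2, 1] ! Suc k') f'"
      using param[OF w(1) S(2)] param[OF w'(1) S'(2)] unfolding w(2) w'(2) by metis
    \<comment> \<open>The second side starts where the first one ends, so gluing the two sides at
      parameter 0 identifies both ends of the first side.\<close>
    have ends: "equivclp dunce_glue (?A 0) (?A 1)"
    proof -
      have "equivclp dunce_glue (?A 0) (side_point [3, 4, 5, 6] 0)"
        by (rule dunce_glue_sides) (auto simp: disc_sides_def)
      moreover have "side_point [3, 4, 5, 6] 0 = ?A 1"
        by (simp add: side_point_def linepath_def numeral_3_eq_3)
      ultimately show ?thesis by simp
    qed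
    have "real k + f = real k' + f' \<or> {(real k + f) / 3, (real k' + f') / 3} = {0, 1}"
      by (rule edge_labels_eq[OF 1(1) 2(1)]) (use push 1(5) 2(5) in simp)
    then have "equivclp dunce_glue (?A ((real k + f) / 3)) (?A ((real k' + f') / 3))"
      using ends equivclp_sym[OF ends] by (auto simp: doubleton_eq_iff)
    then show ?thesis by (rule equivclp_trans[OF equivclp_trans[OF equivclp_sym[OF 1(4)]] 2(4)])
  qed
qed

text \<open>A continuous map from a compact space onto a Hausdorff space is closed and hence a
  quotient map.\<close>

lemma dunce_hat: "is_dunce_hat (\<Union>(dunce_complex t))"
  unfolding is_dunce_hat_def Union_dunce_complex
proof (intro exI conjI ballI)
  have "compact_space (top_of_set dunce_triangle)"
    unfolding dunce_triangle_def by (simp add: compact_space_subtopology compactin_euclidean_iff finite_imp_compact_convex_hull)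
  then have "closed_map (top_of_set dunce_triangle) (top_of_set (realization v dunce_faces)) fold_map"
    using continuous_fold_map fold_map_image
    by (intro continuous_imp_closed_map) (auto intro: Hausdorff_space_subtopology)
  then show "quotient_map (top_of_set dunce_triangle) (top_of_set (realization v dunce_faces)) fold_map"
    using continuous_fold_map fold_map_image by (intro continuous_closed_imp_quotient_map) auto
  show "fold_map x = fold_map y \<longleftrightarrow> equivclp dunce_glue x y" if "x \<in> dunce_triangle" "y \<in> dunce_triangle" for x y
    using fold_map_eq[OF that] fold_map_glue by blast
qed

end

section \<open>The derived neighborhood\<close>

lemma continuous_on_Max:
  fixes f :: "'i \<Rightarrow> 'a::topological_space \<Rightarrow> real"
  assumes "finite I" "I \<noteq> {}" "\<And>i. i \<in> I \<Longrightarrow> continuous_on A (f i)"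
  shows "continuous_on A (\<lambda>x. Max ((\<lambda>i. f i x) ` I))"
  using assms
proof (induction rule: finite_ne_induct)
  case (insert i I)
  have "(\<lambda>x. Max ((\<lambda>i. f i x) ` insert i I)) = (\<lambda>x. max (f i x) (Max ((\<lambda>i. f i x) ` I)))"
    using insert.hyps by (simp add: Max_insert)
  then show ?case using insert by (auto intro!: continuous_on_max)
qed auto

lemma openin_Collect_less:
  fixes f g :: "'a::topological_space \<Rightarrow> real"
  assumes "continuous_on S f" "continuous_on S g"
  shows "openin (top_of_set S) {x \<in> S. f x < g x}"
proof -
  have "openin (top_of_set S) (S \<inter> (\<lambda>x. g x - f x) -` {0<..})"
    by (rule continuous_openin_preimage_gen) (use assms in \<open>auto intro: continuous_intros\<close>)
  moreover have "S \<inter> (\<lambda>x. g x - f x) -` {0<..} = {x \<in> S. f x < g x}" by auto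
  ultimately show ?thesis by simp
qed

text \<open>For a basis containing \<open>u\<close> and \<open>w\<close>, the map \<open>l\<close>
  is a projection with kernel \<open>span {w}\<close>, and \<open>g\<close>, \<open>g'\<close> are
  the coordinates along \<open>u\<close> and \<open>w\<close>. Injectivity of the charts is tested
  with the last clause: a difference that \<open>l\<close> sends to the first axis is a combination
  of \<open>u\<close> and \<open>w\<close>.\<close>

lemma exists_projection_along:
  fixes u w :: "real ^ 5"
  assumes "w \<noteq> 0" "u \<notin> span {w}"
  shows "\<exists>(l :: real ^ 5 \<Rightarrow> real ^ 4) (g :: real ^ 5 \<Rightarrow> real) (g' :: real ^ 5 \<Rightarrow> real).
    linear l \<and> linear g \<and> linear g' \<and> g u = 1 \<and> g w = 0 \<and> g' u = 0 \<and> g' w = 1 \<and> l u = axis 1 1 \<and>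
    (\<forall>x s. l x = s *\<^sub>R axis 1 1 \<longrightarrow> x = s *\<^sub>R u + g' x *\<^sub>R w)"
proof -
  have uw: "u \<noteq> w" using assms(2) by (auto simp: span_base)
  have ind: "independent {u, w}" using assms by (simp add: independent_insert uw)
  obtain B where B0: "{u, w} \<subseteq> B" "B \<subseteq> UNIV" "independent B" "UNIV \<subseteq> span B"
    by (rule maximal_independent_subset_extend[OF subset_UNIV ind])
  note B = B0(1,3,4)
  have finB: "finite B" using B(2) by (rule independent_imp_finite)
  have "span B = UNIV" using B(3) by blast
  then have "card B = 5" using dim_eq_card[of B UNIV] B(2) by (simp add: dim_UNIV)
  then have c: "card (B - {u, w}) = 3" using B(1) finB uw by (simp add: card_Diff_subset)
  have ax: "axis 1 1 \<in> (Basis :: (real ^ 4) set)" by (simp add: axis_in_Basis_iff)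
  have c': "card ((Basis :: (real ^ 4) set) - {axis 1 1}) = 3"
    using ax by (subst card_Diff_singleton) auto
  obtain \<phi> where \<phi>: "bij_betw \<phi> (B - {u, w}) ((Basis :: (real ^ 4) set) - {axis 1 1})"
    using finite_same_card_bij[OF finite_Diff[OF finB] finite_Diff[OF finite_Basis]] c c' by metis
  obtain l where l: "linear l" "\<forall>x\<in>B. l x = (if x = w then 0 else if x = u then axis 1 1 else \<phi> x)"
    using linear_independent_extend[OF B(2), of "\<lambda>x. (if x = w then 0 else if x = u then axis 1 1 else \<phi> x)"] by (elim exE conjE) (rule that)
  obtain g where g: "linear g" "\<forall>x\<in>B. g x = (if x = u then 1 else 0 :: real)"
    using linear_independent_extend[OF B(2), of "\<lambda>x. (if x = u then 1 else 0 :: real)"] by (elim exE conjE) (rule that)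
  obtain g' where g': "linear g'" "\<forall>x\<in>B. g' x = (if x = w then 1 else 0 :: real)"
    using linear_independent_extend[OF B(2), of "\<lambda>x. (if x = w then 1 else 0 :: real)"] by (elim exE conjE) (rule that)
  have key: "x = s *\<^sub>R u + g' x *\<^sub>R w" if x: "l x = s *\<^sub>R axis 1 1" for x s
  proof -
    obtain r where r: "x = (\<Sum>b\<in>B. r b *\<^sub>R b)"
      using B(3) span_finite[OF finB] by (metis (no_types, lifting) UNIV_I image_iff subsetD)
    have split: "(\<Sum>b\<in>B. f b) = f u + f w + (\<Sum>b\<in>B - {u, w}. f b)" for f :: "_ \<Rightarrow> 'z::ab_group_add"
    proof -
      have "(\<Sum>b\<in>B. f b) = (\<Sum>b\<in>{u, w}. f b) + (\<Sum>b\<in>B - {u, w}. f b)"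
        using B(1) finB by (metis add.commute sum.subset_diff)
      then show ?thesis using uw by simp
    qed
    have "l x = r u *\<^sub>R axis 1 1 + (\<Sum>b\<in>B - {u, w}. r b *\<^sub>R \<phi> b)"
    proof -
      have "l x = (\<Sum>b\<in>B. r b *\<^sub>R l b)"
        unfolding r by (simp add: linear_sum[OF l(1)] linear_cmul[OF l(1)])
      also have "\<dots> = r u *\<^sub>R axis 1 1 + (\<Sum>b\<in>B - {u, w}. r b *\<^sub>R l b)"
        unfolding split using l(2) B(1) uw by simp
      also have "(\<Sum>b\<in>B - {u, w}. r b *\<^sub>R l b) = (\<Sum>b\<in>B - {u, w}. r b *\<^sub>R \<phi> b)"
        by (rule sum.cong) (use l(2) in auto)
      finally show ?thesis .
    qed
    then have eq: "s *\<^sub>R axis 1 1 = r u *\<^sub>R axis 1 1 + (\<Sum>b\<in>B - {u, w}. r b *\<^sub>R \<phi> b)" using x by simp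
    have \<phi>B: "\<phi> b \<in> Basis" "\<phi> b \<noteq> axis 1 1" if "b \<in> B - {u, w}" for b using \<phi> that by (auto dest!: bij_betwE)
    have "s = r u"
    proof -
      have "(\<Sum>b\<in>B - {u, w}. r b *\<^sub>R \<phi> b) \<bullet> axis 1 1 = 0"
        unfolding inner_sum_left using \<phi>B ax by (intro sum.neutral) (auto simp: inner_not_same_Basis)
      then have "(s *\<^sub>R axis 1 1) \<bullet> (axis 1 1 :: real ^ 4) = (r u *\<^sub>R axis 1 1) \<bullet> (axis 1 1 :: real ^ 4)"
        unfolding eq by (simp add: inner_add_left)
      then show ?thesis using ax by simp
    qed
    moreover have "r b = 0" if b: "b \<in> B - {u, w}" for b
    proof -
      have "(s *\<^sub>R axis 1 1) \<bullet> \<phi> b = 0" using \<phi>B[OF b] ax by (simp add: inner_not_same_Basis)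
      then have "0 = (\<Sum>d\<in>B - {u, w}. r d *\<^sub>R \<phi> d) \<bullet> \<phi> b"
        unfolding eq using \<phi>B[OF b] ax by (simp add: inner_add_left inner_not_same_Basis)
      also have "\<dots> = (\<Sum>d\<in>B - {u, w}. if d = b then r b else 0)"
        unfolding inner_sum_left
      proof (rule sum.cong[OF refl])
        fix d assume d: "d \<in> B - {u, w}"
        have "\<phi> d = \<phi> b \<longleftrightarrow> d = b" using \<phi> d b by (meson bij_betw_def inj_on_eq_iff)
        then show "r d *\<^sub>R \<phi> d \<bullet> \<phi> b = (if d = b then r b else 0)"
          using \<phi>B[OF b] \<phi>B[OF d] by (auto simp: inner_Basis)
      qed
      also have "\<dots> = r b" using b finB by simp
      finally show ?thesis by simp
    qed
    ultimately have xr: "x = s *\<^sub>R u + r w *\<^sub>R w" unfolding r split by simp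
    have "g' x = r w" unfolding xr using g' B(1) uw by (simp add: linear_add[OF g'(1)] linear_cmul[OF g'(1)])
    then show ?thesis using xr by simp
  qed
  show ?thesis
    by (intro exI[of _ l] exI[of _ g] exI[of _ g']) (use key l g g' B(1) uw in auto)
qed

lemma homeomorphism_inj_on: "homeomorphism S T f g \<Longrightarrow> inj_on f S"
  by (rule inj_on_inverseI[of _ g]) (simp add: homeomorphism_def)

text \<open>The complex triangulates the boundary of a convex body in \<open>\<real>\<^sup>5\<close>. The neighborhood is
  described by the coordinates with respect to the barycentric subdivision.\<close>

locale sphere_subcomplex = geometric_complex b \<K> for b :: "'v \<Rightarrow> real ^ 5" and \<K> +
  fixes P :: "(real ^ 5) set" and \<D> :: "'v set set"
  assumes convex_P: "convex P" and compact_P: "compact P" and interior_P: "interior P \<noteq> {}"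
    and frontier_P: "frontier P = realization b \<K>"
    and subcomplex: "\<D> \<subseteq> \<K>" and subcomplex_closed: "C \<in> \<D> \<Longrightarrow> C' \<subseteq> C \<Longrightarrow> C' \<in> \<D>"
    and subcomplex_ne: "\<D> - {{}} \<noteq> {}" and proper: "\<K> - \<D> \<noteq> {}"
begin

lemma empty_in: "{} \<in> \<D>"
  using subcomplex_ne subcomplex_closed by blast

lemma realization_D: "realization b \<D> = {p \<in> realization b \<K>. {v. coord p v \<noteq> 0} \<in> \<D>}"
  by (rule realization_subcomplex[OF subcomplex]) (rule subcomplex_closed)

section \<open>Inner and outer coordinates\<close>

definition inner_coord :: "real ^ 5 \<Rightarrow> real"
  where "inner_coord p = Max (sd_coord p ` (\<D> - {{}}))"

definition outer_coord :: "real ^ 5 \<Rightarrow> real"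
  where "outer_coord p = Max (sd_coord p ` (\<K> - \<D>))"

definition nbhd :: "(real ^ 5) set"
  where "nbhd = {p \<in> frontier P. outer_coord p \<le> inner_coord p}"

definition level :: "(real ^ 5) set"
  where "level = {p \<in> frontier P. outer_coord p = inner_coord p}"

lemma fin: "finite (\<D> - {{}})" "finite (\<K> - \<D>)"
  using finite_complex finite_subset[OF subcomplex] by auto

lemma sd_coord_le_inner: "S \<in> \<D> \<Longrightarrow> S \<noteq> {} \<Longrightarrow> sd_coord p S \<le> inner_coord p"
  unfolding inner_coord_def using fin by auto

lemma sd_coord_le_outer: "S \<in> \<K> \<Longrightarrow> S \<notin> \<D> \<Longrightarrow> sd_coord p S \<le> outer_coord p"
  unfolding outer_coord_def using fin by auto

lemma inner_coord_attained: "\<exists>S\<in>\<D> - {{}}. inner_coord p = sd_coord p S"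
proof -
  have "inner_coord p \<in> sd_coord p ` (\<D> - {{}})"
    unfolding inner_coord_def using fin subcomplex_ne by (intro Max_in) simp_all
  then show ?thesis by (rule imageE) blast
qed

lemma outer_coord_attained: "\<exists>S\<in>\<K> - \<D>. outer_coord p = sd_coord p S"
proof -
  have "outer_coord p \<in> sd_coord p ` (\<K> - \<D>)"
    unfolding outer_coord_def using fin proper by (intro Max_in) simp_all
  then show ?thesis by (rule imageE) blast
qed

lemma sd_weights: "p \<in> frontier P \<Longrightarrow> sd_coord p \<in> weights (chains \<K>)"
proof -
  interpret sd: geometric_complex "centroid b" "chains \<K>" by (rule sd_complex)
  show "p \<in> frontier P \<Longrightarrow> ?thesis" using sd.coord_weights sd_realization frontier_P by simp
qed

lemma sd_coord_nonneg: "p \<in> frontier P \<Longrightarrow> 0 \<le> sd_coord p S"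
  using chain_weightsD(2)[OF sd_weights] .

lemma sd_coord_outside: "p \<in> frontier P \<Longrightarrow> S \<notin> \<K> - {{}} \<Longrightarrow> sd_coord p S = 0"
  using chain_weightsD(4,5)[OF sd_weights] by blast

lemma sd_point: "p \<in> frontier P \<Longrightarrow> bary_point (centroid b) (sd_coord p) = p"
proof -
  interpret sd: geometric_complex "centroid b" "chains \<K>" by (rule sd_complex)
  show "p \<in> frontier P \<Longrightarrow> ?thesis" using sd.bary_point_coord sd_realization frontier_P by simp
qed

lemma sd_point_weights:
  assumes "w \<in> weights (chains \<K>)"
  shows "bary_point (centroid b) w \<in> frontier P" "sd_coord (bary_point (centroid b) w) = w"
proof -
  interpret sd: geometric_complex "centroid b" "chains \<K>" by (rule sd_complex)
  show "bary_point (centroid b) w \<in> frontier P"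
    using assms sd.realization_eq sd_realization frontier_P by auto
  show "sd_coord (bary_point (centroid b) w) = w" using assms by (rule sd.coord_bary_point)
qed

lemma continuous_sd_coord: "continuous_on (frontier P) (\<lambda>p. sd_coord p S)"
proof -
  interpret sd: geometric_complex "centroid b" "chains \<K>" by (rule sd_complex)
  show ?thesis using sd.continuous_on_coord[of S] sd_realization frontier_P by simp
qed

lemma continuous_inner_coord: "continuous_on (frontier P) inner_coord"
  unfolding inner_coord_def using fin subcomplex_ne continuous_sd_coord
  by (intro continuous_on_Max) auto

lemma continuous_outer_coord: "continuous_on (frontier P) outer_coord"
  unfolding outer_coord_def using fin proper continuous_sd_coord
  by (intro continuous_on_Max) auto

lemma inner_coord_nonneg: "p \<in> frontier P \<Longrightarrow> 0 \<le> inner_coord p"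
  using inner_coord_attained sd_coord_nonneg by metis

text \<open>If the inner maximum vanished, so would the outer one and with them all coordinates,
  which sum to 1.\<close>

lemma inner_coord_pos:
  assumes "p \<in> nbhd"
  shows "0 < inner_coord p"
proof (rule ccontr)
  have p: "p \<in> frontier P" and le: "outer_coord p \<le> inner_coord p" using assms by (auto simp: nbhd_def)
  assume "\<not> 0 < inner_coord p"
  then have "sd_coord p S = 0" for S
    using sd_coord_nonneg[OF p, of S] sd_coord_le_inner[of S p] sd_coord_le_outer[of S p]
      sd_coord_outside[OF p, of S] le by fastforce
  then show False using chain_weightsD(6)[OF sd_weights[OF p]] by simp
qed

lemma nbhd_alt: "{p \<in> frontier P. \<exists>S\<in>\<D> - {{}}. \<forall>T. sd_coord p T \<le> sd_coord p S} = nbhd"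
proof (intro set_eqI iffI)
  fix p assume "p \<in> {p \<in> frontier P. \<exists>S\<in>\<D> - {{}}. \<forall>T. sd_coord p T \<le> sd_coord p S}"
  then obtain S where S: "p \<in> frontier P" "S \<in> \<D> - {{}}" "\<And>T. sd_coord p T \<le> sd_coord p S" by auto
  obtain T where T: "outer_coord p = sd_coord p T" using outer_coord_attained by blast
  have "sd_coord p S \<le> inner_coord p" using sd_coord_le_inner S(2) by blast
  then have "outer_coord p \<le> inner_coord p" using S(3)[of T] T by simp
  then show "p \<in> nbhd" using S(1) by (simp add: nbhd_def)
next
  fix p assume p: "p \<in> nbhd"
  obtain S where S: "S \<in> \<D> - {{}}" "inner_coord p = sd_coord p S" using inner_coord_attained by blast
  have pf: "p \<in> frontier P" "outer_coord p \<le> inner_coord p" using p by (auto simp: nbhd_def)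
  have "sd_coord p T \<le> sd_coord p S" for T
  proof (cases "T \<in> \<K> - {{}}")
    case True
    then show ?thesis using sd_coord_le_inner[of T p] sd_coord_le_outer[of T p] S pf by fastforce
  next
    case False
    then show ?thesis using sd_coord_outside[OF pf(1) False] sd_coord_nonneg[OF pf(1)] by simp
  qed
  then show "p \<in> {p \<in> frontier P. \<exists>S\<in>\<D> - {{}}. \<forall>T. sd_coord p T \<le> sd_coord p S}" using S pf by blast
qed

subsection \<open>Charts\<close>

text \<open>The frontier of a convex body in \<open>real ^ 5\<close> is a 4-sphere, so invariance of
  domain applies to maps into \<open>real ^ 4\<close>. Inverse charts come for free.\<close>

lemma open_image_chart:
  fixes h :: "real ^ 5 \<Rightarrow> real ^ 4"
  assumes "openin (top_of_set (frontier P)) U" "continuous_on U h" "inj_on h U"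
  shows "open (h ` U)"
proof -
  have "openin (top_of_set UNIV) (h ` U)"
  proof (rule invariance_of_domain_sphere_affine_set_gen[where U = P])
    show "aff_dim (UNIV :: (real ^ 4) set) < aff_dim P"
      using aff_dim_nonempty_interior[OF interior_P] by simp
    show "openin (top_of_set (rel_frontier P)) U"
      using assms(1) by (simp add: rel_frontier_nonempty_interior[OF interior_P])
  qed (use assms convex_P compact_P compact_imp_bounded in auto)
  then show ?thesis by simp
qed

text \<open>Openness makes \<open>h\<close> a homeomorphism onto an open set, and the sign of the
  first coordinate cuts out the half-space. Charts at interior points and at boundary points are
  both obtained in this way.\<close>

lemma chart4_of_injective:
  fixes h :: "real ^ 5 \<Rightarrow> real ^ 4"
  assumes U: "openin (top_of_set (frontier P)) U" and h: "continuous_on U h" "inj_on h U"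
    and N: "\<And>y. y \<in> U \<Longrightarrow> y \<in> N \<longleftrightarrow> 0 \<le> h y $ 1" "N \<subseteq> frontier P"
  shows "chart4 N (U \<inter> N) h"
proof -
  have "open (h ` U')" if "openin (top_of_set U) U'" for U'
  proof (rule open_image_chart)
    show "openin (top_of_set (frontier P)) U'" using that U by (rule openin_trans)
    show "continuous_on U' h" "inj_on h U'"
      using that h openin_imp_subset by (blast intro: continuous_on_subset inj_on_subset)+
  qed
  then obtain g where g: "homeomorphism U (h ` U) h g"
    using homeomorphism_injective_open_map[OF h(1) refl h(2)]
    by (metis open_openin_trans open_subset openin_imp_subset image_mono open_image_chart[OF U h])
  have img: "h ` (U \<inter> N) = h ` U \<inter> half_space4" using N(1) by (auto simp: half_space4_def)
  have "homeomorphism (U \<inter> N) (h ` U \<inter> half_space4) h g"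
    by (rule homeomorphism_of_subsets[OF g _ _ img]) auto
  moreover have "openin (top_of_set half_space4) (h ` U \<inter> half_space4)"
    using open_image_chart[OF U h] by (metis inf_commute openin_open_Int)
  moreover have "openin (top_of_set N) (U \<inter> N)"
  proof -
    obtain W where W: "open W" "U = frontier P \<inter> W" using U by (auto simp: openin_open)
    have "U \<inter> N = N \<inter> W" using W(2) N(2) by blast
    then show ?thesis using W(1) by (auto simp: openin_open)
  qed
  ultimately show ?thesis unfolding chart4_def by blast
qed

text \<open>The direction from \<open>p\<close> to the center of an inscribed ball is transverse to
  the frontier near \<open>p\<close>: for \<open>y'\<close> close to \<open>p\<close> the translate
  by \<open>q - p\<close> lies in that ball, and all points strictly after \<open>y'\<close> on a
  segment to an interior point are interior.\<close>

lemma transverse: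
  assumes p: "p \<in> frontier P" and q: "cball q r \<subseteq> P" "0 < r"
    and y: "y \<in> frontier P" "y' \<in> frontier P" "dist y' p < r" "0 < \<beta>" "\<beta> \<le> 1"
  shows "y \<noteq> y' + \<beta> *\<^sub>R (q - p)"
proof
  assume eq: "y = y' + \<beta> *\<^sub>R (q - p)"
  have "y' + (q - p) \<in> ball q r" using y(3) by (simp add: dist_norm norm_minus_commute algebra_simps)
  then have "y' + (q - p) \<in> interior P"
    using q(1) by (meson ball_subset_cball interior_maximal open_ball subset_iff order_trans)
  moreover have "y' \<in> P" using y(2) compact_P by (metis compact_imp_closed frontier_subset_closed subsetD)
  ultimately have "y' - \<beta> *\<^sub>R (y' - (y' + (q - p))) \<in> interior P"
    using mem_interior_convex_shrink[OF convex_P _ _ y(4,5)] by blast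
  then have "y \<in> interior P" by (simp add: eq algebra_simps)
  then show False using y(1) by (simp add: frontier_def)
qed

lemma interior_ball: obtains q r where "cball q r \<subseteq> P" "0 < r"
  using interior_P mem_interior_cball by blast

text \<open>A motion inside the open simplex of the subdivision that carries \<open>y\<close>: the
  direction has total weight zero and uses only vertices of that simplex, so the point stays on the
  frontier while its coordinates remain positive.\<close>

lemma sd_coord_shift:
  assumes y: "y \<in> frontier P" and c: "\<And>S. c S \<noteq> 0 \<Longrightarrow> sd_coord y S \<noteq> 0" "(\<Sum>S | sd_coord y S \<noteq> 0. c S) = 0"
    and pos: "\<And>S. sd_coord y S \<noteq> 0 \<Longrightarrow> 0 < sd_coord y S + \<alpha> * c S"
  shows "y + \<alpha> *\<^sub>R (\<Sum>S | sd_coord y S \<noteq> 0. c S *\<^sub>R centroid b S) \<in> frontier P"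
    "sd_coord (y + \<alpha> *\<^sub>R (\<Sum>S | sd_coord y S \<noteq> 0. c S *\<^sub>R centroid b S)) = (\<lambda>S. sd_coord y S + \<alpha> * c S)"
proof -
  let ?w = "\<lambda>S. sd_coord y S + \<alpha> * c S" and ?C = "{S. sd_coord y S \<noteq> 0}"
  note W = sd_weights[OF y]
  have supp: "{S. ?w S \<noteq> 0} = ?C" using c(1) pos by force
  have "?w \<in> weights (chains \<K>)"
  proof -
    have "0 \<le> ?w S" for S using pos[of S] c(1)[of S] by (cases "c S = 0") (auto simp: sd_coord_nonneg[OF y])
    moreover have "(\<Sum>S | ?w S \<noteq> 0. ?w S) = 1"
      unfolding supp using c(2) W by (simp add: sum.distrib sum_distrib_left[symmetric] weights_def)
    ultimately show ?thesis using W supp by (simp add: weights_def)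
  qed
  moreover have "bary_point (centroid b) ?w = y + \<alpha> *\<^sub>R (\<Sum>S\<in>?C. c S *\<^sub>R centroid b S)"
  proof -
    have "bary_point (centroid b) ?w = (\<Sum>S\<in>?C. ?w S *\<^sub>R centroid b S)" unfolding bary_point_def supp ..
    also have "\<dots> = bary_point (centroid b) (sd_coord y) + \<alpha> *\<^sub>R (\<Sum>S\<in>?C. c S *\<^sub>R centroid b S)"
      by (simp add: bary_point_def scaleR_add_left sum.distrib scaleR_sum_right)
    finally show ?thesis using sd_point[OF y] by simp
  qed
  ultimately show "y + \<alpha> *\<^sub>R (\<Sum>S\<in>?C. c S *\<^sub>R centroid b S) \<in> frontier P"
    "sd_coord (y + \<alpha> *\<^sub>R (\<Sum>S\<in>?C. c S *\<^sub>R centroid b S)) = ?w"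
    using sd_point_weights[of ?w] by auto
qed

text \<open>Projection along a transverse direction is injective near \<open>p\<close>.\<close>

lemma interior_chart:
  assumes p: "p \<in> frontier P" "outer_coord p < inner_coord p"
  shows "\<exists>U h. p \<in> U \<and> chart4 nbhd U h"
proof -
  obtain q r where q: "cball q r \<subseteq> P" "0 < r" by (rule interior_ball)
  define w where "w = q - p"
  have w0: "w \<noteq> 0"
  proof
    assume "w = 0"
    then have "p \<in> interior P" using q by (auto simp: w_def mem_interior_cball)
    then show False using p(1) by (simp add: frontier_def)
  qed
  have "span {w} \<noteq> UNIV"
    using dim_le_card[of "UNIV :: (real ^ 5) set" "{w}"] by auto
  then obtain u where u: "u \<notin> span {w}" by blast
  obtain l :: "real ^ 5 \<Rightarrow> real ^ 4" and g g' where l: "linear l" "linear g'"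
    "g' w = 1" "\<And>x s. l x = s *\<^sub>R axis 1 1 \<Longrightarrow> x = s *\<^sub>R u + g' x *\<^sub>R w"
    using exists_projection_along[OF w0 u] by blast
  have contl: "continuous_on A l" "continuous_on A g'" for A
    using l by (auto intro: linear_continuous_on linear_conv_bounded_linear[THEN iffD1])
  \<comment> \<open>The translation gives \<open>p\<close> the first coordinate 1, away from the
    bounding hyperplane.\<close>
  define h where "h y = l (y - p) + axis 1 1" for y
  have conth: "continuous_on A h" for A
    unfolding h_def by (intro continuous_intros continuous_on_compose2[OF contl(1)[of UNIV]]) auto
  \<comment> \<open>The bound 1 / 2 keeps the difference of two \<open>w\<close>-coordinates below
    1, as \<open>transverse\<close> requires.\<close>
  define U where "U = {y \<in> frontier P. dist y p < r \<and> outer_coord y < inner_coord y \<and> 0 < h y $ 1 \<and> \<bar>g' (y - p)\<bar> < 1 / 2}"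
  have "openin (top_of_set (frontier P)) U"
  proof -
    have "U = {y \<in> frontier P. dist y p < r} \<inter> {y \<in> frontier P. outer_coord y < inner_coord y} \<inter>
       {y \<in> frontier P. 0 < h y $ 1} \<inter> {y \<in> frontier P. \<bar>g' (y - p)\<bar> < 1 / 2}"
      by (auto simp: U_def)
    moreover have "continuous_on (frontier P) (\<lambda>y. g' (y - p))"
      by (intro continuous_on_compose2[OF contl(2)[of UNIV]] continuous_intros) auto
    moreover have "continuous_on (frontier P) (\<lambda>y. h y $ 1)" using conth by (intro continuous_intros) auto
    ultimately show ?thesis
      by (auto intro!: openin_Int openin_Collect_less continuous_intros continuous_inner_coord continuous_outer_coord)
  qed
  moreover have "inj_on h U"
  proof (rule inj_onI, rule ccontr)
    fix y y' assume y: "y \<in> U" "y' \<in> U" "h y = h y'" "y \<noteq> y'"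
    have "l (y - y') = 0 *\<^sub>R axis 1 1"
      using y(3) linear_diff[OF l(1), of "y - p" "y' - p"] by (simp add: h_def)
    from l(4)[OF this] have eq: "y = y' + g' (y - y') *\<^sub>R w" by (simp add: algebra_simps)
    have "\<bar>g' (y - p)\<bar> < 1 / 2" "\<bar>g' (y' - p)\<bar> < 1 / 2" using y(1,2) by (auto simp: U_def)
    moreover have "g' (y - y') = g' (y - p) - g' (y' - p)"
      using linear_diff[OF l(2), of "y - p" "y' - p"] by simp
    ultimately have b: "\<bar>g' (y - y')\<bar> \<le> 1" by linarith
    have "g' (y - y') \<noteq> 0" using eq y(4) by auto
    moreover have "y' = y + (- g' (y - y')) *\<^sub>R w" using eq by (simp add: algebra_simps)
    ultimately show False
      using transverse[OF p(1) q, of y y' "g' (y - y')"] transverse[OF p(1) q, of y' y "- g' (y - y')"]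
        y(1,2) eq b unfolding U_def w_def by (cases "0 < g' (y - y')") auto
  qed
  ultimately have "chart4 nbhd (U \<inter> nbhd) h"
    using conth by (intro chart4_of_injective) (auto simp: U_def nbhd_def)
  moreover have "p \<in> U \<inter> nbhd"
    using p q linear_0[OF l(1)] linear_0[OF l(2)] by (auto simp: U_def nbhd_def h_def)
  ultimately show ?thesis by blast
qed

text \<open>Along \<open>u\<close> all inner coordinates of the chain of \<open>p\<close> grow and
  all outer ones shrink, so the difference \<open>f\<close> of the two maxima increases strictly.
  The chart projects along the transverse direction \<open>w\<close> and replaces the coordinate
  along \<open>u\<close> by \<open>f\<close>. Two points with equal images differ by a combination
  of \<open>u\<close> and \<open>w\<close>; transversality excludes a part along \<open>w\<close>,
  and then monotonicity excludes a part along \<open>u\<close>.\<close>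

lemma level_chart:
  assumes "p \<in> level"
  shows "\<exists>U h. p \<in> U \<and> chart4 nbhd U h \<and> h p $ 1 = 0"
proof -
  have p: "p \<in> frontier P" and eq: "outer_coord p = inner_coord p" using assms by (auto simp: level_def)
  define m where "m = inner_coord p"
  have m: "0 < m" using inner_coord_pos[of p] p eq by (simp add: m_def nbhd_def)
  let ?C = "{S. sd_coord p S \<noteq> 0}"
  note dp = chain_weightsD[OF sd_weights[OF p]]
  obtain q r where q: "cball q r \<subseteq> P" "0 < r" by (rule interior_ball)
  define w where "w = q - p"
  have w0: "w \<noteq> 0"
  proof
    assume "w = 0"
    then have "p \<in> interior P" using q by (auto simp: w_def mem_interior_cball)
    then show False using p by (simp add: frontier_def)
  qed
  obtain S1 where S1: "S1 \<in> \<D> - {{}}" "sd_coord p S1 = m" using inner_coord_attained m_def by metis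
  obtain S2 where S2: "S2 \<in> \<K> - \<D>" "sd_coord p S2 = m" using outer_coord_attained m_def eq by metis
  define k1 where "k1 = real (card (?C \<inter> \<D>))"
  define k2 where "k2 = real (card (?C - \<D>))"
  have k: "0 < k1" "0 < k2"
  proof -
    have "S1 \<in> ?C \<inter> \<D>" "S2 \<in> ?C - \<D>" using S1 S2 m by auto
    moreover have "finite (?C \<inter> \<D>)" "finite (?C - \<D>)" using dp(1) by auto
    ultimately have "0 < card (?C \<inter> \<D>)" "0 < card (?C - \<D>)" unfolding card_gt_0_iff by blast+
    then show "0 < k1" "0 < k2" by (simp_all add: k1_def k2_def)
  qed
  \<comment> \<open>Each part of the chain is weighted by the size of the other one, so that the
    total is zero.\<close>
  define c where "c S = (if S \<in> ?C then if S \<in> \<D> then k2 else - k1 else 0)" for S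
  have csum: "sum c ?C = 0"
  proof -
    have "sum c ?C = sum c (?C \<inter> \<D>) + sum c (?C - \<D>)"
      by (rule sum.Int_Diff[OF dp(1)])
    also have "sum c (?C \<inter> \<D>) = k1 * k2" by (simp add: c_def k1_def)
    also have "sum c (?C - \<D>) = - (k2 * k1)" by (simp add: c_def k2_def)
    finally show ?thesis by simp
  qed
  define u where "u = (\<Sum>S\<in>?C. c S *\<^sub>R centroid b S)"
  \<comment> \<open>Half the least positive coordinate of \<open>p\<close>: coordinates above \<eta>
    stay positive when they change by at most \<eta>.\<close>
  define \<eta> where "\<eta> = Min (sd_coord p ` ?C) / 2"
  have "0 < Min (sd_coord p ` ?C)"
    using dp(1,6) sd_coord_nonneg[OF p] by (subst Min_gr_iff) (auto simp: order_less_le)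
  then have \<eta>: "0 < \<eta>" by (simp add: \<eta>_def)
  have \<eta>_less: "\<eta> < sd_coord p S" if "S \<in> ?C" for S
  proof -
    have "Min (sd_coord p ` ?C) \<le> sd_coord p S" using that dp(1) by auto
    then show ?thesis using \<eta> unfolding \<eta>_def by linarith
  qed
  define M where "M = k1 + k2"
  have M: "0 < M" "\<bar>c S\<bar> \<le> M" for S using k by (auto simp: M_def c_def)
  have shift: "y + \<alpha> *\<^sub>R u \<in> frontier P" "sd_coord (y + \<alpha> *\<^sub>R u) = (\<lambda>S. sd_coord y S + \<alpha> * c S)"
    if y: "y \<in> frontier P" "\<And>S. S \<in> ?C \<Longrightarrow> \<eta> < sd_coord y S" and \<alpha>: "\<bar>\<alpha>\<bar> * M \<le> \<eta>" for y \<alpha>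
  proof -
    have sub: "?C \<subseteq> {S. sd_coord y S \<noteq> 0}" using y(2) \<eta> by force
    have fy: "finite {S. sd_coord y S \<noteq> 0}" using chain_weightsD(1)[OF sd_weights[OF y(1)]] .
    have c0: "c S \<noteq> 0 \<Longrightarrow> S \<in> ?C" for S by (auto simp: c_def split: if_splits)
    have "sum c {S. sd_coord y S \<noteq> 0} = sum c ?C"
      by (rule sum.mono_neutral_right[OF fy sub]) (use c0 in auto)
    moreover have "(\<Sum>S | sd_coord y S \<noteq> 0. c S *\<^sub>R centroid b S) = u"
      unfolding u_def by (rule sum.mono_neutral_right[OF fy sub]) (use c0 in auto)
    moreover have "0 < sd_coord y S + \<alpha> * c S" if "sd_coord y S \<noteq> 0" for S
    proof (cases "S \<in> ?C")
      case True
      have "\<bar>\<alpha> * c S\<bar> \<le> \<bar>\<alpha>\<bar> * M" using M(2)[of S] by (simp add: abs_mult mult_left_mono)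
      then show ?thesis using y(2)[OF True] \<alpha> by linarith
    next
      case False
      then have "c S = 0" by (simp add: c_def)
      then show ?thesis using sd_coord_nonneg[OF y(1), of S] that by simp
    qed
    ultimately show "y + \<alpha> *\<^sub>R u \<in> frontier P" "sd_coord (y + \<alpha> *\<^sub>R u) = (\<lambda>S. sd_coord y S + \<alpha> * c S)"
      using sd_coord_shift[OF y(1), of c \<alpha>] c0 sub csum by auto
  qed
  \<comment> \<open>Small steps along \<open>u\<close> stay on the frontier while steps along
    \<open>w\<close> enter the interior. A factor \<kappa> = 0 is excluded since a step along
    \<open>u\<close> changes the coordinate of \<open>S1\<close>.\<close>
  have u: "u \<notin> span {w}"
  proof
    assume "u \<in> span {w}"
    then obtain \<kappa> where \<kappa>: "u = \<kappa> *\<^sub>R w" by (auto simp: span_singleton)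
    define a where "a = \<eta> / M"
    have a: "0 < a" "\<bar>a\<bar> * M \<le> \<eta>" "\<bar>- a\<bar> * M \<le> \<eta>" using \<eta> M by (auto simp: a_def)
    note sh = shift[OF p \<eta>_less a(2)]
    have "c S1 \<noteq> 0" using S1 m k by (auto simp: c_def)
    then have "p + a *\<^sub>R u \<noteq> p" using sh(2) a(1) by (auto dest: fun_cong[of _ _ S1])
    then have "\<kappa> \<noteq> 0" using \<kappa> by auto
    define e where "e = min 1 (a * \<bar>\<kappa>\<bar>)"
    have e: "0 < e" "e \<le> 1" using a \<open>\<kappa> \<noteq> 0\<close> by (auto simp: e_def)
    have "\<bar>e / \<kappa>\<bar> * M \<le> \<eta>"
    proof -
      have "\<bar>e / \<kappa>\<bar> \<le> a" using e \<open>\<kappa> \<noteq> 0\<close> by (simp add: e_def field_simps)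
      then show ?thesis using a M by (smt (verit) mult_right_mono)
    qed
    from shift(1)[OF p \<eta>_less this] have "p + e *\<^sub>R w \<in> frontier P" using \<kappa> \<open>\<kappa> \<noteq> 0\<close> by simp
    from transverse[OF p q this p _ e] show False using q(2) by (simp add: w_def)
  qed
  obtain l :: "real ^ 5 \<Rightarrow> real ^ 4" and g g' :: "real ^ 5 \<Rightarrow> real" where L: "linear l \<and> linear g \<and> linear g' \<and>
      g u = 1 \<and> g w = 0 \<and> g' u = 0 \<and> g' w = 1 \<and> l u = axis 1 1 \<and>
      (\<forall>x s. l x = s *\<^sub>R axis 1 1 \<longrightarrow> x = s *\<^sub>R u + g' x *\<^sub>R w)"
    using exists_projection_along[OF w0 u] by (elim exE) (rule that)
  have l: "linear l" "linear g" "linear g'" "g u = 1" "g w = 0" "g' u = 0" "g' w = 1" "l u = axis 1 1"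
    "\<forall>x s. l x = s *\<^sub>R axis 1 1 \<longrightarrow> x = s *\<^sub>R u + g' x *\<^sub>R w"
    using L by simp_all
  have contl: "continuous_on A l" "continuous_on A g'" "continuous_on A g" for A
    using l by (auto intro: linear_continuous_on linear_conv_bounded_linear[THEN iffD1])
  have contg: "continuous_on A (\<lambda>y. g (y - p))" "continuous_on A (\<lambda>y. g' (y - p))" "continuous_on A (\<lambda>y. l (y - p))" for A
    by (intro continuous_on_compose2[OF contl(3)[of UNIV]] continuous_on_compose2[OF contl(2)[of UNIV]]
        continuous_on_compose2[OF contl(1)[of UNIV]] continuous_intros; auto)+
  define f where "f y = inner_coord y - outer_coord y" for y
  have contf: "continuous_on (frontier P) f"
    unfolding f_def by (intro continuous_intros continuous_inner_coord continuous_outer_coord)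
  define h where "h y = (\<chi> i. if i = 1 then f y else l (y - p) $ i)" for y
  have conth: "continuous_on (frontier P) h"
    unfolding h_def
  proof (rule continuous_on_vec_lambda)
    fix i :: 4
    show "continuous_on (frontier P) (\<lambda>y. if i = 1 then f y else l (y - p) $ i)"
      using contf contg(3)[of "frontier P"] by (cases "i = 1") (auto intro: continuous_intros)
  qed
  \<comment> \<open>Two values below \<tau> differ by less than both the bound \<eta> / M needed for
    \<open>shift\<close> and the bound 1 of \<open>transverse\<close>.\<close>
  define \<tau> where "\<tau> = min (1 / 2) (\<eta> / (2 * M))"
  have \<tau>: "0 < \<tau>" using \<eta> M by (auto simp: \<tau>_def)
  \<comment> \<open>Coordinates off the chain of \<open>p\<close> stay below m / 2 and both maxima
    stay above it. So the maxima are attained on the chain, where \<open>c\<close> is positive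
    inside \<D> and negative outside.\<close>
  define U where "U = {y \<in> frontier P. dist y p < r / 2} \<inter> {y \<in> frontier P. m / 2 < inner_coord y} \<inter>
     {y \<in> frontier P. m / 2 < outer_coord y} \<inter> {y \<in> frontier P. \<bar>g' (y - p)\<bar> < \<tau>} \<inter>
     {y \<in> frontier P. \<bar>g (y - p)\<bar> < min \<tau> (r / (4 * (1 + norm u)))} \<inter>
     (\<Inter>S\<in>?C. {y \<in> frontier P. \<eta> < sd_coord y S}) \<inter>
     (\<Inter>S\<in>\<K> - ?C. {y \<in> frontier P. sd_coord y S < m / 2})"
  have "openin (top_of_set (frontier P)) U"
    unfolding U_def
    by (intro openin_Int openin_INT2 openin_Collect_less continuous_intros continuous_inner_coord
       continuous_outer_coord contg continuous_sd_coord)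
      (use dp(1,6) finite_complex empty_in subcomplex sd_coord_outside[OF p, of "{}"] in auto)
  have U: "y \<in> frontier P" "dist y p < r / 2" "m / 2 < inner_coord y" "m / 2 < outer_coord y"
    "\<bar>g' (y - p)\<bar> < \<tau>" "\<bar>g (y - p)\<bar> < \<tau>" "\<bar>g (y - p)\<bar> < r / (4 * (1 + norm u))"
    "\<And>S. S \<in> ?C \<Longrightarrow> \<eta> < sd_coord y S" "\<And>S. S \<in> \<K> \<Longrightarrow> S \<notin> ?C \<Longrightarrow> sd_coord y S < m / 2"
    if "y \<in> U" for y
    using that by (auto simp: U_def)
  have f_less: "f y' < f y"
    if y: "y \<in> U" "y' \<in> U" and s: "sd_coord y = (\<lambda>S. sd_coord y' S + s * c S)" "0 < s" for y y' s
  proof -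
    obtain S where S: "S \<in> \<D> - {{}}" "inner_coord y' = sd_coord y' S" using inner_coord_attained by blast
    have SC: "S \<in> ?C"
    proof (rule ccontr)
      assume "S \<notin> ?C"
      then have "sd_coord y' S < m / 2" using U(9)[OF y(2), of S] S subcomplex by auto
      then show False using U(3)[OF y(2)] S by simp
    qed
    have "inner_coord y' < sd_coord y S" using S SC k s by (simp add: c_def)
    also have "\<dots> \<le> inner_coord y" using sd_coord_le_inner S by auto
    finally have 1: "inner_coord y' < inner_coord y" .
    obtain T where T: "T \<in> \<K> - \<D>" "outer_coord y = sd_coord y T" using outer_coord_attained by blast
    have TC: "T \<in> ?C"
    proof (rule ccontr)
      assume "T \<notin> ?C"
      then have "sd_coord y T < m / 2" using U(9)[OF y(1), of T] T by auto
      then show False using U(4)[OF y(1)] T by simp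
    qed
    have "outer_coord y < sd_coord y' T" using T TC k s by (simp add: c_def)
    also have "\<dots> \<le> outer_coord y'" using sd_coord_le_outer T by auto
    finally show ?thesis using 1 by (simp add: f_def)
  qed
  have no_pos: False
    if y: "y \<in> U" "y' \<in> U" and e: "y = y' + s *\<^sub>R u + \<beta> *\<^sub>R w"
      and s: "\<bar>s\<bar> * M \<le> \<eta>" "\<bar>s\<bar> * norm u < r / 2" and \<beta>: "0 < \<beta>" "\<beta> \<le> 1" for y y' s \<beta>
  proof -
    have sh: "y' + s *\<^sub>R u \<in> frontier P" by (rule shift(1)[OF U(1,8)[OF y(2)] s(1)])
    have "dist (y' + s *\<^sub>R u) p \<le> dist y' p + \<bar>s\<bar> * norm u"
      using norm_triangle_ineq[of "y' - p" "s *\<^sub>R u"] by (simp add: dist_norm algebra_simps)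
    then have "dist (y' + s *\<^sub>R u) p < r" using U(2)[OF y(2)] s(2) by linarith
    then show False using transverse[OF p q U(1)[OF y(1)] sh _ \<beta>] e by (simp add: w_def)
  qed
  have "inj_on h U"
  proof (rule inj_onI, rule ccontr)
    fix y y' assume y: "y \<in> U" "y' \<in> U" "h y = h y'" "y \<noteq> y'"
    have f: "f y = f y'" using arg_cong[OF y(3), of "\<lambda>x. x $ 1"] by (simp add: h_def)
    have "l (y - y') = (l (y - y') $ 1) *\<^sub>R axis 1 1"
    proof -
      have "l (y - y') = l (y - p) - l (y' - p)" using linear_diff[OF l(1), of "y - p" "y' - p"] by simp
      moreover have "l (y - p) $ i = l (y' - p) $ i" if "i \<noteq> 1" for i
        using arg_cong[OF y(3), of "\<lambda>x. x $ i"] that by (simp add: h_def)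
      ultimately show ?thesis by (auto simp: vec_eq_iff axis_def)
    qed
    then obtain s where ls: "l (y - y') = s *\<^sub>R axis 1 1" by blast
    define \<beta> where "\<beta> = g' (y - y')"
    have d: "y - y' = s *\<^sub>R u + \<beta> *\<^sub>R w" using l(9)[rule_format, OF ls] by (simp add: \<beta>_def)
    have "g (y - y') = s"
      unfolding d by (simp add: linear_add[OF l(2)] linear_cmul[OF l(2)] l)
    moreover have "g (y - y') = g (y - p) - g (y' - p)"
      using linear_diff[OF l(2), of "y - p" "y' - p"] by simp
    ultimately have "\<bar>s\<bar> \<le> 2 * \<tau>" "\<bar>s\<bar> < 2 * (r / (4 * (1 + norm u)))"
      using U(6,7)[OF y(1)] U(6,7)[OF y(2)] by linarith+
    moreover have "2 * (r / (4 * x)) = r / (2 * x)" for x :: real by simp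
    ultimately have sg: "\<bar>s\<bar> \<le> 2 * \<tau>" "\<bar>s\<bar> < r / (2 * (1 + norm u))" by (simp_all only:)
    have s1: "\<bar>s\<bar> * M \<le> \<eta>"
    proof -
      have "\<bar>s\<bar> \<le> \<eta> / M" using sg(1) by (simp add: \<tau>_def)
      then show ?thesis using M by (simp add: field_simps)
    qed
    have s2: "\<bar>s\<bar> * norm u < r / 2"
    proof -
      have "\<bar>s\<bar> * norm u \<le> \<bar>s\<bar> * (1 + norm u)" by (intro mult_left_mono) auto
      also have "\<dots> < r / (2 * (1 + norm u)) * (1 + norm u)"
        using sg(2) by (intro mult_strict_right_mono) (auto simp: add_pos_nonneg)
      also have "\<dots> = r / 2"
      proof -
        have "r / (2 * x) * x = r / 2" if "x \<noteq> 0" for x :: real using that by simp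
        moreover have "1 + norm u \<noteq> 0" using norm_ge_zero[of u] by linarith
        ultimately show ?thesis by blast
      qed
      finally show ?thesis .
    qed
    have "g' (y - y') = g' (y - p) - g' (y' - p)"
      using linear_diff[OF l(3), of "y - p" "y' - p"] by simp
    then have b: "\<bar>\<beta>\<bar> \<le> 1" using U(5)[OF y(1)] U(5)[OF y(2)] unfolding \<beta>_def \<tau>_def by linarith
    have e: "y = y' + s *\<^sub>R u + \<beta> *\<^sub>R w" "y' = y + (- s) *\<^sub>R u + (- \<beta>) *\<^sub>R w"
      using d by (simp_all add: algebra_simps)
    have "\<beta> = 0"
      using no_pos[OF y(1,2) e(1) s1 s2] no_pos[OF y(2,1) e(2)] s1 s2 b by fastforce
    then have e': "y = y' + s *\<^sub>R u" using e by simp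
    have s0: "s \<noteq> 0" using e' y(4) by auto
    have sd: "sd_coord y = (\<lambda>S. sd_coord y' S + s * c S)"
      unfolding e' by (rule shift(2)[OF U(1,8)[OF y(2)] s1])
    show False
    proof (cases "0 < s")
      case True
      then show False using f_less[OF y(1,2) sd] f by simp
    next
      case False
      have "sd_coord y' = (\<lambda>S. sd_coord y S + (- s) * c S)" unfolding sd by simp
      then show False using f_less[OF y(2,1)] f False s0 by fastforce
    qed
  qed
  moreover have "continuous_on U h" using conth by (rule continuous_on_subset) (use U in blast)
  ultimately have "chart4 nbhd (U \<inter> nbhd) h"
    using \<open>openin (top_of_set (frontier P)) U\<close> U(1)
    by (intro chart4_of_injective) (auto simp: nbhd_def h_def f_def)
  moreover have "p \<in> U \<inter> nbhd"
    unfolding U_def nbhd_def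
    using p q m \<tau> \<eta>_less eq m_def linear_0[OF l(2)] linear_0[OF l(3)] by (auto intro!: divide_pos_pos add_pos_nonneg)
  moreover have "h p $ 1 = 0" using eq by (simp add: h_def f_def)
  ultimately show ?thesis by blast
qed

lemma four_manifold_nbhd: "four_manifold_with_boundary nbhd"
  unfolding four_manifold_with_boundary_def
proof
  fix p assume "p \<in> nbhd"
  then have "p \<in> level \<or> p \<in> frontier P \<and> outer_coord p < inner_coord p"
    by (auto simp: nbhd_def level_def)
  then show "\<exists>U h. p \<in> U \<and> chart4 nbhd U h" using interior_chart level_chart by blast
qed

section \<open>The boundary and the comparison with a ball\<close>

lemma openin_nbhd_interior:
  "openin (top_of_set (frontier P)) {p \<in> frontier P. outer_coord p < inner_coord p}"
  by (rule openin_Collect_less[OF continuous_outer_coord continuous_inner_coord])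

text \<open>A point off the level set has a neighborhood in \<open>nbhd\<close> that is open in the
  frontier, so invariance of domain applies around it.\<close>

lemma interior_image:
  fixes h :: "real ^ 5 \<Rightarrow> real ^ 4"
  assumes U: "openin (top_of_set nbhd) U" and h: "continuous_on U h" "inj_on h U"
    and p: "p \<in> U" "p \<notin> level"
  shows "h p \<in> interior (h ` U)"
proof -
  let ?I = "{p \<in> frontier P. outer_coord p < inner_coord p}"
  have "?I \<subseteq> nbhd" by (auto simp: nbhd_def)
  obtain W where W: "open W" "U = nbhd \<inter> W" using U by (auto simp: openin_open)
  have "U \<inter> ?I = ?I \<inter> W" using W(2) \<open>?I \<subseteq> nbhd\<close> by blast
  then have "openin (top_of_set (frontier P)) (U \<inter> ?I)"
    using openin_Int_open[OF openin_nbhd_interior W(1)] by simp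
  then have "open (h ` (U \<inter> ?I))"
    by (rule open_image_chart) (use h in \<open>auto intro: continuous_on_subset inj_on_subset\<close>)
  moreover have "p \<in> U \<inter> ?I" using p W(2) by (auto simp: nbhd_def level_def)
  ultimately show ?thesis by (meson image_eqI image_mono inf_le1 interiorI)
qed

text \<open>A chart that sends a point off the level set to the hyperplane would have an image
  containing a full ball around a point of the hyperplane, which leaves the half-space.\<close>

lemma boundary_nbhd: "four_manifold_boundary nbhd = level"
proof (intro set_eqI iffI)
  fix p assume "p \<in> level"
  then show "p \<in> four_manifold_boundary nbhd"
    using level_chart unfolding four_manifold_boundary_def by (auto simp: level_def nbhd_def)
next
  fix p assume "p \<in> four_manifold_boundary nbhd"
  then obtain U h where U: "p \<in> U" "chart4 nbhd U h" "h p $ 1 = 0"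
    unfolding four_manifold_boundary_def by auto
  then obtain V k where V: "openin (top_of_set nbhd) U" "openin (top_of_set half_space4) V" "homeomorphism U V h k"
    unfolding chart4_def by blast
  show "p \<in> level"
  proof (rule ccontr)
    assume "p \<notin> level"
    have "inj_on h U" using V(3) by (rule homeomorphism_inj_on)
    then have "h p \<in> interior (h ` U)"
      using interior_image[OF V(1) homeomorphism_cont1[OF V(3)] _ U(1) \<open>p \<notin> level\<close>] by blast
    then obtain e where e: "0 < e" "ball (h p) e \<subseteq> h ` U" by (auto simp: mem_interior)
    let ?z = "h p - (e / 2) *\<^sub>R axis 1 1"
    have "?z \<in> ball (h p) e" using e(1) by (simp add: dist_norm)
    moreover have "h ` U \<subseteq> half_space4"
      using V(2,3) openin_imp_subset by (metis homeomorphism_image1)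
    ultimately have "?z \<in> half_space4" using e(2) by blast
    then show False using U(3) e(1) by (simp add: half_space4_def)
  qed
qed

text \<open>A homeomorphism onto the ball would carry the level set onto the sphere. Points off the
  level set go to the open ball by invariance of domain. A point of the level set going to the open
  ball would yield, through its half-space chart, an open subset of \<open>real ^ 4\<close> that
  lies in the half-space and touches the hyperplane.\<close>

lemma not_ball:
  assumes "\<not> level homeomorphic sphere (0 :: real ^ 4) 1"
  shows "\<not> nbhd homeomorphic cball (0 :: real ^ 4) 1"
proof
  assume "nbhd homeomorphic cball (0 :: real ^ 4) 1"
  then obtain \<phi> \<psi> where \<phi>: "homeomorphism nbhd (cball (0 :: real ^ 4) 1) \<phi> \<psi>" unfolding homeomorphic_def by blast
  have inj: "inj_on \<phi> nbhd" using \<phi> by (rule homeomorphism_inj_on)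
  have img: "\<phi> ` nbhd = cball 0 1" using \<phi> by (simp add: homeomorphism_image1)
  have "\<phi> p \<in> ball 0 1" if "p \<in> nbhd" "p \<notin> level" for p
    using interior_image[OF openin_subtopology_self homeomorphism_cont1[OF \<phi>] inj that]
    by (simp add: img)
  moreover have "\<phi> p \<in> sphere 0 1" if p: "p \<in> level" for p
  proof (rule ccontr)
    obtain U h where U: "p \<in> U" "chart4 nbhd U h" "h p $ 1 = 0" using level_chart[OF p] by blast
    then obtain V k where V: "openin (top_of_set nbhd) U" "openin (top_of_set half_space4) V" "homeomorphism U V h k"
      unfolding chart4_def by blast
    have pn: "p \<in> nbhd" using p by (auto simp: level_def nbhd_def)
    assume "\<phi> p \<notin> sphere 0 1"
    moreover have "\<phi> p \<in> cball 0 1" using pn img by blast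
    ultimately have pb: "\<phi> p \<in> ball 0 1" by auto
    obtain W where W: "open W" "U = nbhd \<inter> W" using V(1) by (auto simp: openin_open)
    have "openin (top_of_set (cball 0 1)) (\<phi> ` U)"
      using homeomorphism_imp_open_map[OF \<phi> V(1)] .
    then obtain W' where W': "open W'" "\<phi> ` U = cball 0 1 \<inter> W'" by (auto simp: openin_open)
    let ?B = "ball 0 1 \<inter> W'"
    have B: "open ?B" "\<phi> p \<in> ?B" "?B \<subseteq> \<phi> ` U" using W' pb U(1) by auto
    have psi: "\<psi> z \<in> U" "\<phi> (\<psi> z) = z" if z: "z \<in> ?B" for z
    proof -
      obtain y where "y \<in> U" "z = \<phi> y" using B(3) z by blast
      then show "\<psi> z \<in> U" "\<phi> (\<psi> z) = z"
        using homeomorphism_apply1[OF \<phi>, of y] openin_imp_subset[OF V(1)] by auto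
    qed
    have sub: "?B \<subseteq> cball 0 1" by auto
    have cont: "continuous_on ?B (h \<circ> \<psi>)"
      by (rule continuous_on_compose[OF continuous_on_subset[OF homeomorphism_cont2[OF \<phi>] sub]
            continuous_on_subset[OF homeomorphism_cont1[OF V(3)]]]) (use psi in auto)
    have "inj_on (h \<circ> \<psi>) ?B"
    proof (rule inj_onI)
      fix x y assume xy: "x \<in> ?B" "y \<in> ?B" "(h \<circ> \<psi>) x = (h \<circ> \<psi>) y"
      then have "\<psi> x = \<psi> y" using homeomorphism_apply1[OF V(3)] psi(1) by (metis comp_apply)
      then show "x = y" using psi(2) xy by metis
    qed
    then have "open ((h \<circ> \<psi>) ` ?B)" using invariance_of_domain[OF cont B(1)] by blast
    moreover have "h p \<in> (h \<circ> \<psi>) ` ?B"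
      using B(2) homeomorphism_apply1[OF \<phi> pn] by (metis comp_apply image_eqI)
    ultimately obtain e where e: "0 < e" "ball (h p) e \<subseteq> (h \<circ> \<psi>) ` ?B" by (meson open_contains_ball)
    let ?z = "h p - (e / 2) *\<^sub>R axis 1 1"
    have "?z \<in> ball (h p) e" using e(1) by (simp add: dist_norm)
    moreover have "(h \<circ> \<psi>) ` ?B \<subseteq> half_space4"
    proof -
      have "h ` U \<subseteq> half_space4" using V(2,3) openin_imp_subset by (metis homeomorphism_image1)
      then show ?thesis using psi(1) by auto
    qed
    ultimately have "?z \<in> half_space4" using e(2) by blast
    then show False using U(3) e(1) by (simp add: half_space4_def)
  qed
  ultimately have "\<phi> ` level = sphere 0 1"
  proof -
    assume a: "\<And>p. p \<in> nbhd \<Longrightarrow> p \<notin> level \<Longrightarrow> \<phi> p \<in> ball 0 1" and b: "\<And>p. p \<in> level \<Longrightarrow> \<phi> p \<in> sphere 0 1"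
    have "z \<in> \<phi> ` level" if z: "z \<in> sphere 0 1" for z
    proof -
      have "z \<in> \<phi> ` nbhd" using z img by auto
      then obtain p where "p \<in> nbhd" "z = \<phi> p" by blast
      then show ?thesis using a[of p] z by fastforce
    qed
    then show ?thesis using b by blast
  qed
  then have "homeomorphism level (sphere 0 1) \<phi> \<psi>"
    by (intro homeomorphism_of_subsets[OF \<phi>]) (auto simp: level_def nbhd_def)
  then show False using assms unfolding homeomorphic_def by blast
qed

text \<open>The neighborhood is pushed onto the subcomplex along straight lines, which lie in simplices
  of the subdivision.\<close>

lemma contractible_nbhd:
  assumes "contractible (realization b \<D>)"
  shows "contractible nbhd"
proof -
  let ?D = "\<D> - {{}}"
  \<comment> \<open>The total inner weight: \<rho> p drops the outer coordinates of \<open>p\<close>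
    and renormalizes by \<open>d p\<close>, and \<open>r p\<close> is the resulting point.\<close>
  define d where "d p = (\<Sum>S\<in>?D. sd_coord p S)" for p
  define \<rho> where "\<rho> p S = (if S \<in> ?D then sd_coord p S / d p else 0)" for p S
  define r where "r p = (\<Sum>S\<in>?D. (sd_coord p S / d p) *\<^sub>R centroid b S)" for p
  have nb: "nbhd \<subseteq> frontier P" by (auto simp: nbhd_def)
  have d: "0 < d p" if "p \<in> nbhd" for p
  proof -
    obtain S where "S \<in> ?D" "inner_coord p = sd_coord p S" using inner_coord_attained by blast
    then show ?thesis
      unfolding d_def using inner_coord_pos[OF that] sd_coord_nonneg that nb fin
      by (intro sum_pos2[of _ S]) auto
  qed
  have \<rho>: "\<rho> p \<in> weights (chains \<K>)" and r\<rho>: "bary_point (centroid b) (\<rho> p) = r p" if p: "p \<in> nbhd" for p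
  proof -
    have pf: "p \<in> frontier P" using p nb by auto
    have supp: "\<rho> p S \<noteq> 0 \<Longrightarrow> S \<in> ?D \<and> sd_coord p S \<noteq> 0" for S by (auto simp: \<rho>_def split: if_splits)
    have "{S. \<rho> p S \<noteq> 0} \<subseteq> {S. sd_coord p S \<noteq> 0}" using supp by auto
    moreover have "{S. sd_coord p S \<noteq> 0} \<in> chains \<K>" using sd_weights[OF pf] by (auto simp: weights_def)
    ultimately have "{S. \<rho> p S \<noteq> 0} \<in> chains \<K>" using chains_subset by blast
    moreover have "0 \<le> \<rho> p S" for S using d[OF p] sd_coord_nonneg[OF pf] by (auto simp: \<rho>_def)
    moreover have "(\<Sum>S | \<rho> p S \<noteq> 0. \<rho> p S) = 1"
    proof -
      have "(\<Sum>S | \<rho> p S \<noteq> 0. \<rho> p S) = (\<Sum>S\<in>?D. sd_coord p S / d p)"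
        by (rule sum.mono_neutral_cong_left) (use fin supp in \<open>auto simp: \<rho>_def\<close>)
      then show ?thesis using d[OF p] by (simp add: sum_divide_distrib[symmetric] d_def)
    qed
    ultimately show "\<rho> p \<in> weights (chains \<K>)" by (simp add: weights_def)
    have "bary_point (centroid b) (\<rho> p) = (\<Sum>S\<in>?D. \<rho> p S *\<^sub>R centroid b S)"
      by (rule bary_point_superset) (use fin supp in auto)
    then show "bary_point (centroid b) (\<rho> p) = r p" by (simp add: r_def \<rho>_def)
  qed
  have rD: "r p \<in> realization b \<D>" if p: "p \<in> nbhd" for p
  proof -
    have rf: "r p \<in> frontier P" "sd_coord (r p) = \<rho> p" using sd_point_weights[OF \<rho>[OF p]] r\<rho>[OF p] by auto
    define T where "T = \<Union>{S. \<rho> p S \<noteq> 0}"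
    have "T \<in> {S. \<rho> p S \<noteq> 0}"
      unfolding T_def using chain_weightsD[OF \<rho>[OF p]] by (intro chain_Union_in) auto
    then have "T \<in> \<D>" by (auto simp: \<rho>_def split: if_splits)
    then show ?thesis
      using realization_D coord_support_sd[of "r p"] rf frontier_P
      by (simp add: T_def)
  qed
  have Dn: "realization b \<D> \<subseteq> nbhd"
  proof
    fix p assume "p \<in> realization b \<D>"
    then have p: "p \<in> frontier P" "{v. coord p v \<noteq> 0} \<in> \<D>"
      using realization_D frontier_P by auto
    have "outer_coord p = 0"
    proof -
      obtain S where S: "S \<in> \<K> - \<D>" "outer_coord p = sd_coord p S" using outer_coord_attained by blast
      have "sd_coord p S = 0"
      proof (rule ccontr)
        assume "sd_coord p S \<noteq> 0"
        then have "S \<subseteq> {v. coord p v \<noteq> 0}" using coord_support_sd[of p] p(1) frontier_P by auto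
        then show False using p(2) subcomplex_closed S by auto
      qed
      then show ?thesis using S by simp
    qed
    then show "p \<in> nbhd" using p(1) inner_coord_nonneg by (simp add: nbhd_def)
  qed
  have contr: "continuous_on nbhd r"
  proof -
    have "continuous_on nbhd d"
      unfolding d_def by (intro continuous_on_sum continuous_on_subset[OF continuous_sd_coord nb])
    moreover have "\<forall>p\<in>nbhd. d p \<noteq> 0" using d by force
    ultimately show ?thesis
      unfolding r_def by (intro continuous_on_sum continuous_on_scaleR continuous_on_divide
          continuous_on_const continuous_on_subset[OF continuous_sd_coord nb])
  qed
  have seg: "closed_segment p (r p) \<subseteq> nbhd" if p: "p \<in> nbhd" for p
  proof
    fix z assume "z \<in> closed_segment p (r p)"
    then obtain s where s: "0 \<le> s" "s \<le> 1" "z = (1 - s) *\<^sub>R p + s *\<^sub>R r p" by (auto simp: in_segment)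
    have pf: "p \<in> frontier P" using p nb by auto
    let ?w = "\<lambda>S. (1 - s) * sd_coord p S + s * \<rho> p S"
    have supp: "\<rho> p S \<noteq> 0 \<Longrightarrow> sd_coord p S \<noteq> 0" for S by (auto simp: \<rho>_def split: if_splits)
    have sub: "{S. ?w S \<noteq> 0} \<subseteq> {S. sd_coord p S \<noteq> 0}" using supp by auto
    have finp: "finite {S. sd_coord p S \<noteq> 0}" using chain_weightsD(1)[OF sd_weights[OF pf]] .
    have "?w \<in> weights (chains \<K>)"
    proof -
      have "{S. sd_coord p S \<noteq> 0} \<in> chains \<K>" using sd_weights[OF pf] by (auto simp: weights_def)
      then have "{S. ?w S \<noteq> 0} \<in> chains \<K>" using sub chains_subset by blast
      moreover have "0 \<le> ?w S" for S
        using s sd_coord_nonneg[OF pf] chain_weightsD(2)[OF \<rho>[OF p]] by auto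
      moreover have "(\<Sum>S | ?w S \<noteq> 0. ?w S) = 1"
      proof -
        have "(\<Sum>S | ?w S \<noteq> 0. ?w S) = (\<Sum>S | sd_coord p S \<noteq> 0. ?w S)"
          by (rule sum.mono_neutral_left[OF finp sub]) auto
        also have "\<dots> = (1 - s) * 1 + s * 1"
          using weights_sum_superset[OF sd_weights[OF pf] finp] weights_sum_superset[OF \<rho>[OF p] finp] supp
          by (simp add: sum.distrib sum_distrib_left[symmetric])
        finally show ?thesis by simp
      qed
      ultimately show ?thesis by (simp add: weights_def)
    qed
    moreover have "bary_point (centroid b) ?w = z"
    proof -
      have "bary_point (centroid b) ?w = (\<Sum>S | sd_coord p S \<noteq> 0. ?w S *\<^sub>R centroid b S)"
        by (rule bary_point_superset[OF finp]) (use sub in auto)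
      also have "\<dots> = (1 - s) *\<^sub>R (\<Sum>S | sd_coord p S \<noteq> 0. sd_coord p S *\<^sub>R centroid b S)
          + s *\<^sub>R (\<Sum>S | sd_coord p S \<noteq> 0. \<rho> p S *\<^sub>R centroid b S)"
        by (simp add: scaleR_add_left sum.distrib scaleR_sum_right)
      also have "(\<Sum>S | sd_coord p S \<noteq> 0. \<rho> p S *\<^sub>R centroid b S) = bary_point (centroid b) (\<rho> p)"
        by (rule bary_point_superset[OF finp, symmetric]) (use supp in auto)
      finally show ?thesis using sd_point[OF pf] r\<rho>[OF p] s(3) by (simp add: bary_point_def)
    qed
    ultimately have z: "z \<in> frontier P" "sd_coord z = ?w" using sd_point_weights[of ?w] by auto
    obtain S where S: "S \<in> ?D" "inner_coord p = sd_coord p S" using inner_coord_attained by blast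
    obtain T where T: "T \<in> \<K> - \<D>" "outer_coord z = sd_coord z T" using outer_coord_attained by blast
    have "d p \<le> 1"
    proof -
      have "d p \<le> sum (sd_coord p) (\<K> - {{}})"
        unfolding d_def using finite_complex sd_coord_nonneg[OF pf] subcomplex by (intro sum_mono2) auto
      also have "\<dots> = 1"
        by (rule weights_sum_superset[OF sd_weights[OF pf]]) (use finite_complex sd_coord_outside[OF pf] in auto)
      finally show ?thesis .
    qed
    \<comment> \<open>Renormalizing divides by \<open>d p \<le> 1\<close>, so along the segment
      inner coordinates do not decrease and outer ones do not increase. The inequality between the
      maxima persists.\<close>
    then have "sd_coord p S \<le> \<rho> p S"
      using S d[OF p] sd_coord_nonneg[OF pf, of S] mult_left_le_one_le[of "sd_coord p S" "d p"]
      by (simp add: \<rho>_def field_simps)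
    have "outer_coord z = (1 - s) * sd_coord p T" using T z(2) by (simp add: \<rho>_def)
    also have "\<dots> \<le> sd_coord p T" using s sd_coord_nonneg[OF pf] by (simp add: mult_left_le_one_le)
    also have "\<dots> \<le> outer_coord p" using T sd_coord_le_outer by auto
    also have "\<dots> \<le> sd_coord p S" using p S by (simp add: nbhd_def)
    also have "\<dots> = (1 - s) * sd_coord p S + s * sd_coord p S" by (simp add: algebra_simps)
    also have "\<dots> \<le> sd_coord z S" using \<open>sd_coord p S \<le> \<rho> p S\<close> s z(2) by (simp add: mult_left_mono)
    also have "\<dots> \<le> inner_coord z" using S sd_coord_le_inner by auto
    finally show "z \<in> nbhd" using z(1) by (simp add: nbhd_def)
  qed
  have hom: "homotopic_with_canon (\<lambda>_. True) nbhd nbhd id r"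
    by (rule homotopic_with_linear) (use contr seg in auto)
  \<comment> \<open>The identity is homotopic to \<open>r\<close>, and \<open>r\<close> factors
    through the contractible subcomplex.\<close>
  obtain c where "homotopic_with_canon (\<lambda>_. True) nbhd nbhd ((\<lambda>x. x) \<circ> r) (\<lambda>x. c)"
    by (rule nullhomotopic_through_contractible[OF contr _ continuous_on_id _ assms, of nbhd])
      (use rD Dn in auto)
  then have "homotopic_with_canon (\<lambda>_. True) nbhd nbhd id (\<lambda>x. c)"
    using homotopic_with_trans[OF hom] by (simp add: o_def)
  then show ?thesis unfolding contractible_def by blast
qed

end

section \<open>Covering arguments on the 3-sphere\<close>

text \<open>Linearly independent vectors with continuous coordinate functionals. They separate the sheets
  of a covering space.\<close>

definition unit_bcontfun :: "nat \<Rightarrow> nat \<Rightarrow>\<^sub>C real"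
  where "unit_bcontfun k = Bcontfun (\<lambda>n. if n = k then 1 else 0)"

lemma apply_unit_bcontfun: "apply_bcontfun (unit_bcontfun k) n = (if n = k then 1 else 0)"
proof -
  have "(\<lambda>n. if n = k then 1 else (0::real)) \<in> bcontfun"
    by (rule bcontfun_normI[where b = 1]) auto
  then show ?thesis by (simp add: unit_bcontfun_def Bcontfun_inverse)
qed

lemma norm_unit_bcontfun: "norm (unit_bcontfun k) \<le> 1"
  by (rule norm_bound) (simp add: apply_unit_bcontfun)

lemma bounded_linear_apply_bcontfun:
  "bounded_linear (\<lambda>f :: 'a::topological_space \<Rightarrow>\<^sub>C real. apply_bcontfun f x)"
proof (rule bounded_linear_intro[where K = 1])
  show "norm (apply_bcontfun f x) \<le> norm f * 1" for f :: "'a \<Rightarrow>\<^sub>C real"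
    using norm_bounded[of f x] by simp
qed auto

lemma apply_bcontfun_sum: "apply_bcontfun (sum f A) x = (\<Sum>i\<in>A. apply_bcontfun (f i) x :: real)"
  by (rule linear_sum[OF bounded_linear.linear[OF bounded_linear_apply_bcontfun]])

text \<open>A locally constant system of \<open>n\<close> sheets is described by charts, the open sets where a weight is
  positive, and by transition functions between the sheets over some pairs of charts.\<close>

locale local_system =
  fixes X :: "'a::real_normed_vector set" and I :: "'c::countable set" and wt :: "'c \<Rightarrow> 'a \<Rightarrow> real"
    and n :: nat and R :: "('c \<times> 'c) set" and g :: "'c \<Rightarrow> 'c \<Rightarrow> nat \<Rightarrow> nat"
  assumes finite_charts: "finite I"
    and continuous_wt: "p \<in> I \<Longrightarrow> continuous_on X (wt p)"
    and wt_nonneg: "p \<in> I \<Longrightarrow> y \<in> X \<Longrightarrow> 0 \<le> wt p y"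
    and wt_cover: "y \<in> X \<Longrightarrow> \<exists>p\<in>I. 0 < wt p y"
begin

definition charts_at :: "'a \<Rightarrow> 'c set"
  where "charts_at y = {p \<in> I. 0 < wt p y}"

definition consistent :: "'a \<Rightarrow> ('c \<Rightarrow> nat) \<Rightarrow> bool"
  where "consistent y f \<longleftrightarrow> (\<forall>p\<in>charts_at y. f p < n) \<and>
    (\<forall>p\<in>charts_at y. \<forall>q\<in>charts_at y. (p, q) \<in> R \<longrightarrow> f q = g p q (f p))"

text \<open>A continuous encoding of a choice of sheets: the coordinate numbered
  \<open>to_nat (p, a)\<close> is \<open>wt p y\<close> if \<open>a\<close> is the sheet over
  \<open>p\<close>, and 0 otherwise. As a weight tends to 0 where its chart ends, charts appear and
  disappear without a jump, and the total space can carry the subspace topology of a normed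
  space.\<close>

definition lift :: "'a \<Rightarrow> ('c \<Rightarrow> nat) \<Rightarrow> nat \<Rightarrow>\<^sub>C real"
  where "lift y f = (\<Sum>p\<in>I. wt p y *\<^sub>R unit_bcontfun (to_nat (p, f p)))"

lemma apply_lift:
  assumes "p \<in> I"
  shows "apply_bcontfun (lift y f) (to_nat (p, a)) = (if f p = a then wt p y else 0)"
proof -
  have "apply_bcontfun (lift y f) (to_nat (p, a)) = (\<Sum>q\<in>I. if q = p then if f p = a then wt p y else 0 else 0)"
    unfolding lift_def apply_bcontfun_sum
    by (rule sum.cong) (auto simp: apply_unit_bcontfun)
  then show ?thesis using assms finite_charts by simp
qed

lemma lift_cong: "y \<in> X \<Longrightarrow> (\<And>p. p \<in> charts_at y \<Longrightarrow> f p = f' p) \<Longrightarrow> lift y f = lift y f'"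
  unfolding lift_def
proof (rule sum.cong[OF refl])
  fix p assume "y \<in> X" "\<And>p. p \<in> charts_at y \<Longrightarrow> f p = f' p" "p \<in> I"
  then show "wt p y *\<^sub>R unit_bcontfun (to_nat (p, f p)) = wt p y *\<^sub>R unit_bcontfun (to_nat (p, f' p))"
    using wt_nonneg[of p y] by (cases "wt p y = 0") (auto simp: charts_at_def)
qed

lemma consistent_mono:
  "consistent y f \<Longrightarrow> charts_at y' \<subseteq> charts_at y \<Longrightarrow> consistent y' f"
  unfolding consistent_def by blast

lemma openin_chart: "p \<in> I \<Longrightarrow> openin (top_of_set X) {y \<in> X. 0 < wt p y}"
proof -
  assume "p \<in> I"
  then have "openin (top_of_set X) (X \<inter> wt p -` {0<..})"
    by (intro continuous_openin_preimage_gen continuous_wt) auto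
  moreover have "X \<inter> wt p -` {0<..} = {y \<in> X. 0 < wt p y}" by auto
  ultimately show ?thesis by simp
qed

text \<open>Near \<open>y\<close> further charts may appear but none is lost, so a consistent
  assignment at a nearby point restricts to one at \<open>y\<close>.\<close>

lemma charts_near:
  assumes "y \<in> X"
  obtains T where "openin (top_of_set X) T" "y \<in> T" "\<And>y'. y' \<in> T \<Longrightarrow> charts_at y \<subseteq> charts_at y'"
proof -
  let ?T = "\<Inter>p\<in>charts_at y. {y \<in> X. 0 < wt p y}"
  have fin: "finite (charts_at y)" using finite_charts by (auto simp: charts_at_def)
  have "charts_at y \<noteq> {}" using wt_cover[OF assms] by (auto simp: charts_at_def)
  then have "openin (top_of_set X) ?T"
    using fin openin_chart by (intro openin_INT2) (auto simp: charts_at_def)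
  then show thesis by (rule that) (use assms in \<open>auto simp: charts_at_def\<close>)
qed

section \<open>The covering space of a local system\<close>

definition total_space :: "('a \<times> (nat \<Rightarrow>\<^sub>C real)) set"
  where "total_space = {(y, lift y f) | y f. y \<in> X \<and> consistent y f}"

text \<open>\<open>extends\<close> and \<open>unique\<close> together say that evaluation at any
  chart around \<open>y\<close> is a bijection from the consistent assignments at \<open>y\<close>
  onto the \<open>n\<close> sheets.\<close>

context
  assumes extends: "\<And>y p a. y \<in> X \<Longrightarrow> p \<in> charts_at y \<Longrightarrow> a < n \<Longrightarrow> \<exists>f. consistent y f \<and> f p = a"
    and unique: "\<And>y p q f f'. y \<in> X \<Longrightarrow> p \<in> charts_at y \<Longrightarrow> consistent y f \<Longrightarrow> consistent y f' \<Longrightarrow>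
      f p = f' p \<Longrightarrow> q \<in> charts_at y \<Longrightarrow> f q = f' q"
    and n_pos: "0 < n"
begin

definition sheet :: "'c \<Rightarrow> nat \<Rightarrow> 'a \<Rightarrow> 'c \<Rightarrow> nat"
  where "sheet p a y = (SOME f. consistent y f \<and> f p = a)"

lemma sheet:
  assumes "y \<in> X" "p \<in> charts_at y" "a < n"
  shows "consistent y (sheet p a y)" "sheet p a y p = a"
  using someI_ex[OF extends[OF assms]] unfolding sheet_def by auto

text \<open>Term by term: where the weight of \<open>q\<close> is positive at \<open>y\<close>, the
  sheet over \<open>q\<close> is constant nearby by uniqueness; where it vanishes, the term is
  bounded by the weight and tends to 0 whatever the sheet does.\<close>

lemma continuous_on_sheet:
  assumes p: "p \<in> I" and a: "a < n"
  shows "continuous_on {y \<in> X. 0 < wt p y} (\<lambda>y. lift y (sheet p a y))"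
  unfolding lift_def
proof (rule continuous_on_sum, unfold continuous_on_def, rule ballI)
  let ?T = "{y \<in> X. 0 < wt p y}"
  fix q y assume q: "q \<in> I" and y: "y \<in> ?T"
  let ?f = "\<lambda>z. wt q z *\<^sub>R unit_bcontfun (to_nat (q, sheet p a z q))"
  have yX: "y \<in> X" and py: "p \<in> charts_at y" using y p by (auto simp: charts_at_def)
  have cw: "(wt q \<longlongrightarrow> wt q y) (at y within ?T)"
    by (rule tendsto_within_subset[where S = X])
      (use continuous_wt[OF q] yX in \<open>auto simp: continuous_on_def\<close>)
  show "(?f \<longlongrightarrow> ?f y) (at y within ?T)"
  proof (cases "0 < wt q y")
    case True
    obtain T where T: "openin (top_of_set X) T" "y \<in> T" "\<And>z. z \<in> T \<Longrightarrow> charts_at y \<subseteq> charts_at z"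
      using charts_near[OF yX] by blast
    obtain W where W: "open W" "T = X \<inter> W" using T(1) by (auto simp: openin_open)
    have "sheet p a z q = sheet p a y q" if z: "z \<in> W" "z \<in> ?T" for z
    proof -
      have zT: "z \<in> T" and zX: "z \<in> X" and pz: "p \<in> charts_at z" using z W p by (auto simp: charts_at_def)
      have "consistent y (sheet p a z)" by (rule consistent_mono[OF sheet(1)[OF zX pz a] T(3)[OF zT]])
      then show ?thesis
        using unique[OF yX py _ sheet(1)[OF yX py a], of "sheet p a z" q] sheet(2)[OF zX pz a]
          sheet(2)[OF yX py a] q True by (auto simp: charts_at_def)
    qed
    then have ev: "eventually (\<lambda>z. ?f z = wt q z *\<^sub>R unit_bcontfun (to_nat (q, sheet p a y q))) (at y within ?T)"
      unfolding eventually_at_topological using W T(2) by (intro exI[of _ W]) auto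
    have "((\<lambda>z. wt q z *\<^sub>R unit_bcontfun (to_nat (q, sheet p a y q))) \<longlongrightarrow> ?f y) (at y within ?T)"
      by (intro tendsto_intros cw)
    then show ?thesis using tendsto_cong[OF ev] by blast
  next
    case False
    then have q0: "wt q y = 0" using wt_nonneg[OF q yX] by simp
    have "(?f \<longlongrightarrow> 0) (at y within ?T)"
    proof (rule Lim_null_comparison)
      show "eventually (\<lambda>z. norm (?f z) \<le> wt q z) (at y within ?T)"
        unfolding eventually_at_filter
      proof (rule always_eventually, intro allI impI)
        fix z assume "z \<in> ?T"
        then have "0 \<le> wt q z" using wt_nonneg[OF q] by auto
        then show "norm (?f z) \<le> wt q z"
          using norm_unit_bcontfun[of "to_nat (q, sheet p a z q)"] by (simp add: mult_left_le)
      qed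
      show "(wt q \<longlongrightarrow> 0) (at y within ?T)" using cw q0 by simp
    qed
    then show ?thesis using q0 by simp
  qed
qed

lemma covering_space_total_space: "covering_space total_space fst X"
  unfolding covering_space_def
proof (intro conjI ballI)
  show "continuous_on total_space fst" by (intro continuous_intros)
  show "fst ` total_space = X"
  proof
    show "X \<subseteq> fst ` total_space"
    proof
      fix y assume y: "y \<in> X"
      obtain p where "p \<in> charts_at y" using wt_cover[OF y] by (auto simp: charts_at_def)
      then obtain f where "consistent y f" using extends[OF y _ n_pos] by blast
      then have "(y, lift y f) \<in> total_space" using y unfolding total_space_def by blast
      then show "y \<in> fst ` total_space" by force
    qed
  qed (auto simp: total_space_def)
  fix x assume x: "x \<in> X"
  obtain p where px: "p \<in> I" "0 < wt p x" using wt_cover[OF x] by blast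
  let ?T = "{y \<in> X. 0 < wt p y}"
  \<comment> \<open>Sheet \<open>a\<close> over the chart of \<open>p\<close>, cut out by positivity
    of a single coordinate.\<close>
  let ?u = "\<lambda>a. total_space \<inter> fst -` ?T \<inter> {e. 0 < apply_bcontfun (snd e) (to_nat (p, a))}"
  have fmem: "p \<in> charts_at y \<and> f p < n" if "y \<in> ?T" "consistent y f" for y f
    using that px(1) unfolding consistent_def charts_at_def by auto
  have ap: "0 < apply_bcontfun (lift y f) (to_nat (p, a)) \<longleftrightarrow> f p = a" if "y \<in> ?T" for y f a
    using that apply_lift[OF px(1)] by auto
  have opn: "openin (top_of_set total_space) (?u a)" for a
  proof -
    have "openin (top_of_set total_space) (total_space \<inter> fst -` ?T)"
      by (rule continuous_openin_preimage[of _ _ X])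
        (use openin_chart[OF px(1)] in \<open>auto simp: total_space_def intro: continuous_intros\<close>)
    moreover have "openin (top_of_set total_space) (total_space \<inter> (\<lambda>e. apply_bcontfun (snd e) (to_nat (p, a))) -` {0<..})"
      by (intro continuous_openin_preimage_gen bounded_linear.continuous_on[OF bounded_linear_apply_bcontfun] continuous_intros
        open_greaterThan)
    moreover have "?u a = (total_space \<inter> fst -` ?T) \<inter> (total_space \<inter> (\<lambda>e. apply_bcontfun (snd e) (to_nat (p, a))) -` {0<..})"
      by auto
    ultimately show ?thesis by (simp only: openin_Int)
  qed
  have hom: "homeomorphism (?u a) ?T fst (\<lambda>y. (y, lift y (sheet p a y)))" if a: "a < n" for a
  proof (rule homeomorphismI)
    show "continuous_on (?u a) fst" by (intro continuous_intros)
    show "continuous_on ?T (\<lambda>y. (y, lift y (sheet p a y)))"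
      by (intro continuous_intros continuous_on_sheet px(1) a)
    show "fst ` ?u a \<subseteq> ?T" by auto
    show "(\<lambda>y. (y, lift y (sheet p a y))) ` ?T \<subseteq> ?u a"
    proof clarify
      fix y assume y: "y \<in> X" "0 < wt p y"
      then have py: "p \<in> charts_at y" using px(1) by (simp add: charts_at_def)
      show "(y, lift y (sheet p a y)) \<in> ?u a"
        using sheet[OF y(1) py a] y ap[of y "sheet p a y" a] unfolding total_space_def by auto
    qed
    show "(fst e, lift (fst e) (sheet p a (fst e))) = e" if e: "e \<in> ?u a" for e
    proof -
      obtain y f where yf: "e = (y, lift y f)" "y \<in> X" "consistent y f" "y \<in> ?T"
        using e unfolding total_space_def by auto
      have "f p = a" using e ap[OF yf(4), of f a] yf(1) by auto
      have py: "p \<in> charts_at y" using fmem[OF yf(4,3)] by blast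
      have "lift y f = lift y (sheet p a y)"
      proof (rule lift_cong[OF yf(2)])
        fix q assume "q \<in> charts_at y"
        then show "f q = sheet p a y q"
          using unique[OF yf(2) py yf(3) sheet(1)[OF yf(2) py a]] sheet(2)[OF yf(2) py a] \<open>f p = a\<close> by simp
      qed
      then show ?thesis using yf(1) by simp
    qed
  qed auto
  show "\<exists>T. x \<in> T \<and> openin (top_of_set X) T \<and> (\<exists>v. \<Union> v = total_space \<inter> fst -` T \<and>
      (\<forall>u\<in>v. openin (top_of_set total_space) u) \<and> pairwise disjnt v \<and> (\<forall>u\<in>v. \<exists>q. homeomorphism u T fst q))"
  proof (intro exI[of _ ?T] conjI exI[of _ "?u ` {..<n}"])
    show "x \<in> ?T" using x px by simp
    show "openin (top_of_set X) ?T" by (rule openin_chart[OF px(1)])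
    show "\<Union> (?u ` {..<n}) = total_space \<inter> fst -` ?T"
    proof
      show "total_space \<inter> fst -` ?T \<subseteq> \<Union> (?u ` {..<n})"
      proof
        fix e assume e: "e \<in> total_space \<inter> fst -` ?T"
        then obtain y f where yf: "e = (y, lift y f)" "consistent y f" "y \<in> ?T"
          unfolding total_space_def by auto
        then have "e \<in> ?u (f p)" using e ap[OF yf(3), of f "f p"] by auto
        then show "e \<in> \<Union> (?u ` {..<n})" using fmem[OF yf(3,2)] by blast
      qed
    qed auto
    show "\<forall>u\<in>?u ` {..<n}. openin (top_of_set total_space) u" using opn by blast
    show "pairwise disjnt (?u ` {..<n})"
    proof (rule pairwise_imageI)
      fix a a' :: nat assume "a \<noteq> a'"
      show "disjnt (?u a) (?u a')"
        unfolding disjnt_def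
      proof (rule equals0I)
        fix e assume e: "e \<in> ?u a \<inter> ?u a'"
        then obtain y f where yf: "e = (y, lift y f)" "y \<in> ?T" unfolding total_space_def by auto
        have "f p = a" "f p = a'" using e ap[OF yf(2), of f] yf(1) by auto
        then show False using \<open>a \<noteq> a'\<close> by simp
      qed
    qed
    show "\<forall>u\<in>?u ` {..<n}. \<exists>q. homeomorphism u ?T fst q" using hom by blast
  qed
qed

text \<open>The identity of a simply connected base lifts through the covering. The sheets selected
  by the lift are locally constant because each is detected by positivity of a coordinate.\<close>

lemma global_section:
  assumes "simply_connected X" "locally path_connected X"
  obtains \<sigma> where "\<And>y. y \<in> X \<Longrightarrow> consistent y (\<sigma> y)"
    "\<And>p a. p \<in> I \<Longrightarrow> openin (top_of_set X) {y \<in> X. 0 < wt p y \<and> \<sigma> y p = a}"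
proof -
  obtain s where s: "continuous_on X s" "s \<in> X \<rightarrow> total_space" "\<And>y. y \<in> X \<Longrightarrow> fst (s y) = y"
    by (rule covering_space_lift[OF covering_space_total_space assms continuous_on_id]) (auto intro: that)
  define \<sigma> where "\<sigma> y = (SOME f. consistent y f \<and> snd (s y) = lift y f)" for y
  have \<sigma>: "consistent y (\<sigma> y)" "snd (s y) = lift y (\<sigma> y)" if y: "y \<in> X" for y
  proof -
    have "s y \<in> total_space" using s(2) y by blast
    then have "\<exists>f. consistent y f \<and> snd (s y) = lift y f"
      using s(3)[OF y] unfolding total_space_def by auto
    then have "consistent y (\<sigma> y) \<and> snd (s y) = lift y (\<sigma> y)" unfolding \<sigma>_def by (rule someI_ex)
    then show "consistent y (\<sigma> y)" "snd (s y) = lift y (\<sigma> y)" by auto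
  qed
  have "openin (top_of_set X) {y \<in> X. 0 < wt p y \<and> \<sigma> y p = a}" if p: "p \<in> I" for p a
  proof -
    have "continuous_on X (\<lambda>y. apply_bcontfun (snd (s y)) (to_nat (p, a)))"
      by (intro bounded_linear.continuous_on[OF bounded_linear_apply_bcontfun] continuous_intros s(1))
    then have "openin (top_of_set X) (X \<inter> (\<lambda>y. apply_bcontfun (snd (s y)) (to_nat (p, a))) -` {0<..})"
      by (rule continuous_openin_preimage_gen) auto
    moreover have "X \<inter> (\<lambda>y. apply_bcontfun (snd (s y)) (to_nat (p, a))) -` {0<..} = {y \<in> X. 0 < wt p y \<and> \<sigma> y p = a}"
      using \<sigma>(2) apply_lift[OF p] by (auto split: if_splits)
    ultimately show ?thesis by simp
  qed
  then show thesis using that \<sigma>(1) by blast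
qed

end

end

lemma locally_constant_on_connected:
  assumes "connected T" "T \<subseteq> X" "\<And>a. openin (top_of_set X) {y \<in> X. Q y \<and> f y = a}" "\<And>y. y \<in> T \<Longrightarrow> Q y"
    and "x \<in> T" "y \<in> T"
  shows "f x = f y"
proof (rule ccontr)
  assume neq: "f x \<noteq> f y"
  let ?A = "{z \<in> X. Q z \<and> f z = f x}" and ?B = "\<Union>a\<in>UNIV - {f x}. {z \<in> X. Q z \<and> f z = a}"
  have restrict: "openin (top_of_set T) (T \<inter> U)" if U: "openin (top_of_set X) U" for U
  proof -
    obtain W where W: "open W" "U = X \<inter> W" using U by (auto simp: openin_open)
    have "T \<inter> U = T \<inter> W" using W(2) assms(2) by blast
    then show ?thesis using W(1) by (auto simp: openin_open)
  qed
  have A: "openin (top_of_set T) (T \<inter> ?A)" by (rule restrict[OF assms(3)])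
  have "openin (top_of_set X) ?B" using assms(3) by blast
  then have B: "openin (top_of_set T) (T \<inter> ?B)" by (rule restrict)
  define E1 where "E1 = T \<inter> ?A"
  define E2 where "E2 = T \<inter> ?B"
  have "T \<subseteq> E1 \<union> E2" using assms(2,4) by (auto simp: E1_def E2_def)
  moreover have "E1 \<inter> E2 = {}" by (auto simp: E1_def E2_def)
  moreover have "x \<in> E1" "y \<in> E2" using assms neq by (auto simp: E1_def E2_def)
  moreover have "openin (top_of_set T) E1" "openin (top_of_set T) E2" using A B by (simp_all add: E1_def E2_def)
  ultimately show False using assms(1) unfolding connected_openin by blast
qed

section \<open>The transition permutations\<close>

text \<open>The local system was found by computer search for homomorphisms from the fundamental group of the
  boundary to a finite group; its permutations are all even. Facets are numbered by their position in
  \<^term>\<open>facet_list\<close>. Entry \<open>x\<close> of a list is the sheet that continues sheet \<open>x\<close> on passing from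
  vertex \<open>i\<close> to \<open>j\<close> over the facet \<open>k\<close>, or from facet \<open>a\<close> to \<open>b\<close> over the vertex \<open>i\<close>. Only the passages to
  larger indices are tabulated.\<close>

definition same_sheet :: "nat list"
  where "same_sheet = [0, 1, 2, 3, 4, 5, 6]"

definition vertex_transition :: "nat \<Rightarrow> nat \<Rightarrow> nat \<Rightarrow> nat list"
  where "vertex_transition i j k = (if i = 1 then (
    if j = 2 then (if member_list k [2] then [1, 2, 4, 0, 5, 6, 3] else same_sheet) else
    if j = 3 then (if member_list k [0] then [1, 3, 4, 5, 0, 6, 2]
      else if member_list k [1] then [4, 0, 5, 2, 6, 1, 3]
      else if member_list k [2, 8] then [2, 0, 5, 6, 1, 3, 4]
      else if member_list k [3, 4, 9, 10] then [6, 2, 0, 4, 5, 1, 3] else same_sheet) else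
    if j = 5 then (if member_list k [0, 5, 6] then [1, 3, 4, 5, 0, 6, 2]
      else if member_list k [2, 8] then [2, 0, 5, 6, 1, 3, 4]
      else if member_list k [11, 13] then [4, 0, 5, 2, 6, 1, 3]
      else if member_list k [12] then [6, 2, 0, 4, 5, 1, 3] else same_sheet) else
    if j = 6 then (if member_list k [2, 8] then [1, 2, 4, 0, 5, 6, 3] else same_sheet) else
    if j = 8 then (if member_list k [1, 5, 6, 7, 13] then [4, 0, 5, 2, 6, 1, 3]
      else if member_list k [4, 10, 12] then [6, 2, 0, 4, 5, 1, 3] else same_sheet) else
    same_sheet)
   else if i = 3 then (
    if j = 4 then (if member_list k [8] then [4, 5, 6, 2, 1, 3, 0]
      else if member_list k [9, 10, 18] then [3, 2, 4, 1, 0, 5, 6]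
      else if member_list k [17] then [2, 5, 1, 6, 3, 4, 0] else same_sheet) else
    if j = 6 then (if member_list k [2, 3, 8, 9, 15, 16, 17, 18]
      then [2, 5, 1, 6, 3, 4, 0] else same_sheet) else
    same_sheet)
   else if i = 4 then (
    if j = 5 then (if member_list k [0, 5, 14] then [2, 5, 1, 6, 3, 4, 0]
      else if member_list k [8] then [0, 3, 6, 4, 2, 5, 1] else same_sheet) else
    if j = 6 then (if member_list k [8] then [0, 3, 6, 4, 2, 5, 1]
      else if member_list k [9, 11, 18, 19] then [3, 6, 5, 2, 1, 4, 0] else same_sheet) else
    same_sheet)
   else if i = 5 then (
    if j = 6 then (if member_list k [11, 13, 19] then [3, 6, 5, 2, 1, 4, 0] else same_sheet) else
    if j = 8 then (if member_list k [5, 6, 14, 15, 17] then [6, 4, 3, 0, 5, 2, 1] else same_sheet) else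
    same_sheet)
   else same_sheet)"

definition facet_transition :: "nat \<Rightarrow> nat \<Rightarrow> nat \<Rightarrow> nat list"
  where "facet_transition i a b = (if a = 0 then (
    if b = 1 then (if member_list i [1, 2, 3, 4] then [2, 5, 6, 1, 3, 0, 4] else same_sheet) else
    if b = 2 then (if member_list i [2, 3, 5] then [1, 2, 4, 0, 5, 6, 3] else same_sheet) else
    if b = 8 then (if member_list i [1, 4] then [4, 5, 6, 2, 1, 3, 0] else same_sheet) else
    same_sheet)
   else if a = 1 then (
    if b = 4 then (if member_list i [1, 2, 3, 8] then [6, 0, 1, 5, 3, 2, 4] else same_sheet) else
    if b = 10 then (if member_list i [1, 4] then [3, 2, 4, 1, 0, 5, 6] else same_sheet) else
    same_sheet)
   else if a = 2 then (
    if b = 3 then (if member_list i [1] then [1, 2, 4, 0, 5, 6, 3] else same_sheet) else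
    if b = 6 then (if member_list i [2, 5, 6] then [3, 0, 1, 6, 2, 4, 5] else same_sheet) else
    same_sheet)
   else if a = 4 then (
    if b = 7 then (if member_list i [1, 2, 7, 8] then [1, 2, 5, 4, 6, 3, 0] else same_sheet) else
    same_sheet)
   else if a = 5 then (
    if b = 12 then (if member_list i [1, 4] then [3, 2, 4, 1, 0, 5, 6]
      else if member_list i [5] then [6, 4, 3, 0, 5, 2, 1] else same_sheet) else
    same_sheet)
   else if a = 6 then (
    if b = 13 then (if member_list i [5] then [6, 4, 3, 0, 5, 2, 1] else same_sheet) else
    same_sheet)
   else if a = 8 then (
    if b = 9 then (if member_list i [3] then [2, 5, 6, 1, 3, 0, 4]
      else if member_list i [6] then [3, 0, 1, 6, 2, 4, 5] else same_sheet) else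
    if b = 11 then (if member_list i [5] then [0, 6, 4, 1, 3, 5, 2]
      else if member_list i [6] then [3, 0, 1, 6, 2, 4, 5] else same_sheet) else
    if b = 17 then (if member_list i [4] then [0, 3, 6, 4, 2, 5, 1] else same_sheet) else
    same_sheet)
   else if a = 11 then (
    if b = 12 then (if member_list i [1, 4, 5, 7] then [6, 0, 1, 5, 3, 2, 4] else same_sheet) else
    same_sheet)
   else if a = 12 then (
    if b = 13 then (if member_list i [1, 5, 7, 8] then [1, 2, 5, 4, 6, 3, 0] else same_sheet) else
    same_sheet)
   else if a = 14 then (
    if b = 17 then (if member_list i [4] then [2, 5, 1, 6, 3, 4, 0] else same_sheet) else
    same_sheet)
   else if a = 17 then (
    if b = 18 then (if member_list i [4] then [6, 4, 3, 0, 5, 2, 1] else same_sheet) else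
    if b = 19 then (if member_list i [4, 5] then [6, 4, 3, 0, 5, 2, 1] else same_sheet) else
    same_sheet)
   else same_sheet)"

text \<open>The 50 pairs \<open>a < b\<close> of facets with four common vertices, one for each
  ridge of the polytope.\<close>

definition share_ridge :: "nat \<Rightarrow> nat \<Rightarrow> bool"
  where "share_ridge a b = (if a = 0 then member_list b [1, 2, 5, 8, 14]
    else if a = 1 then member_list b [4, 5, 10, 14] else if a = 2 then member_list b [3, 6, 8, 15]
    else if a = 3 then member_list b [4, 7, 9, 16] else if a = 4 then member_list b [7, 10, 16]
    else if a = 5 then member_list b [6, 12, 14] else if a = 6 then member_list b [7, 13, 15]
    else if a = 7 then member_list b [13, 16] else if a = 8 then member_list b [9, 11, 17]
    else if a = 9 then member_list b [10, 11, 18] else if a = 10 then member_list b [12, 18]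
    else if a = 11 then member_list b [12, 13, 19] else if a = 12 then member_list b [13, 19]
    else if a = 13 then member_list b [19] else if a = 14 then member_list b [15, 17]
    else if a = 15 then member_list b [16, 17] else if a = 16 then member_list b [18]
    else if a = 17 then member_list b [18, 19] else if a = 18 then member_list b [19] else False)"

section \<open>Trivializations over stars as a finite computation\<close>

fun apply_list :: "nat list \<Rightarrow> nat list \<Rightarrow> nat list"
  where "apply_list g [] = []"
  | "apply_list g (x # xs) = (g ! x) # apply_list g xs"

fun eq_list :: "nat list \<Rightarrow> nat list \<Rightarrow> bool"
  where "eq_list [] [] = True"
  | "eq_list (x # xs) (y # ys) = (if x = y then eq_list xs ys else False)"
  | "eq_list _ _ = False"

fun star_from :: "nat \<Rightarrow> nat list \<Rightarrow> nat list list \<Rightarrow> nat list"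
  where "star_from k t [] = []"
  | "star_from k t (f # fs) = (if subset_list t f then k # star_from (Suc k) t fs else star_from (Suc k) t fs)"

text \<open>The sheets over facet \<open>k\<close> are carried over from the first earlier facet of
  the star that shares a ridge with it. The identity is the default for the first facet;
  \<open>reachable\<close> rules it out for later ones.\<close>

fun base_potential :: "nat \<Rightarrow> nat \<Rightarrow> (nat \<times> nat list) list \<Rightarrow> nat list"
  where "base_potential i k [] = [0,1,2,3,4,5,6]"
  | "base_potential i k ((a, c) # xs) =
      (if share_ridge a k then apply_list (facet_transition i a k) c else base_potential i k xs)"

fun base_potentials :: "nat \<Rightarrow> (nat \<times> nat list) list \<Rightarrow> nat list \<Rightarrow> (nat \<times> nat list) list"
  where "base_potentials i acc [] = acc"
  | "base_potentials i acc (k # ks) = base_potentials i (acc @ [(k, base_potential i k acc)]) ks"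

fun side_potentials :: "nat \<Rightarrow> nat \<Rightarrow> nat list \<Rightarrow> nat list \<Rightarrow> (nat \<times> nat list) list"
  where "side_potentials i k c [] = []"
  | "side_potentials i k c (j # js) = (j, apply_list (vertex_transition i j k) c) # side_potentials i k c js"

fun potentials :: "nat list \<Rightarrow> nat list \<Rightarrow> (nat \<times> (nat \<times> nat list) list) list"
  where "potentials [] ks = map (\<lambda>k. (k, [])) ks"
  | "potentials (i # js) ks = map (\<lambda>(k, c). (k, (i, c) # side_potentials i k c js)) (base_potentials i [] ks)"

definition perm7 :: "nat list \<Rightarrow> bool"
  where "perm7 c = (if length c = 7 then subset_list [0,1,2,3,4,5,6] c else False)"

definition valid_sides :: "nat \<Rightarrow> (nat \<times> nat list) list \<Rightarrow> bool"
  where "valid_sides k cs = list_all (\<lambda>(i, c). if perm7 c then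
     list_all (\<lambda>(j, d). if i < j then eq_list d (apply_list (vertex_transition i j k) c) else True) cs else False) cs"

fun valid_ridge :: "nat \<Rightarrow> nat \<Rightarrow> (nat \<times> nat list) list \<Rightarrow> (nat \<times> nat list) list \<Rightarrow> bool"
  where "valid_ridge a b [] [] = True"
  | "valid_ridge a b ((i, c) # xs) ((j, d) # ys) =
      (if i = j then if eq_list d (apply_list (facet_transition i a b) c) then valid_ridge a b xs ys else False else False)"
  | "valid_ridge _ _ _ _ = False"

definition valid_potentials :: "(nat \<times> (nat \<times> nat list) list) list \<Rightarrow> bool"
  where "valid_potentials P = (if list_all (\<lambda>(k, cs). valid_sides k cs) P then
     list_all (\<lambda>(a, cs). list_all (\<lambda>(b, ds). if share_ridge a b then valid_ridge a b cs ds else True) P) P else False)"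

fun reachable :: "nat list \<Rightarrow> nat list \<Rightarrow> bool"
  where "reachable acc [] = True"
  | "reachable acc (k # ks) = (if list_ex (\<lambda>a. share_ridge a k) acc then reachable (k # acc) ks else False)"

fun reachable_from_hd :: "nat list \<Rightarrow> bool"
  where "reachable_from_hd [] = True"
  | "reachable_from_hd (k # ks) = reachable [k] ks"

text \<open>Only pairs that differ by one vertex are tested, a face outside the dunce hat and one
  inside; \<open>potential_exists\<close> reduces all other pairs to them.\<close>

definition check_star :: "nat list \<Rightarrow> nat list \<Rightarrow> bool"
  where "check_star t ks = (if reachable_from_hd ks then
     list_all (\<lambda>v. if dunce_face_list (removeAll v t) then valid_potentials (potentials (removeAll v t) ks) else True) t
     else False)"

definition check_face :: "nat list \<Rightarrow> bool"
  where "check_face t = (if face_list t then if dunce_face_list t then True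
     else check_star t (star_from 0 t facet_list) else True)"

lemma check_faces: "list_all check_face vertex_lists"
  by code_simp

section \<open>Soundness of the computed trivializations\<close>

lemma apply_list_map: "apply_list g xs = map ((!) g) xs"
  by (induction xs) auto

lemma eq_list_iff [simp]: "eq_list xs ys \<longleftrightarrow> xs = ys"
  by (induction xs ys rule: eq_list.induct) auto

lemma set_star_from: "set (star_from k t fs) = {k + j | j. j < length fs \<and> set t \<subseteq> set (fs ! j)}"
proof (induction fs arbitrary: k)
  case (Cons f fs)
  have "{k + j | j. j < length (f # fs) \<and> set t \<subseteq> set ((f # fs) ! j)} =
      (if set t \<subseteq> set f then {k} else {}) \<union> {Suc k + j | j. j < length fs \<and> set t \<subseteq> set (fs ! j)}" (is "?L = ?R")
  proof (intro set_eqI iffI)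
    fix x assume "x \<in> ?L"
    then obtain j where j: "x = k + j" "j < length (f # fs)" "set t \<subseteq> set ((f # fs) ! j)" by blast
    then show "x \<in> ?R" by (cases j) auto
  next
    fix x assume "x \<in> ?R"
    then consider "set t \<subseteq> set f" "x = k" | j where "x = Suc k + j" "j < length fs" "set t \<subseteq> set (fs ! j)"
      by (auto split: if_splits)
    then show "x \<in> ?L"
    proof cases
      case 1 then show ?thesis by (intro CollectI exI[of _ 0]) simp
    next
      case (2 j) then show ?thesis by (intro CollectI exI[of _ "Suc j"]) simp
    qed
  qed
  then show ?case using Cons.IH[of "Suc k"] by auto
qed simp

lemma map_fst_base_potentials: "map fst (base_potentials i acc ks) = map fst acc @ ks"
  by (induction ks arbitrary: acc) auto

lemma map_fst_side_potentials: "map fst (side_potentials i k c js) = js"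
  by (induction js) auto

lemma map_fst_potentials: "map fst (potentials s ks) = ks"
proof (cases s)
  case Nil then show ?thesis by (simp add: o_def)
next
  case (Cons i js)
  have "map fst (potentials s ks) = map fst (base_potentials i [] ks)"
    by (auto simp: Cons intro!: map_cong)
  then show ?thesis by (simp add: map_fst_base_potentials)
qed

lemma fst_sides_potentials: "(k, cs) \<in> set (potentials s ks) \<Longrightarrow> map fst cs = s"
  by (cases s) (auto simp: map_fst_side_potentials)

lemma valid_ridge_map_of:
  "valid_ridge a b cs ds \<Longrightarrow> i \<in> fst ` set cs \<Longrightarrow>
    the (map_of ds i) = apply_list (facet_transition i a b) (the (map_of cs i))"
  by (induction a b cs ds rule: valid_ridge.induct) (auto split: if_splits)

definition transition :: "nat \<times> nat \<Rightarrow> nat \<times> nat \<Rightarrow> nat \<Rightarrow> nat"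
  where "transition p q a =
    (if snd p = snd q then vertex_transition (fst p) (fst q) (snd p) else facet_transition (fst p) (snd p) (snd q)) ! a"

definition adjacent :: "((nat \<times> nat) \<times> (nat \<times> nat)) set"
  where "adjacent = {(p, q). snd p = snd q \<and> fst p < fst q \<or>
    snd p \<noteq> snd q \<and> fst p = fst q \<and> share_ridge (snd p) (snd q)}"

text \<open>A chart is a pair of a vertex and a facet number. These are the charts around a point
  whose chain has \<open>s\<close> as largest member in the dunce hat and \<open>T\<close> as
  smallest member outside. The set grows with \<open>s\<close> and shrinks with
  \<open>T\<close>.\<close>

definition charts_of :: "nat set \<Rightarrow> nat set \<Rightarrow> (nat \<times> nat) set"
  where "charts_of s T = {(i, k). i \<in> s \<and> k < length facet_list \<and> T \<subseteq> set (facet_list ! k)}"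

lemma mem_charts_of: "(i, k) \<in> charts_of s T \<longleftrightarrow> i \<in> s \<and> k < length facet_list \<and> T \<subseteq> set (facet_list ! k)"
  by (simp add: charts_of_def)

definition consistent_on :: "(nat \<times> nat) set \<Rightarrow> (nat \<times> nat \<Rightarrow> nat) \<Rightarrow> bool"
  where "consistent_on A f \<longleftrightarrow> (\<forall>p\<in>A. f p < 7) \<and>
    (\<forall>p\<in>A. \<forall>q\<in>A. (p, q) \<in> adjacent \<longrightarrow> f q = transition p q (f p))"

text \<open>A trivialization: \<open>c p ! x\<close> is the sheet over the chart \<open>p\<close> in
  the \<open>x\<close>-th consistent assignment.\<close>

definition potential_on :: "(nat \<times> nat) set \<Rightarrow> (nat \<times> nat \<Rightarrow> nat list) \<Rightarrow> bool"
  where "potential_on A c \<longleftrightarrow> (\<forall>p\<in>A. perm7 (c p)) \<and>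
    (\<forall>p\<in>A. \<forall>q\<in>A. (p, q) \<in> adjacent \<longrightarrow> c q = map (transition p q) (c p))"

lemma perm7D:
  assumes "perm7 c"
  shows "length c = 7" "set c = {..<7}" "distinct c"
proof -
  show len: "length c = 7" using assms by (simp add: perm7_def split: if_splits)
  have A: "set [0,1,2,3,4,5,6::nat] \<subseteq> set c"
    using assms unfolding perm7_def subset_list_iff by (auto split: if_splits)
  have B: "set [0,1,2,3,4,5,6::nat] = {..<7}" by (auto simp: lessThan_nat_numeral lessThan_Suc)
  have sub: "{..<7} \<subseteq> set c" using A unfolding B .
  moreover have "card (set c) \<le> 7" using card_length[of c] len by simp
  ultimately show s: "set c = {..<7}" using card_seteq[of "set c" "{..<7}"] by auto
  show "distinct c" by (rule card_distinct) (simp add: s len)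
qed

lemma potential_of_valid:
  assumes "valid_potentials (potentials sl (star_from 0 tv facet_list))"
  shows "\<exists>c. potential_on (charts_of (set sl) (set tv)) c"
proof -
  let ?ks = "star_from 0 tv facet_list"
  let ?P = "potentials sl ?ks"
  define c where "c p = the (map_of (the (map_of ?P (snd p))) (fst p))" for p
  have P: "(k, the (map_of ?P k)) \<in> set ?P" if k: "(i, k) \<in> charts_of (set sl) (set tv)" for i k
  proof -
    have "k \<in> set ?ks" using k by (auto simp: mem_charts_of set_star_from)
    then have "k \<in> fst ` set ?P" by (metis map_fst_potentials set_map)
    then obtain cs where "map_of ?P k = Some cs" by (metis map_of_eq_None_iff option.exhaust)
    then show ?thesis using map_of_SomeD by force
  qed
  have C: "(i, c (i, k)) \<in> set (the (map_of ?P k))" if k: "(i, k) \<in> charts_of (set sl) (set tv)" for i k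
  proof -
    have "i \<in> fst ` set (the (map_of ?P k))"
      using fst_sides_potentials[OF P[OF k]] k by (metis mem_charts_of set_map)
    then obtain d where "map_of (the (map_of ?P k)) i = Some d" by (metis map_of_eq_None_iff option.exhaust)
    then show ?thesis using map_of_SomeD by (force simp: c_def)
  qed
  have sides: "valid_sides k cs" if "(k, cs) \<in> set ?P" for k cs
    using assms that by (auto simp: valid_potentials_def list_all_iff split: if_splits)
  have ridges: "valid_ridge a b cs ds" if "(a, cs) \<in> set ?P" "(b, ds) \<in> set ?P" "share_ridge a b" for a b cs ds
    using assms that by (fastforce simp: valid_potentials_def list_all_iff split: if_splits)
  have "potential_on (charts_of (set sl) (set tv)) c"
    unfolding potential_on_def
  proof (intro conjI ballI impI)
    fix p assume "p \<in> charts_of (set sl) (set tv)"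
    then show "perm7 (c p)"
      using sides[OF P] C by (cases p) (fastforce simp: valid_sides_def list_all_iff split: if_splits)
  next
    fix p q assume p: "p \<in> charts_of (set sl) (set tv)" and q: "q \<in> charts_of (set sl) (set tv)"
      and adj: "(p, q) \<in> adjacent"
    obtain i k where ik: "p = (i, k)" by (cases p)
    obtain j l where jl: "q = (j, l)" by (cases q)
    consider "k = l" "i < j" | "k \<noteq> l" "i = j" "share_ridge k l" using adj ik jl by (auto simp: adjacent_def)
    then show "c q = map (transition p q) (c p)"
    proof cases
      case 1
      have "(i, c (i, k)) \<in> set (the (map_of ?P k))" "(j, c (j, k)) \<in> set (the (map_of ?P k))"
        using C p q ik jl 1 by auto
      then have "c (j, k) = apply_list (vertex_transition i j k) (c (i, k))"
        using sides[OF P] p ik 1(2) by (fastforce simp: valid_sides_def list_all_iff split: if_splits)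
      then show ?thesis using ik jl 1 by (simp add: apply_list_map transition_def)
    next
      case 2
      have "i \<in> fst ` set (the (map_of ?P k))" using C p ik by force
      then have "c (i, l) = apply_list (facet_transition i k l) (c (i, k))"
        using valid_ridge_map_of[OF ridges[OF P P 2(3)]] p q ik jl 2(2) by (simp add: c_def)
      then show ?thesis using ik jl 2 by (simp add: apply_list_map transition_def)
    qed
  qed
  then show ?thesis by blast
qed

lemma potential_on_subset: "potential_on A c \<Longrightarrow> B \<subseteq> A \<Longrightarrow> potential_on B c"
  unfolding potential_on_def by blast

lemma check_face_set:
  assumes "T \<notin> dunce_faces" "F \<in> set facet_list" "T \<subseteq> set F"
  obtains tv where "T = set tv" "check_star tv (star_from 0 tv facet_list)"
proof -
  have "set F \<subseteq> {1..8}" using assms(2) by (auto simp: facet_list_def)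
  then obtain tv where tv: "tv \<in> set vertex_lists" "T = set tv" using sublist_of_8 assms(3) by (metis order_trans)
  have "face_list tv" using assms tv by (auto simp: face_list_def list_ex_iff)
  moreover have "\<not> dunce_face_list tv" using assms tv by (simp add: dunce_face_list_iff)
  moreover have "check_face tv" using check_faces tv(1) by (simp add: list_all_iff)
  ultimately have "check_star tv (star_from 0 tv facet_list)" by (simp add: check_face_def)
  then show thesis using that tv(2) by blast
qed

text \<open>Between a face of the dunce hat and a larger face outside it there is a step that adds one
  vertex and leaves the dunce hat.\<close>

lemma potential_exists:
  assumes s: "s \<in> dunce_faces" and T: "T \<notin> dunce_faces" "F \<in> set facet_list" "T \<subseteq> set F" "s \<subseteq> T"
  shows "\<exists>c. potential_on (charts_of s T) c"
proof -
  have finT: "finite T" using T(3) finite_subset by blast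
  let ?A = "{s'. s \<subseteq> s' \<and> s' \<subseteq> T \<and> s' \<in> dunce_faces}"
  have "finite ?A" using finT by (rule rev_finite_subset[OF finite_Pow_iff[THEN iffD2]]) auto
  from finite_has_maximal2[OF this, of s] obtain s1 where s1: "s1 \<in> ?A" "\<And>s'. s' \<in> ?A \<Longrightarrow> s1 \<subseteq> s' \<Longrightarrow> s1 = s'"
    using s T(4) by auto
  have "s1 \<noteq> T" using s1(1) T(1) by auto
  then obtain v where v: "v \<in> T" "v \<notin> s1" using s1(1) by auto
  let ?T1 = "insert v s1"
  have "?T1 \<notin> dunce_faces"
  proof
    assume "?T1 \<in> dunce_faces"
    then have "?T1 \<in> ?A" using s1(1) v(1) by auto
    from s1(2)[OF this] have "v \<in> s1" by blast
    then show False using v(2) by simp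
  qed
  moreover have "?T1 \<subseteq> set F" using s1(1) v(1) T(3) by blast
  ultimately obtain tv where tv: "?T1 = set tv" "check_star tv (star_from 0 tv facet_list)"
    using check_face_set T(2) by metis
  have rem: "set (removeAll v tv) = s1" using tv(1) v(2) by auto
  have "v \<in> set tv" using tv(1) by blast
  then have "valid_potentials (potentials (removeAll v tv) (star_from 0 tv facet_list))"
    using tv(2) s1(1) rem by (auto simp: check_star_def list_all_iff dunce_face_list_iff split: if_splits)
  then obtain c where "potential_on (charts_of s1 ?T1) c" using potential_of_valid rem tv(1) by metis
  moreover have "charts_of s T \<subseteq> charts_of s1 ?T1" using s1(1) v(1) by (auto simp: charts_of_def)
  ultimately show ?thesis using potential_on_subset by blast
qed

lemma reachable_induct:
  assumes "reachable acc ks" "\<And>k. k \<in> set acc \<Longrightarrow> Q k"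
    "\<And>a k. a \<in> set acc \<union> set ks \<Longrightarrow> k \<in> set ks \<Longrightarrow> Q a \<Longrightarrow> share_ridge a k \<Longrightarrow> Q k"
  shows "k \<in> set acc \<union> set ks \<Longrightarrow> Q k"
  using assms
proof (induction ks arbitrary: acc)
  case (Cons k' ks)
  obtain a where "a \<in> set acc" "share_ridge a k'" "reachable (k' # acc) ks"
    using Cons.prems(2) by (auto simp: list_ex_iff split: if_splits)
  then have "Q k'" using Cons.prems(3,4) by auto
  then show ?case
    using Cons.IH[of "k' # acc"] Cons.prems \<open>reachable (k' # acc) ks\<close> by auto
qed auto

text \<open>Agreement with column \<open>x\<close> at one chart spreads along ridges over the
  smallest vertex and then, over each facet, to the other vertices. The smallest vertex is the start
  because adjacency leads to larger vertices only.\<close>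

lemma consistent_from_potential:
  assumes s: "s \<in> dunce_faces" "s \<noteq> {}" and T: "T \<notin> dunce_faces" "F \<in> set facet_list" "T \<subseteq> set F"
    and c: "potential_on (charts_of s T) c" and f: "consistent_on (charts_of s T) f"
  obtains x where "x < 7" "\<And>p. p \<in> charts_of s T \<Longrightarrow> f p = c p ! x"
proof -
  obtain tv where tv: "T = set tv" "check_star tv (star_from 0 tv facet_list)"
    using check_face_set[OF T] by blast
  let ?ks = "star_from 0 tv facet_list"
  have ks: "k \<in> set ?ks \<longleftrightarrow> k < length facet_list \<and> T \<subseteq> set (facet_list ! k)" for k
    using tv(1) by (auto simp: set_star_from)
  have "?ks \<noteq> []" using ks T(2,3) by (metis in_set_conv_nth list.set(1) empty_iff)
  then obtain k0 ks' where k0: "?ks = k0 # ks'" by (cases ?ks) auto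
  then have reach: "reachable [k0] ks'" using tv(2) by (simp add: check_star_def split: if_splits)
  have fins: "finite s" using s(1) by (auto simp: dunce_faces_def dunce_triangles_list intro: finite_subset)
  define i0 where "i0 = Min s"
  have i0: "i0 \<in> s" "\<And>i. i \<in> s \<Longrightarrow> i0 \<le> i" using fins s(2) by (auto simp: i0_def)
  have mem: "(i, k) \<in> charts_of s T \<longleftrightarrow> i \<in> s \<and> k \<in> set ?ks" for i k using ks by (auto simp: mem_charts_of)
  have perm: "perm7 (c p)" if "p \<in> charts_of s T" for p using c that by (auto simp: potential_on_def)
  have step: "f q = c q ! x" if "p \<in> charts_of s T" "q \<in> charts_of s T" "(p, q) \<in> adjacent" "f p = c p ! x" "x < 7" for p q x
  proof -
    have "c q = map (transition p q) (c p)" using c that by (auto simp: potential_on_def)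
    moreover have "f q = transition p q (f p)" using f that by (auto simp: consistent_on_def)
    ultimately show ?thesis using that(4,5) perm7D(1)[OF perm[OF that(1)]] by simp
  qed
  have p0: "(i0, k0) \<in> charts_of s T" using mem i0(1) k0 by simp
  have "f (i0, k0) \<in> set (c (i0, k0))"
    using f p0 perm7D(2)[OF perm[OF p0]] by (auto simp: consistent_on_def)
  then obtain x where x: "x < 7" "f (i0, k0) = c (i0, k0) ! x"
    using perm7D(1)[OF perm[OF p0]] by (metis in_set_conv_nth)
  have base: "f (i0, k) = c (i0, k) ! x" if "k \<in> set ?ks" for k
  proof (rule reachable_induct[OF reach, of "\<lambda>k. f (i0, k) = c (i0, k) ! x"])
    show "k \<in> set [k0] \<union> set ks'" using that k0 by simp
    show "\<And>k. k \<in> set [k0] \<Longrightarrow> f (i0, k) = c (i0, k) ! x" using x by simp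
    fix a l assume al: "a \<in> set [k0] \<union> set ks'" "l \<in> set ks'" "f (i0, a) = c (i0, a) ! x" "share_ridge a l"
    show "f (i0, l) = c (i0, l) ! x"
    proof (cases "a = l")
      case False
      show ?thesis
      proof (rule step[of "(i0, a)"])
        show "(i0, a) \<in> charts_of s T" "(i0, l) \<in> charts_of s T" using al(1,2) k0 i0(1) mem by simp_all
        show "((i0, a), (i0, l)) \<in> adjacent" using False al(4) by (simp add: adjacent_def)
      qed (use al x in simp_all)
    qed (use al in simp)
  qed
  have "f (i, k) = c (i, k) ! x" if "(i, k) \<in> charts_of s T" for i k
  proof (cases "i = i0")
    case True then show ?thesis using base that mem by simp
  next
    case False
    show ?thesis
    proof (rule step[of "(i0, k)"])
      have "i \<in> s" "k \<in> set ?ks" using that mem by simp_all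
      then show "(i0, k) \<in> charts_of s T" "f (i0, k) = c (i0, k) ! x" using i0(1) mem base by simp_all
      show "((i0, k), (i, k)) \<in> adjacent"
        using False i0(2)[OF \<open>i \<in> s\<close>] by (simp add: adjacent_def)
    qed (use that x in simp_all)
  qed
  then show thesis using that x(1) by auto
qed

lemma consistent_extends:
  assumes "s \<in> dunce_faces" "T \<notin> dunce_faces" "F \<in> set facet_list" "T \<subseteq> set F" "s \<subseteq> T"
    "p \<in> charts_of s T" "a < 7"
  shows "\<exists>f. consistent_on (charts_of s T) f \<and> f p = a"
proof -
  obtain c where c: "potential_on (charts_of s T) c" using potential_exists assms by metis
  have perm: "perm7 (c p)" if "p \<in> charts_of s T" for p using c that by (auto simp: potential_on_def)
  obtain x where x: "x < 7" "c p ! x = a"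
    using perm7D(1,2)[OF perm[OF assms(6)]] assms(7) by (metis in_set_conv_nth lessThan_iff)
  have "consistent_on (charts_of s T) (\<lambda>q. c q ! x)"
    unfolding consistent_on_def
  proof (intro conjI ballI impI)
    fix q assume "q \<in> charts_of s T"
    then show "c q ! x < 7" using perm7D(1,2)[OF perm] x(1) by (metis lessThan_iff nth_mem)
  next
    fix q r assume "q \<in> charts_of s T" "r \<in> charts_of s T" "(q, r) \<in> adjacent"
    then show "c r ! x = transition q r (c q ! x)"
      using c perm7D(1)[OF perm] x(1) by (simp add: potential_on_def)
  qed
  then show ?thesis using x(2) by blast
qed

text \<open>Both assignments are columns of one trivialization. Its lists are permutations, so equal
  values over one chart mean equal columns.\<close>

lemma consistent_unique:
  assumes "s \<in> dunce_faces" "T \<notin> dunce_faces" "F \<in> set facet_list" "T \<subseteq> set F" "s \<subseteq> T"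
    and p: "p \<in> charts_of s T" and f: "consistent_on (charts_of s T) f" "consistent_on (charts_of s T) f'" "f p = f' p"
    and q: "q \<in> charts_of s T"
  shows "f q = f' q"
proof -
  have "s \<noteq> {}" using p by (auto simp: charts_of_def)
  obtain c where c: "potential_on (charts_of s T) c" using potential_exists assms by metis
  obtain x where x: "x < 7" "\<And>p. p \<in> charts_of s T \<Longrightarrow> f p = c p ! x"
    using consistent_from_potential[OF assms(1) \<open>s \<noteq> {}\<close> assms(2-4) c f(1)] by blast
  obtain x' where x': "x' < 7" "\<And>p. p \<in> charts_of s T \<Longrightarrow> f' p = c p ! x'"
    using consistent_from_potential[OF assms(1) \<open>s \<noteq> {}\<close> assms(2-4) c f(2)] by blast
  have "perm7 (c p)" using c p by (auto simp: potential_on_def)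
  note perm7D[OF this]
  moreover have "c p ! x = c p ! x'" using x(2)[OF p] x'(2)[OF p] f(3) by simp
  ultimately have "x = x'" using x(1) x'(1) by (simp add: nth_eq_iff_index_eq)
  then show ?thesis using x(2)[OF q] x'(2)[OF q] by simp
qed

text \<open>The holonomy around a circle parallel to the boundary of the triangle with vertices 1, 4, 5.\<close>

lemma holonomy_no_fixed_point:
  "x < 7 \<Longrightarrow> transition (4, 0) (5, 0) (transition (1, 0) (4, 0) x) \<noteq> transition (1, 0) (5, 0) x"
proof -
  have "list_all (\<lambda>x. vertex_transition 4 5 0 ! (vertex_transition 1 4 0 ! x)
      \<noteq> vertex_transition 1 5 0 ! x) [0,1,2,3,4,5,6]"
    by code_simp
  moreover assume "x < 7"
  then have "x \<in> set [0,1,2,3,4,5,6]" by auto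
  ultimately show ?thesis by (auto simp: list_all_iff transition_def simp del: set_simps)
qed

section \<open>The boundary of the neighborhood\<close>

context cyclic_vertices
begin

lemma outer_face: "{1, 2, 3, 4, 5} \<in> cyclic_complex t - dunce_faces"
proof -
  have "set [1, 2, 3, 4, 5] \<in> cyclic_complex t" by (rule facet_in_complex) (simp add: facet_list_def)
  moreover have "\<not> dunce_face_list [1, 2, 3, 4, 5]" by code_simp
  ultimately show ?thesis by (simp add: dunce_face_list_iff)
qed

interpretation sphere_subcomplex v "cyclic_complex t" P dunce_faces
proof unfold_locales
  show "convex P" "compact P" by (simp_all add: cyclic_polytope_def finite_imp_compact_convex_hull)
  show "interior P \<noteq> {}" by (rule interior_P)
  show "frontier P = realization v (cyclic_complex t)" by (rule frontier_P)
  show "dunce_faces \<subseteq> cyclic_complex t" by (rule dunce_subset_complex)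
  show "\<And>C C'. C \<in> dunce_faces \<Longrightarrow> C' \<subseteq> C \<Longrightarrow> C' \<in> dunce_faces" by (rule dunce_faces_closed)
  have "{1} \<in> dunce_faces" by (auto simp: dunce_faces_def dunce_triangles_def)
  then show "dunce_faces - {{}} \<noteq> {}" by blast
  show "cyclic_complex t - dunce_faces \<noteq> {}" using outer_face by blast
qed

text \<open>On the level set the first factor is positive exactly if the vertex lies in the inner
  face, the second exactly if the facet contains the outer simplex. Sums over whole families of
  simplices are needed for this, as the chain varies from point to point.\<close>

definition chart_weight :: "nat \<times> nat \<Rightarrow> real ^ 5 \<Rightarrow> real"
  where "chart_weight p y = (\<Sum>s\<in>{s \<in> dunce_faces. fst p \<in> s}. sd_coord y s) *
    (\<Sum>T\<in>{T \<in> cyclic_complex t - dunce_faces. T \<subseteq> set (facet_list ! snd p)}. sd_coord y T)"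

definition chart_index :: "(nat \<times> nat) set"
  where "chart_index = charts_of {1..8} {}"

text \<open>The largest simplex of the chain of \<open>y\<close> in the dunce hat, and the smallest one outside.\<close>

definition inner_face :: "real ^ 5 \<Rightarrow> nat set"
  where "inner_face y = \<Union>{s \<in> dunce_faces. sd_coord y s \<noteq> 0}"

definition outer_simplex :: "real ^ 5 \<Rightarrow> nat set"
  where "outer_simplex y = \<Inter>{T. T \<notin> dunce_faces \<and> sd_coord y T \<noteq> 0}"

text \<open>On the level set both maxima are positive, so the chain of the point has members inside
  and outside the dunce hat. As the dunce hat is closed under faces, the inside ones are the smaller
  ones.\<close>

lemma level_faces:
  assumes y: "y \<in> level"
  shows "inner_face y \<in> dunce_faces" "outer_simplex y \<in> cyclic_complex t - dunce_faces"
    "inner_face y \<subseteq> outer_simplex y"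
    "sd_coord y (inner_face y) \<noteq> 0" "sd_coord y (outer_simplex y) \<noteq> 0" "inner_face y \<noteq> {}"
proof -
  have yf: "y \<in> frontier P" and yn: "y \<in> nbhd" and eq: "outer_coord y = inner_coord y"
    using y by (auto simp: level_def nbhd_def)
  note d = chain_weightsD[OF sd_weights[OF yf]]
  let ?A = "{s \<in> dunce_faces. sd_coord y s \<noteq> 0}" and ?B = "{T. T \<notin> dunce_faces \<and> sd_coord y T \<noteq> 0}"
  have pos: "0 < inner_coord y" by (rule inner_coord_pos[OF yn])
  obtain s where s: "s \<in> dunce_faces - {{}}" "inner_coord y = sd_coord y s" using inner_coord_attained by blast
  obtain T where T: "T \<in> cyclic_complex t - dunce_faces" "outer_coord y = sd_coord y T" using outer_coord_attained by blast
  have "s \<in> ?A" using s pos by auto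
  have "T \<in> ?B" using T pos eq by auto
  have finA: "finite ?A" and finB: "finite ?B" using d(1) by (auto intro: rev_finite_subset)
  have A: "inner_face y \<in> ?A"
    unfolding inner_face_def using finA \<open>s \<in> ?A\<close> d(3) by (intro chain_Union_in) auto
  then show 1: "inner_face y \<in> dunce_faces" "sd_coord y (inner_face y) \<noteq> 0" by auto
  show "inner_face y \<noteq> {}" using d(4)[OF 1(2)] by blast
  have B: "outer_simplex y \<in> ?B"
    unfolding outer_simplex_def
  proof (rule Inter_in_chain)
    show "finite ?B" by (rule finB)
    show "?B \<noteq> {}" using \<open>T \<in> ?B\<close> by blast
    show "subset.chain ?B ?B" using d(3) by (auto simp: subset_chain_def)
  qed
  then show 2: "sd_coord y (outer_simplex y) \<noteq> 0" "outer_simplex y \<in> cyclic_complex t - dunce_faces"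
    using d(5) by auto
  show "inner_face y \<subseteq> outer_simplex y"
    using d(3)[OF 1(2) 2(1)] dunce_faces_closed[OF 1(1)] 2(2) by auto
qed

lemma chart_weight_pos_iff:
  assumes y: "y \<in> level" and p: "p \<in> chart_index"
  shows "0 < chart_weight p y \<longleftrightarrow> p \<in> charts_of (inner_face y) (outer_simplex y)"
proof -
  have yf: "y \<in> frontier P" using y by (auto simp: level_def)
  note l = level_faces[OF y]
  let ?S = "{s \<in> dunce_faces. fst p \<in> s}"
  let ?T = "{T \<in> cyclic_complex t - dunce_faces. T \<subseteq> set (facet_list ! snd p)}"
  have fin: "finite ?S" "finite ?T" using finite_dunce_faces finite_complex by auto
  have nn: "0 \<le> sd_coord y u" for u by (rule sd_coord_nonneg[OF yf])
  have S: "sum (sd_coord y) ?S \<noteq> 0 \<longleftrightarrow> fst p \<in> inner_face y"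
    using sum_nonneg_eq_0_iff[OF fin(1), of "sd_coord y"] nn by (auto simp: inner_face_def)
  have T: "sum (sd_coord y) ?T \<noteq> 0 \<longleftrightarrow> outer_simplex y \<subseteq> set (facet_list ! snd p)"
  proof
    assume "sum (sd_coord y) ?T \<noteq> 0"
    then obtain u where u: "u \<in> ?T" "sd_coord y u \<noteq> 0" by (rule sum.not_neutral_contains_not_neutral)
    then show "outer_simplex y \<subseteq> set (facet_list ! snd p)" by (auto simp: outer_simplex_def)
  next
    assume "outer_simplex y \<subseteq> set (facet_list ! snd p)"
    then have "outer_simplex y \<in> ?T" using l(2) by auto
    then show "sum (sd_coord y) ?T \<noteq> 0"
      using sum_nonneg_eq_0_iff[OF fin(2), of "sd_coord y"] nn l(5) by blast
  qed
  have "0 \<le> chart_weight p y" unfolding chart_weight_def using nn by (intro mult_nonneg_nonneg sum_nonneg) auto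
  then have "0 < chart_weight p y \<longleftrightarrow> chart_weight p y \<noteq> 0" by auto
  also have "\<dots> \<longleftrightarrow> fst p \<in> inner_face y \<and> outer_simplex y \<subseteq> set (facet_list ! snd p)"
    unfolding chart_weight_def using S T by auto
  also have "\<dots> \<longleftrightarrow> p \<in> charts_of (inner_face y) (outer_simplex y)"
    using p by (cases p) (auto simp: chart_index_def mem_charts_of)
  finally show ?thesis .
qed

lemma inner_face_8: "y \<in> level \<Longrightarrow> inner_face y \<subseteq> {1..8}"
  using level_faces(1) dunce_subset_complex complex_subset by blast

interpretation local_system level chart_index chart_weight 7 adjacent transition
proof
  show "finite chart_index"
    by (rule finite_subset[of _ "{1..8} \<times> {..<length facet_list}"]) (auto simp: chart_index_def charts_of_def)
  fix p
  have "continuous_on (frontier P) (chart_weight p)"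
    unfolding chart_weight_def by (intro continuous_on_mult continuous_on_sum continuous_sd_coord)
  then show "continuous_on level (chart_weight p)"
    by (rule continuous_on_subset) (auto simp: level_def)
  fix y assume y: "y \<in> level"
  then have "y \<in> frontier P" by (simp add: level_def)
  then show "0 \<le> chart_weight p y"
    unfolding chart_weight_def using sd_coord_nonneg by (intro mult_nonneg_nonneg sum_nonneg) auto
next
  fix y assume y: "y \<in> level"
  note l = level_faces[OF y]
  obtain i where i: "i \<in> inner_face y" using l(6) by blast
  obtain k where k: "k < length facet_list" "outer_simplex y \<subseteq> set (facet_list ! k)"
    using l(2) complex_iff by (metis DiffD1 in_set_conv_nth)
  have "(i, k) \<in> chart_index" using i inner_face_8[OF y] k by (auto simp: chart_index_def mem_charts_of)
  then show "\<exists>p\<in>chart_index. 0 < chart_weight p y"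
    using chart_weight_pos_iff[OF y] i k by (metis mem_charts_of)
qed

lemma charts_at_level: "y \<in> level \<Longrightarrow> charts_at y = charts_of (inner_face y) (outer_simplex y)"
proof -
  assume y: "y \<in> level"
  have "charts_of (inner_face y) (outer_simplex y) \<subseteq> chart_index"
    using inner_face_8[OF y] by (auto simp: chart_index_def charts_of_def)
  then show ?thesis unfolding charts_at_def using chart_weight_pos_iff[OF y] by blast
qed

lemma consistent_level: "y \<in> level \<Longrightarrow> consistent y f \<longleftrightarrow> consistent_on (charts_of (inner_face y) (outer_simplex y)) f"
  by (simp add: consistent_def consistent_on_def charts_at_level)

text \<open>Points over the chain formed by a vertex \<open>i\<close>, an edge \<open>ij\<close> and the facet \<open>12345\<close>.\<close>

definition track :: "nat \<Rightarrow> nat \<Rightarrow> real \<Rightarrow> nat set \<Rightarrow> real"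
  where "track i j x S = (if S = {i} then min 1 (2 - 2 * x) else if S = {i, j} then min 1 (2 * x)
     else if S = {1, 2, 3, 4, 5} then 1 else 0) / (min 1 (2 - 2 * x) + min 1 (2 * x) + 1)"

definition track_point :: "nat \<Rightarrow> nat \<Rightarrow> real \<Rightarrow> real ^ 5"
  where "track_point i j x = bary_point (centroid v) (track i j x)"

context
  fixes i j :: nat
  assumes ij: "i \<noteq> j" "i \<in> {1, 4, 5}" "j \<in> {1, 4, 5}"
begin

lemma edge_faces: "{i} \<in> dunce_faces" "{i, j} \<in> dunce_faces"
proof -
  have "{1, 4} \<in> dunce_faces" "{4, 5} \<in> dunce_faces" "{1, 5} \<in> dunce_faces"
    by (auto simp: dunce_faces_def dunce_triangles_def)
  then show "{i, j} \<in> dunce_faces" using ij by (auto simp: insert_commute)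
  then show "{i} \<in> dunce_faces" by (rule dunce_faces_closed) auto
qed

lemma track_sets: "{i} \<noteq> {i, j}" "{i} \<noteq> {1, 2, 3, 4, 5}" "{i, j} \<noteq> {1, 2, 3, 4, 5}" "{i, j} \<subseteq> {1, 2, 3, 4, 5}"
proof -
  show "{i} \<noteq> {i, j}" using ij by auto
  have "2 \<notin> {i, j}" using ij by auto
  then show "{i} \<noteq> {1, 2, 3, 4, 5}" "{i, j} \<noteq> {1, 2, 3, 4, 5}" by auto
  show "{i, j} \<subseteq> {1, 2, 3, 4, 5}" using ij by auto
qed

lemma track_values:
  "track i j x {i} = min 1 (2 - 2 * x) / (min 1 (2 - 2 * x) + min 1 (2 * x) + 1)"
  "track i j x {i, j} = min 1 (2 * x) / (min 1 (2 - 2 * x) + min 1 (2 * x) + 1)"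
  "track i j x {1, 2, 3, 4, 5} = 1 / (min 1 (2 - 2 * x) + min 1 (2 * x) + 1)"
  "S \<noteq> {i} \<Longrightarrow> S \<noteq> {i, j} \<Longrightarrow> S \<noteq> {1, 2, 3, 4, 5} \<Longrightarrow> track i j x S = 0"
  using track_sets by (simp_all add: track_def)

lemma track_weights:
  assumes x: "0 \<le> x" "x \<le> 1"
  shows "track i j x \<in> weights (chains (cyclic_complex t))"
proof -
  let ?C = "{{i}, {i, j}, {1, 2, 3, 4, 5}}"
  have pos: "0 < min 1 (2 - 2 * x) + min 1 (2 * x) + 1" using x by (auto simp: min_def)
  have "?C \<in> chains (cyclic_complex t)"
  proof (rule chainsI)
    fix S assume "S \<in> ?C"
    then show "S \<in> cyclic_complex t \<and> S \<noteq> {}" using edge_faces dunce_subset_complex outer_face by auto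
  next
    fix S T assume "S \<in> ?C" "T \<in> ?C"
    then show "S \<subseteq> T \<or> T \<subseteq> S" using track_sets(4) by auto
  qed
  then have "Pow ?C \<subseteq> chains (cyclic_complex t)" using chains_subset by blast
  moreover have "track i j x \<in> weights (Pow ?C)"
  proof (rule weights_PowI)
    show "0 \<le> track i j x S" for S unfolding track_def using x pos by (auto simp: min_def)
    show "S \<notin> ?C \<Longrightarrow> track i j x S = 0" for S using track_values(4) by auto
    have "sum (track i j x) ?C = track i j x {i} + track i j x {i, j} + track i j x {1, 2, 3, 4, 5}"
      using track_sets by simp
    also have "\<dots> = 1" unfolding track_values add_divide_distrib[symmetric] using pos by simp
    finally show "sum (track i j x) ?C = 1" .
  qed simp
  ultimately show ?thesis using weights_mono by blast
qed

lemma track_point: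
  assumes x: "0 \<le> x" "x \<le> 1"
  shows "track_point i j x \<in> frontier P" "sd_coord (track_point i j x) = track i j x"
  unfolding track_point_def by (rule sd_point_weights[OF track_weights[OF x]])+

text \<open>At every \<open>x\<close> one of \<open>{i}\<close> and \<open>{i, j}\<close> carries
  the numerator 1, as the facet does, and no simplex carries more. So both maxima equal the inverse
  of the denominator.\<close>

lemma track_level:
  assumes x: "0 \<le> x" "x \<le> 1"
  shows "track_point i j x \<in> level"
proof -
  note tp = track_point[OF x]
  let ?m = "min 1 (2 - 2 * x) + min 1 (2 * x) + 1"
  have pos: "0 < ?m" using x by (auto simp: min_def)
  have le: "track i j x S \<le> 1 / ?m" for S
    unfolding track_def using pos by (auto simp: divide_right_mono)
  have one: "track i j x {i} = 1 / ?m \<or> track i j x {i, j} = 1 / ?m"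
    unfolding track_values by (cases "x \<le> 1 / 2") (auto simp: min_def)
  have "inner_coord (track_point i j x) = 1 / ?m"
  proof (rule antisym)
    show "inner_coord (track_point i j x) \<le> 1 / ?m" using inner_coord_attained[of "track_point i j x"] tp le by metis
    show "1 / ?m \<le> inner_coord (track_point i j x)"
      using one sd_coord_le_inner[OF edge_faces(1), of "track_point i j x"]
        sd_coord_le_inner[OF edge_faces(2), of "track_point i j x"] tp(2) by auto
  qed
  moreover have "outer_coord (track_point i j x) = 1 / ?m"
  proof (rule antisym)
    show "outer_coord (track_point i j x) \<le> 1 / ?m" using outer_coord_attained[of "track_point i j x"] tp le by metis
    show "1 / ?m \<le> outer_coord (track_point i j x)"
      using sd_coord_le_outer[of "{1, 2, 3, 4, 5}" "track_point i j x"] outer_face tp(2) track_values(3) by auto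
  qed
  ultimately show ?thesis using tp(1) by (simp add: level_def)
qed

text \<open>\<open>i\<close> belongs to both inner simplices of the track, \<open>j\<close> only to
  the edge, which has weight zero at \<open>x = 0\<close>.\<close>

lemma track_chart:
  assumes x: "0 \<le> x" "x \<le> 1"
  shows "(i, 0) \<in> charts_at (track_point i j x)" "0 < x \<Longrightarrow> (j, 0) \<in> charts_at (track_point i j x)"
proof -
  note tp = track_point[OF x] and tl = track_level[OF x]
  have pos: "0 < min 1 (2 - 2 * x) + min 1 (2 * x) + 1" using x by (auto simp: min_def)
  have "sd_coord (track_point i j x) {1, 2, 3, 4, 5} \<noteq> 0" unfolding tp(2) track_values using pos by simp
  then have o: "outer_simplex (track_point i j x) \<subseteq> set (facet_list ! 0)"
    using outer_face by (auto simp: outer_simplex_def facet_list_def)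
  have "track i j x {i} \<noteq> 0 \<or> track i j x {i, j} \<noteq> 0"
    unfolding track_values using pos by (cases "x \<le> 1 / 2") (auto simp: min_def)
  then have "i \<in> inner_face (track_point i j x)"
    unfolding inner_face_def tp(2) using edge_faces by auto
  then show "(i, 0) \<in> charts_at (track_point i j x)"
    unfolding charts_at_level[OF tl] using o by (simp add: mem_charts_of facet_list_def)
  assume "0 < x"
  then have "track i j x {i, j} \<noteq> 0" unfolding track_values using pos by (auto simp: min_def)
  then have "j \<in> inner_face (track_point i j x)"
    unfolding inner_face_def tp(2) using edge_faces by auto
  then show "(j, 0) \<in> charts_at (track_point i j x)"
    unfolding charts_at_level[OF tl] using o by (simp add: mem_charts_of facet_list_def)
qed

lemma connected_track: "connected (track_point i j ` {0..1})"
proof (rule connected_continuous_image)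
  have "track_point i j x = (\<Sum>S\<in>{{i}, {i, j}, {1, 2, 3, 4, 5}}. track i j x S *\<^sub>R centroid v S)" for x
    unfolding track_point_def by (rule bary_point_superset) (use track_values(4) in auto)
  then have eq: "track_point i j = (\<lambda>x. \<Sum>S\<in>{{i}, {i, j}, {1, 2, 3, 4, 5}}. track i j x S *\<^sub>R centroid v S)"
    by (rule ext)
  have cond: "continuous_on A (\<lambda>x. if c then f x else h x)"
    if "continuous_on A f" "continuous_on A h" for A :: "real set" and c and f h :: "real \<Rightarrow> real"
    using that by (cases c) auto
  have "min 1 (2 - 2 * x) + min 1 (2 * x) + 1 \<noteq> 0" if "x \<in> {0..1}" for x :: real
    using that by (auto simp: min_def)
  then have "continuous_on {0..1} (\<lambda>x. track i j x S)" for S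
    unfolding track_def by (intro continuous_on_divide cond continuous_intros) simp_all
  then show "continuous_on {0..1} (track_point i j)" unfolding eq by (intro continuous_on_sum continuous_intros)
qed auto

lemma track_start: "track i j 0 = (\<lambda>S. if S = {i} \<or> S = {1, 2, 3, 4, 5} then 1 / 2 else 0)"
proof
  fix S
  show "track i j 0 S = (if S = {i} \<or> S = {1, 2, 3, 4, 5} then 1 / 2 else 0)"
    by (cases "S = {i, j}"; cases "S = {i}"; cases "S = {1, 2, 3, 4, 5}")
      (use track_values[of 0] track_values(4)[of S 0] track_sets in simp_all)
qed

lemma track_end: "track i j 1 = (\<lambda>S. if S = {i, j} \<or> S = {1, 2, 3, 4, 5} then 1 / 2 else 0)"
proof
  fix S
  show "track i j 1 S = (if S = {i, j} \<or> S = {1, 2, 3, 4, 5} then 1 / 2 else 0)"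
    by (cases "S = {i, j}"; cases "S = {i}"; cases "S = {1, 2, 3, 4, 5}")
      (use track_values[of 1] track_values(4)[of S 1] track_sets in simp_all)
qed

end

lemma level_not_sphere: "\<not> level homeomorphic sphere (0 :: real ^ 4) 1"
proof
  assume hom: "level homeomorphic sphere (0 :: real ^ 4) 1"
  have sc: "simply_connected level"
    using homeomorphic_simply_connected_eq[OF hom] simply_connected_sphere[of "0 :: real ^ 4" 1] by simp
  have lpc: "locally path_connected level"
  proof -
    have "locally path_connected level \<longleftrightarrow> locally path_connected (sphere (0 :: real ^ 4) 1)"
      by (rule homeomorphic_locally[OF hom]) (rule homeomorphic_path_connectedness)
    then show ?thesis by (simp add: locally_path_connected_sphere)
  qed
  have ex: "\<exists>f. consistent y f \<and> f p = a" if y: "y \<in> level" and p: "p \<in> charts_at y" and a: "a < 7" for y p a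
  proof -
    note l = level_faces[OF y]
    obtain F where "F \<in> set facet_list" "outer_simplex y \<subseteq> set F" using l(2) complex_iff by blast
    then show ?thesis
      using consistent_extends[OF l(1) _ _ _ l(3)] l(2) p a by (simp add: consistent_level[OF y] charts_at_level[OF y])
  qed
  have un: "f q = f' q" if y: "y \<in> level" and p: "p \<in> charts_at y" and f: "consistent y f" "consistent y f'" "f p = f' p"
    and q: "q \<in> charts_at y" for y p q f f'
  proof -
    note l = level_faces[OF y]
    obtain F where "F \<in> set facet_list" "outer_simplex y \<subseteq> set F" using l(2) complex_iff by blast
    then show ?thesis
      using consistent_unique[OF l(1) _ _ _ l(3), of F p f f' q] l(2) p f q
      by (simp add: consistent_level[OF y] charts_at_level[OF y])
  qed
  have "\<exists>\<sigma>. (\<forall>y\<in>level. consistent y (\<sigma> y)) \<and>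
     (\<forall>p\<in>chart_index. \<forall>a. openin (top_of_set level) {y \<in> level. 0 < chart_weight p y \<and> \<sigma> y p = a})"
  proof (rule global_section)
    show "\<exists>f. consistent y f \<and> f p = a" if "y \<in> level" "p \<in> charts_at y" "a < 7" for y p a
      by (rule ex[OF that])
    show "f q = f' q"
      if "y \<in> level" "p \<in> charts_at y" "consistent y f" "consistent y f'" "f p = f' p" "q \<in> charts_at y" for y p q f f'
      by (rule un[OF that])
    show "simply_connected level" "locally path_connected level" "0 < (7 :: nat)" using sc lpc by simp_all
    fix \<sigma> assume a: "\<And>y. y \<in> level \<Longrightarrow> consistent y (\<sigma> y)"
      and b: "\<And>p a. p \<in> chart_index \<Longrightarrow> openin (top_of_set level) {y \<in> level. 0 < chart_weight p y \<and> \<sigma> y p = a}"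
    show "\<exists>\<sigma>. (\<forall>y\<in>level. consistent y (\<sigma> y)) \<and>
     (\<forall>p\<in>chart_index. \<forall>a. openin (top_of_set level) {y \<in> level. 0 < chart_weight p y \<and> \<sigma> y p = a})"
      by (intro exI[of _ \<sigma>] conjI ballI allI a b)
  qed
  then obtain \<sigma> where \<sigma>: "\<And>y. y \<in> level \<Longrightarrow> consistent y (\<sigma> y)"
    "\<And>p a. p \<in> chart_index \<Longrightarrow> openin (top_of_set level) {y \<in> level. 0 < chart_weight p y \<and> \<sigma> y p = a}"
    by blast
  \<comment> \<open>Along the track from \<open>i\<close> the sheet over \<open>(i, 0)\<close> is
    constant up to the end on the edge. There the chart \<open>(j, 0)\<close> is present as well and
    the transition applies; the track from \<open>j\<close> is then followed backwards.\<close>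
  have step: "\<sigma> (track_point j i 0) (j, 0) = transition (i, 0) (j, 0) (\<sigma> (track_point i j 0) (i, 0))"
    if ij: "i < j" "i \<in> {1, 4, 5}" "j \<in> {1, 4, 5}" for i j
  proof -
    have neq: "i \<noteq> j" using ij by simp
    have const: "\<sigma> (track_point i j 0) (i, 0) = \<sigma> (track_point i j 1) (i, 0)"
      if ij: "i \<noteq> j" "i \<in> {1, 4, 5}" "j \<in> {1, 4, 5}" for i j
    proof (rule locally_constant_on_connected[OF connected_track[OF ij], where X = level and f = "\<lambda>y. \<sigma> y (i, 0)"
          and Q = "\<lambda>y. 0 < chart_weight (i, 0) y"])
      show "track_point i j ` {0..1} \<subseteq> level" using track_level[OF ij] by auto
      have "(i, 0) \<in> charts_at (track_point i j 0)" using track_chart(1)[OF ij] by simp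
      then show "openin (top_of_set level) {y \<in> level. 0 < chart_weight (i, 0) y \<and> \<sigma> y (i, 0) = a}" for a
        by (intro \<sigma>(2)) (simp add: charts_at_def)
      fix y assume "y \<in> track_point i j ` {0..1}"
      then show "0 < chart_weight (i, 0) y" using track_chart(1)[OF ij] by (auto simp: charts_at_def)
    qed auto
    have m: "track_point i j 1 \<in> level" using track_level[OF neq ij(2,3)] by simp
    have "(i, 0) \<in> charts_at (track_point i j 1)" "(j, 0) \<in> charts_at (track_point i j 1)"
      using track_chart[OF neq ij(2,3), of 1] by auto
    moreover have "((i, 0), (j, 0)) \<in> adjacent" using ij(1) by (simp add: adjacent_def)
    ultimately have "\<sigma> (track_point i j 1) (j, 0) = transition (i, 0) (j, 0) (\<sigma> (track_point i j 1) (i, 0))"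
      using \<sigma>(1)[OF m] by (simp add: consistent_def)
    \<comment> \<open>The two tracks end at the same point, since \<open>track_end\<close> is
      symmetric in \<open>i\<close> and \<open>j\<close>.\<close>
    then show ?thesis
      using const[OF neq ij(2,3)] const[OF neq[symmetric] ij(3,2)]
        track_end[OF neq ij(2,3)] track_end[OF neq[symmetric] ij(3,2)]
      by (simp add: track_point_def insert_commute)
  qed
  define x where "x = \<sigma> (track_point 1 4 0) (1, 0)"
  have "\<sigma> (track_point 4 1 0) (4, 0) = transition (1, 0) (4, 0) x" unfolding x_def by (rule step) auto
  moreover have "\<sigma> (track_point 5 4 0) (5, 0) = transition (4, 0) (5, 0) (\<sigma> (track_point 4 5 0) (4, 0))" by (rule step) auto
  moreover have "\<sigma> (track_point 5 1 0) (5, 0) = transition (1, 0) (5, 0) (\<sigma> (track_point 1 5 0) (1, 0))" by (rule step) auto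
  \<comment> \<open>By \<open>track_start\<close> the starting point of a track depends only on its
    first vertex, so the three steps can be composed.\<close>
  ultimately have "transition (4, 0) (5, 0) (transition (1, 0) (4, 0) x) = transition (1, 0) (5, 0) x"
    unfolding x_def by (simp add: track_point_def track_start)
  moreover have "x < 7"
  proof -
    have y: "track_point 1 4 0 \<in> level" "(1, 0) \<in> charts_at (track_point 1 4 0)"
      using track_level[of 1 4 0] track_chart(1)[of 1 4 0] by auto
    then show ?thesis using \<sigma>(1)[OF y(1)] unfolding x_def consistent_def by blast
  qed
  ultimately show False using holonomy_no_fixed_point by blast
qed

lemma regular_neighborhood_dunce: "regular_neighborhood (boundary_complex P) (\<Union>(dunce_complex t)) = nbhd"
  unfolding regular_neighborhood_eq nbhd_alt ..

lemma neighborhood_properties: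
  "four_manifold_with_boundary nbhd" "contractible nbhd"
  "\<not> four_manifold_boundary nbhd homeomorphic sphere (0 :: real ^ 4) 1"
  "\<not> nbhd homeomorphic cball (0 :: real ^ 4) 1"
  using four_manifold_nbhd contractible_nbhd[OF contractible_dunce] level_not_sphere
    not_ball[OF level_not_sphere] by (simp_all add: boundary_nbhd)

lemmas neighborhood_of_dunce_hat = neighborhood_properties[folded regular_neighborhood_dunce]

end

theorem corollary10p1:
  fixes t :: "nat \<Rightarrow> real"
  assumes "strict_mono_on {1..8} t"
  shows
    "let D = dunce_complex t;
         B = boundary_complex (cyclic_polytope t 8);
         N = regular_neighborhood B (\<Union>D)
     in simplicial_complex D \<and> is_dunce_hat (\<Union>D) \<and> D \<subseteq> B \<and>
        four_manifold_with_boundary N \<and> contractible N \<and>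
        \<not> four_manifold_boundary N homeomorphic sphere (0 :: real ^ 4) 1 \<and>
        \<not> N homeomorphic cball (0 :: real ^ 4) 1"
proof -
  interpret cyclic_vertices t by unfold_locales (rule assms)
  show ?thesis
    unfolding Let_def
    using simplicial_dunce_complex dunce_hat dunce_complex_boundary neighborhood_of_dunce_hat by blast
qed

end
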